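(* Let $I \subseteq \mathbb{R}$ be an open interval. Consider a curve of monic polynomials \[ P(t)(z) = z^n + \sum_{j=1}^n (-1)^j a_j(t) z^{n-j}, \qquad t\in I, \] such that the coefficients $a_j : I \to \mathbb{C}$, $1 \le j \le n$, are of class $C^n$. Then the following conditions are equivalent: (1) There exists a global (i.e. defined on all of $I$) differentiable parameterization of the roots of $P$. (2) There exists a global continuous parameterization $\lambda_1,\ldots,\lambda_n$ of the roots of $P$ with order of contact $\ge 1$, i.e. whenever $\lambda_i(t_0)=\lambda_j(t_0)$ for some $t_0\in I$ and $i\neq j$, then $m_{t_0}(\lambda_i-\lambda_j)\ge 1$. (3) For every $t_0 \in I$ the following holds: let $l$ be the number of distinct roots of $P(t_0)$ and let $P(t) = P_1(t) \cdots P_l(t)$ be the splitting of $P$ near $t_0$ into monic factors, where $P_1(t_0),\ldots,P_l(t_0)$ have each exactly one distinct root and pairwise no common root. Then $m_{t_0}(\tilde \Delta_k(P_i)) \ge k(k-1)$, for all $1 \le i \le l$ and $2 \le k \le \deg P_i$.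
   Context: A (continuous, differentiable) parameterization of the roots of $P$ on $I$ is an $n$-tuple of (continuous, differentiable) functions $\lambda_1,\ldots,\lambda_n : I\to\mathbb{C}$ such that $P(t)(z)=\prod_{j=1}^n(z-\lambda_j(t))$ for all $t\in I$. For a continuous function $f$ defined near $t_0$, the multiplicity $m_{t_0}(f)\in\{0,1,2,\ldots,\infty\}$ is the supremum of all integers $p$ such that $f(t)=(t-t_0)^p g(t)$ near $t_0$ for a continuous function $g$. For a monic polynomial $Q$ of degree $d$ with roots $\mu_1,\ldots,\mu_d\in\mathbb{C}$ (with multiplicity) and $1\le k\le d$ put \[ \tilde\Delta_k(Q) := \sum_{1\le i_1<\cdots<i_k\le d}\ \prod_{1\le p<q\le k} (\mu_{i_p}-\mu_{i_q})^2 , \] a polynomial in the coefficients of $Q$; $m_{t_0}(\tilde\Delta_k(P_i))$ denotes the multiplicity at $t_0$ of $t\mapsto\tilde\Delta_k(P_i(t))$. Splitting: if a monic polynomial $P_0$ factors as a product of monic polynomials without common roots, then every monic polynomial $P$ of the same degree with coefficients near those of $P_0$ factors correspondingly into monic factors depending real analytically on $P$, with the given initial values at $P_0$. Applied to $P_0=P(t_0)=\prod_{i=1}^l (z-\nu_i)^{m_i}$ with $\nu_1,\ldots,\nu_l$ distinct, this gives $P(t)=P_1(t)\cdots P_l(t)$ for $t$ near $t_0$, with $P_i$ a curve of monic polynomials of degree $m_i$ with $C^n$ coefficients and $P_i(t_0)=(z-\nu_i)^{m_i}$. *)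

theory Defs
  imports
    "HOL-Analysis.Analysis"
    "HOL-Computational_Algebra.Computational_Algebra"
    "HOL-Combinatorics.Combinatorics"
    "HOL-Library.Extended_Nat"
begin

definition monic_curve :: "nat \<Rightarrow> (nat \<Rightarrow> real \<Rightarrow> complex) \<Rightarrow> real \<Rightarrow> complex poly" where
  "monic_curve n a t = monom 1 n + (\<Sum>j=1..n. monom ((-1) ^ j * a j t) (n - j))"

text \<open>\<open>Ck_on k f S\<close>: the curve \<open>f\<close> is of class \<open>C\<^sup>k\<close> (real differentiability) on \<open>S\<close>;
  only open \<open>S\<close> are intended.\<close>

primrec Ck_on :: "nat \<Rightarrow> (real \<Rightarrow> complex) \<Rightarrow> real set \<Rightarrow> bool" where
  "Ck_on 0 f S \<longleftrightarrow> continuous_on S f"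
| "Ck_on (Suc k) f S \<longleftrightarrow>
     (\<exists>f'. (\<forall>t\<in>S. (f has_vector_derivative f' t) (at t within S)) \<and> Ck_on k f' S)"

definition root_tuple :: "nat \<Rightarrow> (nat \<Rightarrow> complex) \<Rightarrow> complex poly \<Rightarrow> bool" where
  "root_tuple d \<mu> Q \<longleftrightarrow> Q = (\<Prod>j=1..d. [:- \<mu> j, 1:])"

definition root_parameterization ::
  "nat \<Rightarrow> (nat \<Rightarrow> real \<Rightarrow> complex) \<Rightarrow> (real \<Rightarrow> complex poly) \<Rightarrow> real set \<Rightarrow> bool" where
  "root_parameterization n \<rho> P I \<longleftrightarrow> (\<forall>t\<in>I. root_tuple n (\<lambda>j. \<rho> j t) (P t))"

definition mult_at :: "real \<Rightarrow> (real \<Rightarrow> complex) \<Rightarrow> enat" where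
  "mult_at t0 f = Sup {enat p | p. \<exists>g. \<exists>e>0. continuous_on (ball t0 e) g \<and>
     (\<forall>t\<in>ball t0 e. f t = of_real (t - t0) ^ p * g t)}"

text \<open>The index tuples \<open>i\<^sub>1 < \<dots> < i\<^sub>k\<close> are encoded as the subsets \<open>A\<close> of \<open>{1..d}\<close> with \<open>k\<close> elements.\<close>

definition Delta_tuple :: "nat \<Rightarrow> nat \<Rightarrow> (nat \<Rightarrow> complex) \<Rightarrow> complex" where
  "Delta_tuple k d \<mu> = (\<Sum>A | A \<subseteq> {1..d} \<and> card A = k. \<Prod>i\<in>A. \<Prod>j\<in>{j\<in>A. i < j}. (\<mu> i - \<mu> j)\<^sup>2)"

text \<open>The value does not depend on the chosen enumeration of the roots, see \<open>Delta_eq\<close> below.\<close>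

definition Delta :: "nat \<Rightarrow> complex poly \<Rightarrow> complex" where
  "Delta k Q = Delta_tuple k (degree Q) (SOME \<mu>. root_tuple (degree Q) \<mu> Q)"

text \<open>\<open>Q 1, \<dots>, Q l\<close> is the splitting near \<open>t0\<close> of the curve of polynomials \<open>P\<close> with \<open>C\<^sup>n\<close>
  coefficients. As a germ at \<open>t0\<close>, it is unique up to the order of the factors.\<close>

definition splitting_at ::
  "nat \<Rightarrow> (real \<Rightarrow> complex poly) \<Rightarrow> real \<Rightarrow> nat \<Rightarrow> (nat \<Rightarrow> real \<Rightarrow> complex poly) \<Rightarrow> bool" where
  "splitting_at n P t0 l Q \<longleftrightarrow>
     (\<exists>\<nu> m. inj_on \<nu> {1..l} \<and> (\<forall>i\<in>{1..l}. 1 \<le> m i \<and> Q i t0 = [:- \<nu> i, 1:] ^ m i) \<and>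
       (\<exists>e>0. (\<forall>t\<in>ball t0 e. P t = (\<Prod>i=1..l. Q i t)) \<and>
         (\<forall>i\<in>{1..l}. (\<forall>t\<in>ball t0 e. lead_coeff (Q i t) = 1 \<and> degree (Q i t) = m i) \<and>
           (\<forall>j. Ck_on n (\<lambda>t. coeff (Q i t) j) (ball t0 e)))))"

lemma root_tuple_degree: "root_tuple d \<mu> Q \<Longrightarrow> degree Q = d"
  unfolding root_tuple_def by (simp add: degree_prod_eq_sum_degree)

lemma root_tuple_proots:
  assumes "root_tuple d \<mu> Q"
  shows "proots Q = image_mset \<mu> (mset_set {1..d})"
proof -
  have "proots Q = (\<Sum>j=1..d. {#\<mu> j#})"
    using assms unfolding root_tuple_def by (simp add: proots_prod)
  also have "\<dots> = image_mset \<mu> (mset_set {1..d})"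
    by (induction d) (auto simp: atLeastAtMostSuc_conv)
  finally show ?thesis .
qed

lemma prod_square_diff:
  fixes f :: "nat \<Rightarrow> complex"
  assumes "finite A"
  shows "(\<Prod>i\<in>A. \<Prod>j\<in>{j\<in>A. i < j}. (f i - f j)\<^sup>2) =
    (-1) ^ (card A * (card A - 1) div 2) * (\<Prod>i\<in>A. \<Prod>j\<in>A - {i}. f i - f j)"
  using assms
proof (induction A rule: finite_linorder_max_induct)
  case empty
  then show ?case by simp
next
  case (insert b A)
  have b: "b \<notin> A" using insert by auto
  have L: "(\<Prod>i\<in>insert b A. \<Prod>j\<in>{j\<in>insert b A. i < j}. (f i - f j)\<^sup>2)
     = (\<Prod>i\<in>A. (f i - f b)\<^sup>2) * (\<Prod>i\<in>A. \<Prod>j\<in>{j\<in>A. i < j}. (f i - f j)\<^sup>2)"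
  proof -
    have 1: "{j\<in>insert b A. b < j} = {}" using insert by force
    have 2: "{j\<in>insert b A. i < j} = insert b {j\<in>A. i < j}" if "i \<in> A" for i
      using insert that by auto
    have "(\<Prod>i\<in>A. \<Prod>j\<in>{j\<in>insert b A. i < j}. (f i - f j)\<^sup>2)
      = (\<Prod>i\<in>A. (f i - f b)\<^sup>2 * (\<Prod>j\<in>{j\<in>A. i < j}. (f i - f j)\<^sup>2))"
      by (rule prod.cong) (use 2 insert b in auto)
    then show ?thesis using insert b by (simp only: prod.insert[OF insert(1) b] 1) (simp add: prod.distrib)
  qed
  have R: "(\<Prod>i\<in>insert b A. \<Prod>j\<in>insert b A - {i}. f i - f j)
     = (-1) ^ card A * (\<Prod>i\<in>A. (f i - f b)\<^sup>2) * (\<Prod>i\<in>A. \<Prod>j\<in>A - {i}. f i - f j)"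
  proof -
    have 1: "insert b A - {b} = A" using b by auto
    have 2: "insert b A - {i} = insert b (A - {i})" if "i \<in> A" for i using b that by auto
    have "(\<Prod>i\<in>A. \<Prod>j\<in>insert b A - {i}. f i - f j)
      = (\<Prod>i\<in>A. (f i - f b) * (\<Prod>j\<in>A - {i}. f i - f j))"
      by (rule prod.cong) (use 2 insert b in auto)
    moreover have "(\<Prod>j\<in>A. f b - f j) = (-1) ^ card A * (\<Prod>j\<in>A. f j - f b)"
      by (subst prod_constant[symmetric], subst prod.distrib[symmetric]) simp
    ultimately show ?thesis
      by (simp only: prod.insert[OF insert(1) b] 1) (simp add: prod.distrib power2_eq_square)
  qed
  have c: "card (insert b A) * (card (insert b A) - 1) div 2 = card A * (card A - 1) div 2 + card A"
  proof -
    have "card (insert b A) = Suc (card A)" using insert(1) b by simp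
    moreover have "Suc m * m div 2 = m * (m - 1) div 2 + m" for m :: nat
    proof -
      have "Suc m * m = m * (m - 1) + m * 2" by (cases m) auto
      then show ?thesis by simp
    qed
    ultimately show ?thesis by simp
  qed
  have s: "(-1) ^ card A * (-1) ^ card A = (1::complex)"
    by (simp flip: power_add mult_2)
  show ?case unfolding L R c insert.IH power_add using s by (simp add: algebra_simps)
qed

lemma Delta_tuple_permutes:
  assumes "\<pi> permutes {1..d}"
  shows "Delta_tuple k d (\<mu> \<circ> \<pi>) = Delta_tuple k d \<mu>"
proof -
  define h where "h f A = (\<Prod>i\<in>A. \<Prod>j\<in>{j\<in>A. i < j}. (f i - f j)\<^sup>2)"
    for f :: "nat \<Rightarrow> complex" and A :: "nat set"
  have inj: "inj \<pi>" using assms by (rule permutes_inj)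
  have h: "h (\<mu> \<circ> \<pi>) A = h \<mu> (\<pi> ` A)" if "finite A" for A
  proof -
    have i: "inj_on \<pi> B" for B using inj by (rule inj_on_subset) simp
    have "\<pi> ` A - {\<pi> x} = \<pi> ` (A - {x})" for x
      using inj by (auto simp: inj_def)
    then have "(\<Prod>x\<in>\<pi> ` A. \<Prod>y\<in>\<pi> ` A - {x}. \<mu> x - \<mu> y)
      = (\<Prod>x\<in>A. \<Prod>y\<in>A - {x}. \<mu> (\<pi> x) - \<mu> (\<pi> y))"
      by (simp add: prod.reindex[OF i])
    then show ?thesis
      using that unfolding h_def by (simp add: prod_square_diff card_image[OF i])
  qed
  have "bij_betw ((`) \<pi>) {A. A \<subseteq> {1..d} \<and> card A = k} {A. A \<subseteq> {1..d} \<and> card A = k}"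
  proof (rule bij_betw_byWitness[where f' = "(`) (inv \<pi>)"])
    have *: "(`) \<sigma> ` {A. A \<subseteq> {1..d} \<and> card A = k} \<subseteq> {A. A \<subseteq> {1..d} \<and> card A = k}"
      if "\<sigma> permutes {1..d}" for \<sigma>
    proof safe
      fix A x assume "A \<subseteq> {1..d}" "x \<in> A"
      then show "\<sigma> x \<in> {1..d}" using permutes_in_image[OF that] by blast
    next
      fix A :: "nat set"
      show "card (\<sigma> ` A) = card A"
        by (rule card_image, rule inj_on_subset[OF permutes_inj[OF that]]) simp
    qed
    show "(`) (inv \<pi>) ` {A. A \<subseteq> {1..d} \<and> card A = k} \<subseteq> {A. A \<subseteq> {1..d} \<and> card A = k}"
      by (rule *[OF permutes_inv[OF assms]])
    show "(`) \<pi> ` {A. A \<subseteq> {1..d} \<and> card A = k} \<subseteq> {A. A \<subseteq> {1..d} \<and> card A = k}"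
      by (rule *[OF assms])
  qed (use permutes_inverses[OF assms] in \<open>auto simp: image_image\<close>)
  then have "(\<Sum>A | A \<subseteq> {1..d} \<and> card A = k. h \<mu> (\<pi> ` A)) = (\<Sum>A | A \<subseteq> {1..d} \<and> card A = k. h \<mu> A)"
    by (rule sum.reindex_bij_betw)
  moreover have "(\<Sum>A | A \<subseteq> {1..d} \<and> card A = k. h (\<mu> \<circ> \<pi>) A) = (\<Sum>A | A \<subseteq> {1..d} \<and> card A = k. h \<mu> (\<pi> ` A))"
    by (rule sum.cong) (auto intro!: h finite_subset[of _ "{1..d}"])
  ultimately show ?thesis unfolding Delta_tuple_def h_def by simp
qed

lemma Delta_tuple_cong:
  assumes "\<And>j. j \<in> {1..d} \<Longrightarrow> \<mu> j = \<mu>' j"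
  shows "Delta_tuple k d \<mu> = Delta_tuple k d \<mu>'"
  unfolding Delta_tuple_def
  by (intro sum.cong prod.cong refl) (use assms in \<open>auto simp: subset_eq\<close>)

lemma Delta_eq:
  assumes "root_tuple d \<mu> Q"
  shows "Delta k Q = Delta_tuple k d \<mu>"
proof -
  have d: "degree Q = d" using assms by (rule root_tuple_degree)
  define \<mu>' where "\<mu>' = (SOME \<mu>. root_tuple (degree Q) \<mu> Q)"
  have "root_tuple d \<mu>' Q" unfolding \<mu>'_def d by (rule someI[of _ \<mu>]) (rule assms)
  then have "image_mset \<mu>' (mset_set {1..d}) = image_mset \<mu> (mset_set {1..d})"
    using root_tuple_proots assms by metis
  then obtain \<pi> where "\<pi> permutes {1..d}" "\<forall>x\<in>{1..d}. \<mu>' x = \<mu> (\<pi> x)"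
    using image_mset_eq_implies_permutes[of "{1..d}" \<mu>' \<mu>] by auto
  then have "Delta_tuple k d \<mu>' = Delta_tuple k d \<mu>"
    using Delta_tuple_permutes[of \<pi> d k \<mu>] Delta_tuple_cong[of d \<mu>' "\<mu> \<circ> \<pi>" k] by simp
  then show ?thesis by (simp add: Delta_def \<mu>'_def d)
qed

lemma root_tuple_exists:
  assumes "lead_coeff Q = 1"
  shows "\<exists>\<mu>. root_tuple (degree Q) \<mu> Q"
proof -
  obtain xs where xs: "mset xs = proots Q" using ex_mset by blast
  have Q: "Q = (\<Prod>x\<in>#proots Q. [:- x, 1:])"
    using assms complex_poly_decompose_multiset[of Q] by simp
  have len: "length xs = degree Q" using xs size_proots_complex[of Q] by (metis size_mset)
  have "Q = prod_list (map (\<lambda>x. [:- x, 1:]) xs)"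
    using Q by (metis mset_map prod_mset_prod_list xs)
  also have "\<dots> = (\<Prod>i<length xs. [:- xs ! i, 1:])"
    by (simp add: prod.list_conv_set_nth atLeast0LessThan)
  also have "\<dots> = (\<Prod>j=1..length xs. [:- xs ! (j - 1), 1:])"
    by (rule prod.reindex_bij_witness[of _ "\<lambda>j. j - 1" Suc]) auto
  finally show ?thesis unfolding root_tuple_def len
    by (intro exI[of _ "\<lambda>j. xs ! (j - 1)"])
qed

end

theory Submission
  imports Defs "Jordan_Normal_Form.Determinant"
begin

text \<open>
  All three conditions are compared with a local contact condition: near \<open>t0\<close>, the roots of \<open>P t\<close>
  close to a given root of \<open>P t0\<close> have mutual distances \<open>O(\<bar>t - t0\<bar>)\<close>.

  Condition (3) implies contact because, by compactness, the diameter \<open>D\<close> of a tuple of roots satisfies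
  \<open>c D\<^bsup>k(k-1)\<^esup> \<le> \<bar>\<Delta>\<^sub>k\<bar>\<close> for some \<open>k\<close>: if a tuple has exactly \<open>k\<close> distinct values, then \<open>\<Delta>\<^sub>k\<close> does not
  vanish on it. If all roots of \<open>P t0\<close> equal \<open>\<nu>\<close>, contact and Taylor's formula show that the polynomial
  with roots \<open>(\<lambda>\<^sub>j - \<nu>) / (t - t0)\<close> has a limit at \<open>t0\<close>. So the one-sided derivatives of continuous roots
  exist, and they form the same multiset on both sides. Parameterizations that are differentiable on both
  sides of \<open>t0\<close> can therefore be glued after a permutation; a differentiable parameterization on the whole
  interval is obtained by induction on the degree, splitting \<open>P\<close> where it has at least two distinct roots.

  For (2) \<open>\<Longrightarrow>\<close> (1), the sum over a cluster of roots is a coefficient of a factor of \<open>P\<close> and hence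
  differentiable, and so are the differences of roots in the cluster.

  The splitting is of class \<open>C\<^sup>n\<close> because it is continuous, by continuity of the roots, and
  its derivative solves a linear system whose determinant is the resultant of the coprime factors.
\<close>

section \<open>Curves of class \<open>C\<^sup>k\<close>\<close>

text \<open>Each summand of \<open>Delta k\<close> is, up to sign, a product of
  \<open>k * (k - 1)\<close> differences of roots, so differences of size O(|t - t0|) predict the
  exponent in (3). The discriminant alone would not do: it vanishes identically as soon as a factor
  has a persistent multiple root, and then the smaller \<open>k\<close> carry the information. From
  (1) both other conditions follow because a differentiable function that vanishes at
  \<open>t0\<close> is \<open>t - t0\<close> times a continuous one. The smoothness is spent on
  turning bounds into limits: for a cluster of d roots the recentred coefficient of z^i is O(|t -
  t0|^(d-i)), and a Taylor expansion of order d-i \<le> n keeps its quotient by (t - t0)^(d-i) from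
  oscillating. The obstacle is that collisions of roots may accumulate, so they cannot be passed one
  after the other. What helps is that the derivatives may be discontinuous: gluing at a point has to
  match only values and first derivatives there.\<close>

lemma Ck_on_subset: "Ck_on k f S \<Longrightarrow> T \<subseteq> S \<Longrightarrow> Ck_on k f T"
proof (induction k arbitrary: f)
  case (Suc k)
  then obtain f' where f': "\<forall>t\<in>S. (f has_vector_derivative f' t) (at t within S)" "Ck_on k f' S"
    by auto
  have "\<forall>t\<in>T. (f has_vector_derivative f' t) (at t within T)"
    using f'(1) Suc.prems(2) by (meson has_vector_derivative_within_subset subsetD)
  then show ?case using f' Suc by auto
qed (auto intro: continuous_on_subset)

lemma Ck_on_cong:
  assumes "\<And>t. t \<in> S \<Longrightarrow> f t = g t"
  shows "Ck_on k f S \<longleftrightarrow> Ck_on k g S"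
proof -
  have "Ck_on k h S" if "Ck_on k f S" "\<And>t. t \<in> S \<Longrightarrow> f t = h t" for f h
  proof (cases k)
    case 0
    with that show ?thesis by (simp cong: continuous_on_cong)
  next
    case (Suc m)
    then obtain f' where f': "\<forall>t\<in>S. (f has_vector_derivative f' t) (at t within S)" "Ck_on m f' S"
      using \<open>Ck_on k f S\<close> by auto
    have "\<forall>t\<in>S. (h has_vector_derivative f' t) (at t within S)"
      using f'(1) that(2) by (metis has_vector_derivative_transform)
    with f' Suc show ?thesis by auto
  qed
  with assms show ?thesis by metis
qed

lemma Ck_on_imp_continuous_on: "Ck_on k f S \<Longrightarrow> continuous_on S f"
  by (cases k) (auto simp: continuous_on_eq_continuous_within intro: has_vector_derivative_continuous)

lemma Ck_on_SucD: "Ck_on (Suc k) f S \<Longrightarrow> Ck_on k f S"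
proof (induction k arbitrary: f)
  case 0
  then show ?case using Ck_on_imp_continuous_on by (metis Ck_on.simps(1))
next
  case (Suc k)
  then obtain f' where "\<forall>t\<in>S. (f has_vector_derivative f' t) (at t within S)" "Ck_on (Suc k) f' S"
    using Ck_on.simps(2) by blast
  then show ?case using Suc.IH by auto
qed

lemma Ck_on_mono: "Ck_on n f S \<Longrightarrow> k \<le> n \<Longrightarrow> Ck_on k f S"
proof (induction n)
  case (Suc n)
  then show ?case using Ck_on_SucD by (cases "k = Suc n") auto
qed simp

lemma Ck_on_const [simp]: "Ck_on k (\<lambda>t. c) S"
proof (induction k arbitrary: c)
  case (Suc k)
  then show ?case by (auto intro!: exI[of _ "\<lambda>t. 0"] derivative_eq_intros)
qed simp

lemma Ck_on_add: "Ck_on k f S \<Longrightarrow> Ck_on k g S \<Longrightarrow> Ck_on k (\<lambda>t. f t + g t) S"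
proof (induction k arbitrary: f g)
  case (Suc k)
  then obtain f' g' where *: "\<forall>t\<in>S. (f has_vector_derivative f' t) (at t within S)" "Ck_on k f' S"
      "\<forall>t\<in>S. (g has_vector_derivative g' t) (at t within S)" "Ck_on k g' S" by auto
  have "\<forall>t\<in>S. ((\<lambda>t. f t + g t) has_vector_derivative f' t + g' t) (at t within S)"
    using * by (auto intro: has_vector_derivative_add)
  moreover have "Ck_on k (\<lambda>t. f' t + g' t) S"
    using * by (auto intro: Suc.IH)
  ultimately show ?case by (auto intro!: exI[of _ "\<lambda>t. f' t + g' t"])
qed (auto intro: continuous_intros)

lemma Ck_on_mult: "Ck_on k f S \<Longrightarrow> Ck_on k g S \<Longrightarrow> Ck_on k (\<lambda>t. f t * g t) S"
proof (induction k arbitrary: f g)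
  case (Suc k)
  then obtain f' g' where *: "\<forall>t\<in>S. (f has_vector_derivative f' t) (at t within S)" "Ck_on k f' S"
      "\<forall>t\<in>S. (g has_vector_derivative g' t) (at t within S)" "Ck_on k g' S" by auto
  have "\<forall>t\<in>S. ((\<lambda>t. f t * g t) has_vector_derivative f t * g' t + f' t * g t) (at t within S)"
    using * by (auto intro: has_vector_derivative_mult)
  moreover have "Ck_on k (\<lambda>t. f t * g' t + f' t * g t) S"
    using * Suc.prems by (intro Ck_on_add Suc.IH) (auto dest: Ck_on_SucD simp del: Ck_on.simps)
  ultimately show ?case by (auto intro!: exI[of _ "\<lambda>t. f t * g' t + f' t * g t"])
qed (auto intro: continuous_intros)

lemma Ck_on_sum: "(\<And>i. i \<in> A \<Longrightarrow> Ck_on k (f i) S) \<Longrightarrow> Ck_on k (\<lambda>t. \<Sum>i\<in>A. f i t) S"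
  by (induction A rule: infinite_finite_induct) (auto intro: Ck_on_add)

lemma Ck_on_prod: "(\<And>i. i \<in> A \<Longrightarrow> Ck_on k (f i) S) \<Longrightarrow> Ck_on k (\<lambda>t. \<Prod>i\<in>A. f i t) S"
  by (induction A rule: infinite_finite_induct) (auto intro: Ck_on_mult)

lemma Ck_on_inverse:
  "Ck_on k f S \<Longrightarrow> (\<And>t. t \<in> S \<Longrightarrow> f t \<noteq> 0) \<Longrightarrow> Ck_on k (\<lambda>t. inverse (f t)) S"
proof (induction k)
  case (Suc k)
  then obtain f' where f': "\<forall>t\<in>S. (f has_vector_derivative f' t) (at t within S)" "Ck_on k f' S"
    by auto
  \<comment> \<open>Writing the derivative -f' / f^2 as nested products lets the product rule for
    class C^k and the induction hypothesis for 1 / f finish.\<close>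
  have "((\<lambda>t. inverse (f t)) has_vector_derivative - 1 * (f' t * (inverse (f t) * inverse (f t)))) (at t within S)"
    if "t \<in> S" for t
  proof -
    have "f t \<noteq> 0" using Suc.prems that by auto
    then have "(inverse has_field_derivative - (inverse (f t) ^ 2)) (at (f t))"
      by (auto intro!: derivative_eq_intros simp: power2_eq_square)
    moreover have "(f has_vector_derivative f' t) (at t within S)" using f' that by auto
    ultimately have "((inverse \<circ> f) has_vector_derivative f' t * - (inverse (f t) ^ 2)) (at t within S)"
      by (intro field_vector_diff_chain_within[of f "f' t" t S inverse])
         (auto intro: has_field_derivative_at_within)
    then show ?thesis by (simp add: o_def power2_eq_square)
  qed
  moreover have "Ck_on k (\<lambda>t. - 1 * (f' t * (inverse (f t) * inverse (f t)))) S"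
    using f' Suc.IH[OF Ck_on_SucD[OF Suc.prems(1)] Suc.prems(2)] by (intro Ck_on_mult Ck_on_const)
  ultimately show ?case by (auto intro!: exI[of _ "\<lambda>t. - 1 * (f' t * (inverse (f t) * inverse (f t)))"])
qed (auto intro: continuous_intros)

text \<open>Taylor's formula with Peano remainder. The Taylor polynomial of \<open>f'\<close> is
  integrated, and the mean value inequality raises the order of the remainder by one. The clause
  \<open>poly p 0 = f t0\<close> serves the induction: applied to \<open>f'\<close>, it makes the
  derivative of the new remainder vanish at \<open>t0\<close>.\<close>

lemma Ck_on_taylor:
  assumes "Ck_on k f (ball t0 e)" "e > 0"
  shows "\<exists>p. poly p 0 = f t0 \<and>
    ((\<lambda>t. (f t - poly p (of_real (t - t0))) / of_real (t - t0) ^ k) \<longlongrightarrow> 0) (at t0)"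
  using assms
proof (induction k arbitrary: f)
  case 0
  then have "isCont f t0"
    by (simp add: continuous_on_eq_continuous_at)
  then have "((\<lambda>t. f t - f t0) \<longlongrightarrow> 0) (at t0)"
    unfolding isCont_def by (rule LIM_zero)
  then show ?case by (intro exI[of _ "[:f t0:]"]) simp
next
  case (Suc k)
  then obtain f' where f': "\<forall>t\<in>ball t0 e. (f has_vector_derivative f' t) (at t within ball t0 e)"
    "Ck_on k f' (ball t0 e)" by auto
  then obtain p where p: "poly p 0 = f' t0"
    "((\<lambda>t. (f' t - poly p (of_real (t - t0))) / of_real (t - t0) ^ k) \<longlongrightarrow> 0) (at t0)"
    using Suc by blast
  define q where "q = pCons (f t0) (\<Sum>i\<le>degree p. monom (coeff p i / of_nat (Suc i)) i)"
  have q: "pderiv q = p"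
  proof (rule poly_eqI)
    fix i
    show "coeff (pderiv q) i = coeff p i"
      by (simp add: coeff_pderiv q_def coeff_sum coeff_eq_0 del: of_nat_Suc)
  qed
  define g where "g t = f t - poly q (of_real (t - t0))" for t
  define g' where "g' t = f' t - poly p (of_real (t - t0))" for t
  have g': "(g has_vector_derivative g' t) (at t within ball t0 e)" if "t \<in> ball t0 e" for t
  proof -
    have "((\<lambda>t. of_real (t - t0) :: complex) has_vector_derivative 1) (at t within ball t0 e)"
      by (auto intro!: derivative_eq_intros has_vector_derivative_of_real
          simp: has_real_derivative_iff_has_vector_derivative[symmetric])
    then have "((poly q \<circ> (\<lambda>t. of_real (t - t0) :: complex)) has_vector_derivative
       1 * poly (pderiv q) (of_real (t - t0))) (at t within ball t0 e)"
      by (intro field_vector_diff_chain_within) (auto intro: has_field_derivative_at_within poly_DERIV)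
    then show ?thesis
      unfolding g_def[abs_def] g'_def q using f' that by (auto intro: has_vector_derivative_diff simp: o_def)
  qed
  have g0: "g t0 = 0" by (simp add: g_def q_def)
  have g'0: "g' t0 = 0" by (simp add: g'_def p)
  have "((\<lambda>t. g t / of_real (t - t0) ^ Suc k) \<longlongrightarrow> 0) (at t0)"
    unfolding tendsto_iff
  proof (intro allI impI)
    fix r :: real assume "r > 0"
    have "\<forall>\<^sub>F t in at t0. dist (g' t / of_real (t - t0) ^ k) 0 < r / 2"
      using p(2) \<open>r > 0\<close> unfolding g'_def tendsto_iff by (meson half_gt_zero)
    then obtain d where d: "d > 0" "\<And>t. dist t t0 < d \<Longrightarrow> t \<noteq> t0 \<Longrightarrow> norm (g' t / of_real (t - t0) ^ k) < r / 2"
      unfolding eventually_at by (auto simp: dist_norm)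
    have "norm (g t / of_real (t - t0) ^ Suc k) < r" if t: "dist t t0 < min d e" "t \<noteq> t0" for t
    proof -
      have sub: "closed_segment t0 t \<subseteq> ball t0 e" using t \<open>e > 0\<close>
        by (intro closed_segment_subset) (auto simp: dist_commute)
      have bd: "norm (g' s - g' t0) \<le> r / 2 * \<bar>t - t0\<bar> ^ k" if s: "s \<in> closed_segment t0 t" for s
      proof (cases "s = t0")
        case True
        then show ?thesis using \<open>r > 0\<close> by simp
      next
        case False
        have le: "\<bar>s - t0\<bar> \<le> \<bar>t - t0\<bar>" using s
          by (auto simp: closed_segment_eq_real_ivl split: if_splits)
        then have "norm (g' s / of_real (s - t0) ^ k) < r / 2"
          using d(2)[of s] t False by (simp add: dist_norm)
        then have "norm (g' s) \<le> r / 2 * \<bar>s - t0\<bar> ^ k"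
          using False by (simp add: norm_divide norm_power field_simps flip: of_real_diff)
        also have "\<dots> \<le> r / 2 * \<bar>t - t0\<bar> ^ k"
          using le \<open>r > 0\<close> by (intro mult_left_mono power_mono) auto
        finally show ?thesis by (simp add: g'0)
      qed
      \<comment> \<open>Both \<open>g\<close> and \<open>g'\<close> vanish at \<open>t0\<close>, so
        the linearization at \<open>t0\<close> is zero and only the bound on \<open>g'\<close> along
        the segment remains.\<close>
      have "norm (g t - g t0 - (t - t0) *\<^sub>R g' t0) \<le> norm (t - t0) * (r / 2 * \<bar>t - t0\<bar> ^ k)"
        by (rule vector_differentiable_bound_linearization[where S = "closed_segment t0 t" and f' = g'])
          (use bd sub in \<open>auto intro: has_vector_derivative_within_subset[OF g' sub]\<close>)
      then have "norm (g t) \<le> r / 2 * \<bar>t - t0\<bar> ^ Suc k" by (simp add: g0 g'0 mult_ac)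
      moreover have "\<bar>t - t0\<bar> ^ Suc k > 0" using t by simp
      ultimately have "norm (g t) / \<bar>t - t0\<bar> ^ Suc k \<le> r / 2" by (simp only: pos_divide_le_eq)
      then have "norm (g t) / \<bar>t - t0\<bar> ^ Suc k < r" using \<open>r > 0\<close> by linarith
      then show ?thesis
        by (simp add: norm_divide norm_mult norm_power flip: of_real_diff)
    qed
    moreover have "min d e > 0" using d \<open>e > 0\<close> by simp
    ultimately show "\<forall>\<^sub>F t in at t0. dist (g t / of_real (t - t0) ^ Suc k) 0 < r"
      unfolding eventually_at by (intro exI[of _ "min d e"]) (simp add: dist_norm)
  qed
  then show ?case by (intro exI[of _ q]) (simp add: g_def q_def)
qed

text \<open>The bound forces the coefficients of \<open>p\<close> below degree \<open>k\<close> to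
  vanish, so the quotient is again a polynomial in \<open>t - t0\<close>. Each induction step
  removes one factor.\<close>

lemma poly_bound_imp_quotient_tendsto:
  fixes p :: "complex poly"
  assumes "\<forall>\<^sub>F t in at t0. norm (poly p (of_real (t - t0))) \<le> C * \<bar>t - t0\<bar> ^ k"
  shows "\<exists>L. ((\<lambda>t. poly p (of_real (t - t0)) / of_real (t - t0) ^ k) \<longlongrightarrow> L) (at t0)"
  using assms
proof (induction k arbitrary: p)
  case 0
  have "((\<lambda>t. poly p (of_real (t - t0))) \<longlongrightarrow> poly p (of_real (t0 - t0))) (at t0)"
    by (intro tendsto_intros)
  then show ?case by auto
next
  case (Suc k)
  have "((\<lambda>t. poly p (of_real (t - t0))) \<longlongrightarrow> poly p (of_real (t0 - t0))) (at t0)"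
    by (intro tendsto_intros)
  moreover have "((\<lambda>t. poly p (of_real (t - t0))) \<longlongrightarrow> 0) (at t0)"
  proof (rule Lim_null_comparison[OF Suc.prems])
    have "((\<lambda>t. C * \<bar>t - t0\<bar> ^ Suc k) \<longlongrightarrow> C * \<bar>t0 - t0\<bar> ^ Suc k) (at t0)"
      by (intro tendsto_intros)
    then show "((\<lambda>t. C * \<bar>t - t0\<bar> ^ Suc k) \<longlongrightarrow> 0) (at t0)" by simp
  qed
  ultimately have "poly p (of_real (t0 - t0)) = 0" by (rule tendsto_unique[rotated]) simp
  then obtain q where q: "p = pCons 0 q" by (cases p) auto
  have neq: "\<forall>\<^sub>F t in at t0. t \<noteq> t0" by (auto simp: eventually_at intro: exI[of _ 1])
  have "\<forall>\<^sub>F t in at t0. norm (poly q (of_real (t - t0))) \<le> C * \<bar>t - t0\<bar> ^ k"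
    using Suc.prems neq
  proof eventually_elim
    case (elim t)
    then have "\<bar>t - t0\<bar> * norm (poly q (of_real (t - t0))) \<le> \<bar>t - t0\<bar> * (C * \<bar>t - t0\<bar> ^ k)"
      by (simp add: q norm_mult mult_ac flip: of_real_diff)
    then show ?case using elim by simp
  qed
  then obtain L where L: "((\<lambda>t. poly q (of_real (t - t0)) / of_real (t - t0) ^ k) \<longlongrightarrow> L) (at t0)"
    using Suc.IH by blast
  have "\<forall>\<^sub>F t in at t0. poly q (of_real (t - t0)) / of_real (t - t0) ^ k =
      poly p (of_real (t - t0)) / of_real (t - t0) ^ Suc k"
    using neq by eventually_elim (simp add: q flip: of_real_diff)
  with L show ?case by (blast intro: Lim_transform_eventually)
qed

text \<open>Up to a remainder o(|t - t0|^k), \<open>f\<close> is a polynomial in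
  \<open>t - t0\<close>; the polynomial inherits the bound and therefore cannot oscillate after the
  division.\<close>

lemma Ck_on_bound_imp_quotient_tendsto:
  assumes "Ck_on k f (ball t0 e)" "e > 0"
    and "\<forall>\<^sub>F t in at t0. norm (f t) \<le> C * \<bar>t - t0\<bar> ^ k"
  shows "\<exists>L. ((\<lambda>t. f t / of_real (t - t0) ^ k) \<longlongrightarrow> L) (at t0)"
proof -
  obtain p where p: "((\<lambda>t. (f t - poly p (of_real (t - t0))) / of_real (t - t0) ^ k) \<longlongrightarrow> 0) (at t0)"
    using Ck_on_taylor[OF assms(1,2)] by blast
  have "\<forall>\<^sub>F t in at t0. norm ((f t - poly p (of_real (t - t0))) / of_real (t - t0) ^ k) < 1"
    using p unfolding tendsto_iff by (force simp: dist_norm)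
  moreover have "\<forall>\<^sub>F t in at t0. t \<noteq> t0" by (auto simp: eventually_at intro: exI[of _ 1])
  \<comment> \<open>The additional 1 absorbs the Taylor remainder, which is eventually at most |t -
    t0|^k.\<close>
  ultimately have "\<forall>\<^sub>F t in at t0. norm (poly p (of_real (t - t0))) \<le> (C + 1) * \<bar>t - t0\<bar> ^ k"
    using assms(3)
  proof eventually_elim
    case (elim t)
    then have "norm (f t - poly p (of_real (t - t0))) \<le> \<bar>t - t0\<bar> ^ k"
      by (simp add: norm_divide norm_power field_simps flip: of_real_diff)
    with elim(3) norm_triangle_ineq2[of "poly p (of_real (t - t0))" "f t"] show ?case
      by (simp add: algebra_simps norm_minus_commute)
  qed
  then obtain L where "((\<lambda>t. poly p (of_real (t - t0)) / of_real (t - t0) ^ k) \<longlongrightarrow> L) (at t0)"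
    using poly_bound_imp_quotient_tendsto by blast
  from tendsto_add[OF p this] show ?thesis by (auto simp: diff_divide_distrib)
qed

section \<open>Coprime factors of polynomial curves\<close>

definition poly_tendsto :: "('a \<Rightarrow> complex poly) \<Rightarrow> complex poly \<Rightarrow> 'a filter \<Rightarrow> bool" where
  "poly_tendsto Q Q0 F \<longleftrightarrow> (\<forall>j. ((\<lambda>t. coeff (Q t) j) \<longlongrightarrow> coeff Q0 j) F)"

definition Ck_poly_on :: "nat \<Rightarrow> (real \<Rightarrow> complex poly) \<Rightarrow> real set \<Rightarrow> bool" where
  "Ck_poly_on k Q S \<longleftrightarrow> (\<forall>j. Ck_on k (\<lambda>t. coeff (Q t) j) S)"

lemma poly_tendsto_const [simp]: "poly_tendsto (\<lambda>t. Q) Q F"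
  by (simp add: poly_tendsto_def)

lemma poly_tendsto_mult:
  "poly_tendsto Q Q0 F \<Longrightarrow> poly_tendsto R R0 F \<Longrightarrow> poly_tendsto (\<lambda>t. Q t * R t) (Q0 * R0) F"
  by (auto simp: poly_tendsto_def coeff_mult intro!: tendsto_intros)

lemma poly_tendsto_prod:
  "(\<And>i. i \<in> A \<Longrightarrow> poly_tendsto (Q i) (Q0 i) F) \<Longrightarrow> poly_tendsto (\<lambda>t. \<Prod>i\<in>A. Q i t) (\<Prod>i\<in>A. Q0 i) F"
  by (induction A rule: infinite_finite_induct) (auto intro: poly_tendsto_mult)

lemma poly_tendsto_linear: "(x \<longlongrightarrow> x0) F \<Longrightarrow> poly_tendsto (\<lambda>t. [:- x t, 1:]) [:- x0, 1:] F"
  by (auto simp: poly_tendsto_def coeff_pCons split: nat.split intro: tendsto_intros)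

lemma poly_tendsto_cong:
  "\<forall>\<^sub>F t in F. Q t = R t \<Longrightarrow> poly_tendsto Q Q0 F \<longleftrightarrow> poly_tendsto R Q0 F"
  unfolding poly_tendsto_def by (intro all_cong1 tendsto_cong) (auto elim: eventually_mono)

lemma poly_eq_sum_upto:
  fixes p :: "complex poly"
  shows "degree p \<le> d \<Longrightarrow> poly p x = (\<Sum>i\<le>d. coeff p i * x ^ i)"
  unfolding poly_altdef by (rule sum.mono_neutral_left) (auto simp: coeff_eq_0)

text \<open>Coefficientwise convergence does not control terms whose degree grows along the filter.
  The uniform bound \<open>d\<close> makes evaluation one fixed finite sum.\<close>

lemma poly_tendsto_imp_tendsto_poly:
  assumes "poly_tendsto Q Q0 F" "\<And>t. degree (Q t) \<le> d" "degree Q0 \<le> d" "(x \<longlongrightarrow> x0) F"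
  shows "((\<lambda>t. poly (Q t) (x t)) \<longlongrightarrow> poly Q0 x0) F"
  unfolding poly_eq_sum_upto[OF assms(2)] poly_eq_sum_upto[OF assms(3)]
  using assms(1,4) by (auto simp: poly_tendsto_def intro!: tendsto_intros)

lemma Ck_poly_on_imp_tendsto:
  assumes "Ck_poly_on k Q S" "open S" "t0 \<in> S"
  shows "poly_tendsto Q (Q t0) (at t0)"
  using assms unfolding Ck_poly_on_def poly_tendsto_def
  by (meson Ck_on_imp_continuous_on continuous_on_eq_continuous_at isCont_def)

lemma Ck_poly_on_differentiable:
  assumes "Ck_poly_on n P S" "1 \<le> n" "open S" "t0 \<in> S"
  shows "\<exists>l. ((\<lambda>t. coeff (P t) j) has_vector_derivative l) (at t0)"
proof -
  have "Ck_on 1 (\<lambda>t. coeff (P t) j) S"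
    by (rule Ck_on_mono[of n]) (use assms(1,2) in \<open>auto simp: Ck_poly_on_def\<close>)
  then obtain f' where "\<forall>t\<in>S. ((\<lambda>t. coeff (P t) j) has_vector_derivative f' t) (at t within S)"
    unfolding One_nat_def Ck_on.simps by blast
  then show ?thesis using assms(4) unfolding at_within_open[OF assms(4,3), symmetric] by blast
qed

section \<open>Sylvester matrices and the equation X R + Y Q = T\<close>

definition sylv :: "nat \<Rightarrow> nat \<Rightarrow> complex poly \<Rightarrow> complex poly \<Rightarrow> complex mat" where
  "sylv p q R Q = mat (p + q) (p + q)
     (\<lambda>(i, j). if j < p then coeff (monom 1 j * R) i else coeff (monom 1 (j - p) * Q) i)"

text \<open>Pairs with deg X < p and deg Y < q are encoded so that \<open>sylv p q R Q\<close> acts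
  as (X, Y) |-> X R + Y Q: its columns are the coefficients of z^j R and z^j Q. For deg Q = p and
  deg R = q its determinant is, up to sign, the resultant.\<close>

definition sylv_vec :: "nat \<Rightarrow> nat \<Rightarrow> complex poly \<Rightarrow> complex poly \<Rightarrow> complex vec" where
  "sylv_vec p q X Y = vec (p + q) (\<lambda>j. if j < p then coeff X j else coeff Y (j - p))"

lemma sylv_carrier [simp]: "sylv p q R Q \<in> carrier_mat (p + q) (p + q)"
  by (simp add: sylv_def)

lemma poly_eq_sum_monom:
  assumes "\<forall>j\<ge>p. coeff X j = 0"
  shows "X = (\<Sum>j<p. monom (coeff X j) j)"
  by (rule poly_eqI) (use assms in \<open>auto simp: coeff_sum not_less\<close>)

lemma coeff_mult_eq_sum:
  fixes X R :: "complex poly"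
  assumes "\<forall>j\<ge>p. coeff X j = 0"
  shows "coeff (X * R) i = (\<Sum>j<p. coeff X j * coeff (monom 1 j * R) i)"
proof -
  have "X * R = (\<Sum>j<p. Polynomial.smult (coeff X j) (monom 1 j * R))"
    by (subst poly_eq_sum_monom[OF assms]) (simp add: sum_distrib_right smult_monom flip: mult_smult_left)
  then show ?thesis by (simp add: coeff_sum)
qed

lemma sylv_mult_vec:
  assumes "\<forall>j\<ge>p. coeff X j = 0" "\<forall>j\<ge>q. coeff Y j = 0"
  shows "sylv p q R Q *\<^sub>v sylv_vec p q X Y = vec (p + q) (coeff (X * R + Y * Q))"
proof (rule eq_vecI)
  fix i assume "i < dim_vec (vec (p + q) (coeff (X * R + Y * Q)))"
  then have i: "i < p + q" by simp
  let ?f = "\<lambda>j. (if j < p then coeff (monom 1 j * R) i else coeff (monom 1 (j - p) * Q) i) *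
    (if j < p then coeff X j else coeff Y (j - p))"
  have "(sylv p q R Q *\<^sub>v sylv_vec p q X Y) $ i = (\<Sum>j = 0..<p + q. ?f j)"
    using i by (simp add: sylv_def sylv_vec_def scalar_prod_def)
  also have "{0..<p + q} = {..<p} \<union> {p..<p + q}" by auto
  also have "sum ?f \<dots> = (\<Sum>j<p. ?f j) + (\<Sum>j=p..<p + q. ?f j)"
    by (rule sum.union_disjoint) auto
  also have "(\<Sum>j=p..<p + q. ?f j) = (\<Sum>j<q. coeff Y j * coeff (monom 1 j * Q) i)"
    by (rule sum.reindex_bij_witness[of _ "\<lambda>j. j + p" "\<lambda>j. j - p"]) auto
  also have "(\<Sum>j<p. ?f j) = (\<Sum>j<p. coeff X j * coeff (monom 1 j * R) i)"
    by (rule sum.cong) auto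
  finally show "(sylv p q R Q *\<^sub>v sylv_vec p q X Y) $ i = vec (p + q) (coeff (X * R + Y * Q)) $ i"
    using i by (simp add: coeff_mult_eq_sum[OF assms(1)] coeff_mult_eq_sum[OF assms(2)])
qed (simp add: sylv_def)

text \<open>Euclid's lemma, with coprimality expressed by roots as suits an algebraically closed
  field. A root of \<open>Q\<close> must be a root of \<open>X\<close>, so linear factors are
  cancelled one at a time.\<close>

lemma no_common_root_dvd_mult:
  fixes Q R X :: "complex poly"
  assumes "Q dvd X * R" "\<And>z. poly Q z = 0 \<Longrightarrow> poly R z \<noteq> 0" "Q \<noteq> 0"
  shows "Q dvd X"
  using assms
proof (induction "degree Q" arbitrary: Q X)
  case 0
  then show ?case using is_unit_iff_degree unit_imp_dvd by metis
next
  case (Suc d)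
  then have "\<not> constant (poly Q)" by (simp add: constant_degree)
  then obtain z where z: "poly Q z = 0" using fundamental_theorem_of_algebra by blast
  then obtain Q' where Q': "Q = [:- z, 1:] * Q'" by (auto simp: poly_eq_0_iff_dvd)
  have "poly (X * R) z = 0" using Suc.prems(1) z by (metis dvdE mult_zero_left poly_mult)
  then have "poly X z = 0" using Suc.prems(2) z by auto
  then obtain X' where X': "X = [:- z, 1:] * X'" by (auto simp: poly_eq_0_iff_dvd)
  have "[:- z, 1:] * Q' dvd [:- z, 1:] * (X' * R)"
    using Suc.prems(1) unfolding Q' X' by (simp only: mult.assoc)
  then have "Q' dvd X' * R" by (subst (asm) dvd_mult_cancel_left) auto
  moreover have "Q' \<noteq> 0" using Suc.prems(3) Q' by auto
  moreover from this have "d = degree Q'" using Suc.hyps(2) unfolding Q' by (subst (asm) degree_mult_eq) auto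
  moreover have "poly Q' z = 0 \<Longrightarrow> poly R z \<noteq> 0" for z using Suc.prems(2)[of z] Q' by simp
  ultimately have "Q' dvd X'" using Suc.hyps(1) by blast
  then show ?case unfolding Q' X' by (rule mult_dvd_mono[OF dvd_refl])
qed

text \<open>A kernel vector is a relation X R = - Y Q with deg X < deg Q. Coprimality gives Q | X,
  hence X = 0, and then Y = 0.\<close>

lemma det_sylv_nonzero:
  assumes "\<And>z. poly Q z = 0 \<Longrightarrow> poly R z \<noteq> 0" "degree Q = p" "degree R = q" "Q \<noteq> 0" "R \<noteq> 0"
  shows "det (sylv p q R Q) \<noteq> 0"
proof
  assume "det (sylv p q R Q) = 0"
  then obtain v where v: "v \<in> carrier_vec (p + q)" "v \<noteq> 0\<^sub>v (p + q)"
    "sylv p q R Q *\<^sub>v v = 0\<^sub>v (p + q)"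
    using det_0_iff_vec_prod_zero[OF sylv_carrier] by blast
  define X where "X = (\<Sum>j<p. monom (v $ j) j)"
  define Y where "Y = (\<Sum>j<q. monom (v $ (j + p)) j)"
  have cX: "coeff X j = (if j < p then v $ j else 0)" for j by (auto simp: X_def coeff_sum)
  have cY: "coeff Y j = (if j < q then v $ (j + p) else 0)" for j by (auto simp: Y_def coeff_sum)
  have vv: "v = sylv_vec p q X Y"
    using v(1) by (intro eq_vecI) (auto simp: sylv_vec_def cX cY)
  have "vec (p + q) (coeff (X * R + Y * Q)) = 0\<^sub>v (p + q)"
    using v(3) sylv_mult_vec[of p X q Y R Q] vv cX cY by auto
  then have c0: "coeff (X * R + Y * Q) i = 0" if "i < p + q" for i
    using that by (metis index_vec index_zero_vec(1))
  \<comment> \<open>The kernel equation speaks only of the coefficients below \<open>p + q\<close>;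
    the others vanish for reasons of degree.\<close>
  have "coeff (X * R + Y * Q) i = 0" for i
  proof (cases "i < p + q")
    case False
    have "coeff (X * R) i = 0"
    proof (cases "X = 0")
      case False
      then have "degree X < p" using cX by (metis leading_coeff_0_iff)
      then have "degree (X * R) < p + q" using assms degree_mult_le[of X R] by linarith
      then show ?thesis using \<open>\<not> i < p + q\<close> by (auto intro: coeff_eq_0)
    qed simp
    moreover have "coeff (Y * Q) i = 0"
    proof (cases "Y = 0")
      case False
      then have "degree Y < q" using cY by (metis leading_coeff_0_iff)
      then have "degree (Y * Q) < p + q" using assms degree_mult_le[of Y Q] by linarith
      then show ?thesis using \<open>\<not> i < p + q\<close> by (auto intro: coeff_eq_0)
    qed simp
    ultimately show ?thesis by simp
  qed (rule c0)
  then have eq: "X * R + Y * Q = 0" by (auto intro: poly_eqI)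
  then have "X * R = - (Y * Q)" by (simp only: eq_neg_iff_add_eq_0)
  then have "Q dvd X * R" by simp
  then have "Q dvd X" by (rule no_common_root_dvd_mult) (use assms in auto)
  have X0: "X = 0"
  proof (rule ccontr)
    assume "X \<noteq> 0"
    then have "degree X < p" using cX by (metis leading_coeff_0_iff)
    moreover have "p \<le> degree X" using dvd_imp_degree_le[OF \<open>Q dvd X\<close> \<open>X \<noteq> 0\<close>] assms by simp
    ultimately show False by simp
  qed
  then have "Y = 0" using eq assms by simp
  with X0 vv have "v = 0\<^sub>v (p + q)" by (auto simp: sylv_vec_def)
  with v show False by simp
qed

text \<open>Cramer's rule in division-free form. It makes the coefficients of \<open>X\<close>
  quotients of polynomials in the coefficients of \<open>R\<close>, \<open>Q\<close> and
  \<open>T\<close>, so limits and smoothness pass to \<open>X\<close> without an a priori bound on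
  it.\<close>

lemma sylv_cramer:
  assumes "X * R + Y * Q = T" "\<forall>j\<ge>p. coeff X j = 0" "\<forall>j\<ge>q. coeff Y j = 0" "j < p"
  shows "coeff X j * det (sylv p q R Q) = det (replace_col (sylv p q R Q) (vec (p + q) (coeff T)) j)"
proof -
  have "det (replace_col (sylv p q R Q) (sylv p q R Q *\<^sub>v sylv_vec p q X Y) j)
     = sylv_vec p q X Y $ j * det (sylv p q R Q)"
    by (rule cramer_lemma_mat[OF sylv_carrier]) (use assms in \<open>auto simp: sylv_vec_def\<close>)
  then show ?thesis using assms by (simp add: sylv_mult_vec) (simp add: sylv_vec_def)
qed

lemma index_sylv:
  "i < p + q \<Longrightarrow> j < p + q \<Longrightarrow> sylv p q R Q $$ (i, j) =
     (if j < p then coeff (monom 1 j * R) i else coeff (monom 1 (j - p) * Q) i)"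
  by (simp add: sylv_def)

lemma index_replace_col_sylv:
  "i < p + q \<Longrightarrow> j < p + q \<Longrightarrow> replace_col (sylv p q R Q) (vec (p + q) (coeff T)) l $$ (i, j) =
     (if j = l then coeff T i else sylv p q R Q $$ (i, j))"
  by (simp add: replace_col_def sylv_def)

lemma replace_col_sylv_carrier: "replace_col (sylv p q R Q) v l \<in> carrier_mat (p + q) (p + q)"
  by (simp add: replace_col_def sylv_def)

lemma tendsto_det:
  assumes "\<And>t. M t \<in> carrier_mat n n"
    and "\<And>i j. i < n \<Longrightarrow> j < n \<Longrightarrow> ((\<lambda>t. M t $$ (i, j)) \<longlongrightarrow> L i j) F"
  shows "((\<lambda>t. det (M t) :: complex) \<longlongrightarrow> det (mat n n (\<lambda>(i, j). L i j))) F"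
proof -
  have "((\<lambda>t. \<Sum>\<pi> | \<pi> permutes {0..<n}. signof \<pi> * (\<Prod>i = 0..<n. M t $$ (i, \<pi> i)))
    \<longlongrightarrow> (\<Sum>\<pi> | \<pi> permutes {0..<n}. signof \<pi> * (\<Prod>i = 0..<n. L i (\<pi> i)))) F"
    by (intro tendsto_intros assms(2)) (auto dest: permutes_in_image)
  moreover have "det (mat n n (\<lambda>(i, j). L i j)) =
      (\<Sum>\<pi> | \<pi> permutes {0..<n}. signof \<pi> * (\<Prod>i = 0..<n. L i (\<pi> i)))"
    by (subst det_def'[of _ n]) (auto intro!: sum.cong prod.cong dest: permutes_in_image)
  ultimately show ?thesis by (simp add: det_def'[OF assms(1)])
qed

lemma Ck_on_det:
  assumes "\<And>t. M t \<in> carrier_mat n n"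
    and "\<And>i j. i < n \<Longrightarrow> j < n \<Longrightarrow> Ck_on k (\<lambda>t. M t $$ (i, j)) S"
  shows "Ck_on k (\<lambda>t. det (M t) :: complex) S"
  unfolding det_def'[OF assms(1)]
  by (intro Ck_on_sum Ck_on_mult Ck_on_prod Ck_on_const assms(2)) (auto dest: permutes_in_image)

text \<open>In the application \<open>X\<close> and \<open>Y\<close> are difference quotients of two
  factors, not known to be bounded, so convergence has to come from Cramer's rule. The limit
  \<open>T0\<close> is a family of numbers because the derivatives of the coefficients of the
  product are given one by one.\<close>

lemma linear_solution_tendsto:
  assumes "poly_tendsto R R0 F" "poly_tendsto Q Q0 F" "\<And>j. ((\<lambda>t. coeff (T t) j) \<longlongrightarrow> T0 j) F"
    and "\<forall>\<^sub>F t in F. X t * R t + Y t * Q t = T t"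
    and "\<And>t j. p \<le> j \<Longrightarrow> coeff (X t) j = 0" "\<And>t j. q \<le> j \<Longrightarrow> coeff (Y t) j = 0"
    and "\<And>z. poly Q0 z = 0 \<Longrightarrow> poly R0 z \<noteq> 0" "degree Q0 = p" "degree R0 = q" "Q0 \<noteq> 0" "R0 \<noteq> 0"
  shows "\<exists>L. ((\<lambda>t. coeff (X t) j) \<longlongrightarrow> L) F"
proof (cases "j < p")
  case True
  let ?M = "\<lambda>t. sylv p q (R t) (Q t)"
  have M: "((\<lambda>t. ?M t $$ (i, j)) \<longlongrightarrow> sylv p q R0 Q0 $$ (i, j)) F" if "i < p + q" "j < p + q" for i j
    using assms(1,2) that by (auto simp: index_sylv poly_tendsto_def coeff_monom_mult)
  have "mat (p + q) (p + q) (\<lambda>(i, j). sylv p q R0 Q0 $$ (i, j)) = sylv p q R0 Q0"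
    by (rule eq_matI) (auto simp: sylv_def)
  with tendsto_det[of ?M "p + q" "\<lambda>i j. sylv p q R0 Q0 $$ (i, j)" F] M
  have d: "((\<lambda>t. det (?M t)) \<longlongrightarrow> det (sylv p q R0 Q0)) F" by simp
  have nz: "det (sylv p q R0 Q0) \<noteq> 0" using assms by (intro det_sylv_nonzero)
  let ?N = "\<lambda>t. replace_col (?M t) (vec (p + q) (coeff (T t))) j"
  define D where "D = det (mat (p + q) (p + q)
      (\<lambda>(i, j'). if j' = j then T0 i else sylv p q R0 Q0 $$ (i, j')))"
  have N: "((\<lambda>t. det (?N t)) \<longlongrightarrow> D) F"
    unfolding D_def using M assms(3)
    by (intro tendsto_det) (auto simp: index_replace_col_sylv replace_col_sylv_carrier)
  have "\<forall>\<^sub>F t in F. det (?M t) \<noteq> 0" using d nz by (rule tendsto_imp_eventually_ne)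
  then have "\<forall>\<^sub>F t in F. det (?N t) / det (?M t) = coeff (X t) j"
    using assms(4)
  proof eventually_elim
    case (elim t)
    then show ?case using sylv_cramer[OF elim(2), of p q j] assms(5,6) True
      by (simp add: field_simps)
  qed
  with tendsto_divide[OF N d nz] show ?thesis by (blast intro: Lim_transform_eventually)
next
  case False
  then show ?thesis using assms(5) by (intro exI[of _ 0]) simp
qed

lemma linear_solution_Ck:
  assumes "Ck_poly_on k R S" "Ck_poly_on k Q S" "Ck_poly_on k T S"
    and "\<And>t. t \<in> S \<Longrightarrow> X t * R t + Y t * Q t = T t"
    and "\<And>t j. p \<le> j \<Longrightarrow> coeff (X t) j = 0" "\<And>t j. q \<le> j \<Longrightarrow> coeff (Y t) j = 0"
    and "\<And>t z. t \<in> S \<Longrightarrow> poly (Q t) z = 0 \<Longrightarrow> poly (R t) z \<noteq> 0"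
    and "\<And>t. t \<in> S \<Longrightarrow> degree (Q t) = p \<and> lead_coeff (Q t) = 1"
    and "\<And>t. t \<in> S \<Longrightarrow> degree (R t) = q \<and> lead_coeff (R t) = 1"
  shows "Ck_poly_on k X S"
  unfolding Ck_poly_on_def
proof
  fix j
  show "Ck_on k (\<lambda>t. coeff (X t) j) S"
  proof (cases "j < p")
    case True
    let ?M = "\<lambda>t. sylv p q (R t) (Q t)"
    let ?N = "\<lambda>t. replace_col (?M t) (vec (p + q) (coeff (T t))) j"
    have M: "Ck_on k (\<lambda>t. ?M t $$ (i, j)) S" if "i < p + q" "j < p + q" for i j
      using assms(1,2) that
      by (cases "j < p"; cases "i < j"; cases "i < j - p")
        (auto simp: index_sylv Ck_poly_on_def coeff_monom_mult)
    have N': "Ck_on k (\<lambda>t. ?N t $$ (i, l)) S" if "i < p + q" "l < p + q" for i l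
      using M[OF that] assms(3) that
      by (cases "l = j") (auto simp: index_replace_col_sylv Ck_poly_on_def)
    have N: "Ck_on k (\<lambda>t. det (?N t)) S"
      by (intro Ck_on_det[where n = "p + q"])
        (auto intro: N' simp: replace_col_sylv_carrier)
    have nz: "det (?M t) \<noteq> 0" if "t \<in> S" for t
      using assms(7-9)[OF that] by (intro det_sylv_nonzero) auto
    have "Ck_on k (\<lambda>t. det (?N t) * inverse (det (?M t))) S"
      by (intro Ck_on_mult N Ck_on_inverse Ck_on_det[where n = "p + q"] M nz) auto
    moreover have "det (?N t) * inverse (det (?M t)) = coeff (X t) j" if "t \<in> S" for t
      using sylv_cramer[OF assms(4)[OF that], of p q j] assms(5,6) True nz[OF that]
      by (simp add: field_simps)
    ultimately show ?thesis by (subst Ck_on_cong[symmetric]) auto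
  next
    case False
    then show ?thesis using assms(5) by simp
  qed
qed

text \<open>The definition of the derivative divides by |t - t0| instead of \<open>t - t0\<close>.
  The two quotients differ by the sign of \<open>t - t0\<close>, which leaves norms
  unchanged.\<close>

lemma has_vector_derivative_iff_quotient_tendsto:
  fixes f :: "real \<Rightarrow> complex"
  shows "(f has_vector_derivative l) (at t0 within S) \<longleftrightarrow>
    ((\<lambda>t. (f t - f t0) / of_real (t - t0)) \<longlongrightarrow> l) (at t0 within S)"
proof -
  have *: "(1 / norm (t - t0)) *\<^sub>R (f t - (f t0 + (t - t0) *\<^sub>R l)) =
      sgn (t - t0) *\<^sub>R ((f t - f t0) / of_real (t - t0) - l)" if "t \<noteq> t0" for t
  proof -
    have "(1 / norm s) *\<^sub>R (A - s *\<^sub>R l) = sgn s *\<^sub>R (A / of_real s - l)"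
      if "s \<noteq> 0" for A and s :: real
      using that by (simp add: sgn_if scaleR_conv_of_real field_simps)
    from this[of "t - t0" "f t - f t0"] that show ?thesis by (simp add: diff_diff_add)
  qed
  have "(f has_vector_derivative l) (at t0 within S) \<longleftrightarrow>
     ((\<lambda>t. sgn (t - t0) *\<^sub>R ((f t - f t0) / of_real (t - t0) - l)) \<longlongrightarrow> 0) (at t0 within S)"
  proof -
    have "((\<lambda>t. (1 / norm (t - t0)) *\<^sub>R (f t - (f t0 + (t - t0) *\<^sub>R l))) \<longlongrightarrow> 0) (at t0 within S)
      \<longleftrightarrow> ((\<lambda>t. sgn (t - t0) *\<^sub>R ((f t - f t0) / of_real (t - t0) - l)) \<longlongrightarrow> 0) (at t0 within S)"
      by (rule Lim_cong_within[OF refl refl refl]) (rule *)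
    then show ?thesis
      unfolding has_vector_derivative_def has_derivative_within
      using bounded_linear_scaleR_left[of l] by blast
  qed
  also have "\<dots> \<longleftrightarrow> ((\<lambda>t. (f t - f t0) / of_real (t - t0) - l) \<longlongrightarrow> 0) (at t0 within S)"
  proof -
    have "norm (sgn (t - t0) *\<^sub>R z) = norm z" if "t \<noteq> t0" for t and z :: complex
      using that by (simp add: sgn_if)
    then have "((\<lambda>t. norm (sgn (t - t0) *\<^sub>R ((f t - f t0) / of_real (t - t0) - l))) \<longlongrightarrow> 0) (at t0 within S)
      \<longleftrightarrow> ((\<lambda>t. norm ((f t - f t0) / of_real (t - t0) - l)) \<longlongrightarrow> 0) (at t0 within S)"
      by (intro Lim_cong_within) auto
    then show ?thesis by (simp only: tendsto_norm_zero_iff)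
  qed
  finally show ?thesis by (simp only: LIM_zero_iff)
qed

lemma monic_coeff_ge:
  assumes "degree Q = p" "lead_coeff Q = 1" "p \<le> j"
  shows "coeff Q j = (if j = p then 1 else 0)"
  using assms by (auto simp: coeff_eq_0)

text \<open>The difference quotients \<open>X\<close> of \<open>Q\<close> and \<open>Y\<close> of
  \<open>R\<close> at \<open>t1\<close> satisfy X R(t) + Y Q(t1) = T, where \<open>T\<close> is the
  difference quotient of \<open>P\<close>. The Sylvester matrix of this system tends to that of
  \<open>R t1\<close> and \<open>Q t1\<close>, which is invertible by coprimality, so
  \<open>X\<close> converges.\<close>

lemma factor_differentiable:
  assumes "open S" "t1 \<in> S" "\<And>t. t \<in> S \<Longrightarrow> Q t * R t = P t"
    and Q: "\<And>t. t \<in> S \<Longrightarrow> degree (Q t) = p \<and> lead_coeff (Q t) = 1"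
    and R: "\<And>t. t \<in> S \<Longrightarrow> degree (R t) = q \<and> lead_coeff (R t) = 1"
    and "poly_tendsto R (R t1) (at t1)"
    and "\<And>z. poly (Q t1) z = 0 \<Longrightarrow> poly (R t1) z \<noteq> 0"
    and P: "\<And>j. \<exists>l. ((\<lambda>t. coeff (P t) j) has_vector_derivative l) (at t1)"
  shows "\<exists>l. ((\<lambda>t. coeff (Q t) j) has_vector_derivative l) (at t1)"
proof -
  define c :: "real \<Rightarrow> complex" where "c t = inverse (of_real (t - t1))" for t
  \<comment> \<open>The leading terms of two monic polynomials cancel, and the value 0 outside
    \<open>S\<close> keeps the degree of \<open>X t\<close> below \<open>p\<close> for every
    \<open>t\<close>.\<close>
  define X where "X t = (if t \<in> S then Polynomial.smult (c t) (Q t - Q t1) else 0)" for t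
  define Y where "Y t = (if t \<in> S then Polynomial.smult (c t) (R t - R t1) else 0)" for t
  define T where "T t = Polynomial.smult (c t) (P t - P t1)" for t
  obtain P' where P': "\<And>j. ((\<lambda>t. coeff (P t) j) has_vector_derivative P' j) (at t1)"
    using P by metis
  have "\<forall>\<^sub>F t in at t1. t \<in> S" using assms(1,2) by (simp add: eventually_at_in_open')
  moreover have "X t * R t + Y t * Q t1 = T t" if "t \<in> S" for t
  proof -
    have "T t = Polynomial.smult (c t) ((Q t - Q t1) * R t + (R t - R t1) * Q t1)"
      using assms(3)[OF that] assms(3)[OF assms(2)] by (simp add: T_def algebra_simps)
    then show ?thesis using that by (simp add: X_def Y_def smult_add_right)
  qed
  ultimately have ev: "\<forall>\<^sub>F t in at t1. X t * R t + Y t * Q t1 = T t"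
    by (rule eventually_mono)
  have X0: "coeff (X t) i = 0" if "p \<le> i" for t i
    using that Q[of t] Q[OF assms(2)] monic_coeff_ge[of "Q t" p i] monic_coeff_ge[of "Q t1" p i]
    by (auto simp: X_def)
  have Y0: "coeff (Y t) i = 0" if "q \<le> i" for t i
    using that R[of t] R[OF assms(2)] monic_coeff_ge[of "R t" q i] monic_coeff_ge[of "R t1" q i]
    by (auto simp: Y_def)
  have T0: "((\<lambda>t. coeff (T t) i) \<longlongrightarrow> P' i) (at t1)" for i
    using P'[of i] unfolding has_vector_derivative_iff_quotient_tendsto T_def c_def
    by (simp add: divide_inverse mult.commute)
  have "\<exists>L. ((\<lambda>t. coeff (X t) j) \<longlongrightarrow> L) (at t1)"
    by (rule linear_solution_tendsto[OF assms(6) poly_tendsto_const T0 ev X0 Y0 assms(7)])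
      (use Q[OF assms(2)] R[OF assms(2)] in auto)
  then obtain L where L: "((\<lambda>t. coeff (X t) j) \<longlongrightarrow> L) (at t1)" by blast
  have "\<forall>\<^sub>F t in at t1. coeff (X t) j = (coeff (Q t) j - coeff (Q t1) j) / of_real (t - t1)"
    using \<open>\<forall>\<^sub>F t in at t1. t \<in> S\<close> by eventually_elim (simp add: X_def c_def divide_inverse mult.commute)
  with L have "((\<lambda>t. (coeff (Q t) j - coeff (Q t1) j) / of_real (t - t1)) \<longlongrightarrow> L) (at t1)"
    by (rule Lim_transform_eventually)
  then show ?thesis unfolding has_vector_derivative_iff_quotient_tendsto by blast
qed

text \<open>Bootstrapping: the derivatives of \<open>Q\<close> and \<open>R\<close> solve the linear system
  \<open>Q' R + R' Q = P'\<close>, so they are as smooth as \<open>Q\<close>, \<open>R\<close> and \<open>P'\<close>.\<close>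

lemma factor_Ck:
  assumes "open S" "\<And>t. t \<in> S \<Longrightarrow> Q t * R t = P t"
    and Q: "\<And>t. t \<in> S \<Longrightarrow> degree (Q t) = p \<and> lead_coeff (Q t) = 1"
    and R: "\<And>t. t \<in> S \<Longrightarrow> degree (R t) = q \<and> lead_coeff (R t) = 1"
    and Qc: "\<And>t. t \<in> S \<Longrightarrow> poly_tendsto Q (Q t) (at t)"
    and Rc: "\<And>t. t \<in> S \<Longrightarrow> poly_tendsto R (R t) (at t)"
    and co: "\<And>t z. t \<in> S \<Longrightarrow> poly (Q t) z = 0 \<Longrightarrow> poly (R t) z \<noteq> 0"
    and P: "Ck_poly_on n P S"
  shows "Ck_poly_on n Q S"
proof -
  \<comment> \<open>Both factors go through the induction together, since the derivative of each is
    expressed by both.\<close>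
  have "Ck_poly_on k Q S \<and> Ck_poly_on k R S" if "k \<le> n" for k
    using that
  proof (induction k)
    case 0
    then show ?case using Qc Rc \<open>open S\<close>
      by (auto simp: Ck_poly_on_def poly_tendsto_def continuous_on_eq_continuous_at isCont_def)
  next
    case (Suc k)
    have "Ck_poly_on (Suc k) P S" using P Suc.prems Ck_on_mono unfolding Ck_poly_on_def by blast
    then have "\<exists>f'. (\<forall>t\<in>S. ((\<lambda>t. coeff (P t) j) has_vector_derivative f' t) (at t within S)) \<and> Ck_on k f' S" for j
      by (simp add: Ck_poly_on_def)
    then obtain P' where P': "\<And>j t. t \<in> S \<Longrightarrow> ((\<lambda>t. coeff (P t) j) has_vector_derivative P' j t) (at t)"
      "\<And>j. Ck_on k (P' j) S"
      using at_within_open[OF _ \<open>open S\<close>] by metis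
    have "\<exists>l. ((\<lambda>t. coeff (Q t) j) has_vector_derivative l) (at t)" if "t \<in> S" for t j
      by (rule factor_differentiable[OF assms(1) that assms(2) Q R Rc[OF that] co[OF that]])
        (use P'(1)[OF that] in auto)
    note Qd = this
    define Q' where "Q' j t = vector_derivative (\<lambda>t. coeff (Q t) j) (at t)" for j t
    have Q': "((\<lambda>t. coeff (Q t) j) has_vector_derivative Q' j t) (at t)" if "t \<in> S" for j t
      using Qd[OF that, of j] unfolding Q'_def
      by (auto dest: differentiableI_vector simp flip: vector_derivative_works)
    have "\<exists>l. ((\<lambda>t. coeff (R t) j) has_vector_derivative l) (at t)" if "t \<in> S" for t j
      by (rule factor_differentiable[where R = Q and P = P, OF assms(1) that _ R Q Qc[OF that]])
        (use P'(1)[OF that] co[OF that] assms(2) in \<open>auto simp: mult.commute\<close>)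
    note Rd = this
    define R' where "R' j t = vector_derivative (\<lambda>t. coeff (R t) j) (at t)" for j t
    have R': "((\<lambda>t. coeff (R t) j) has_vector_derivative R' j t) (at t)" if "t \<in> S" for j t
      using Rd[OF that, of j] unfolding R'_def
      by (auto dest: differentiableI_vector simp flip: vector_derivative_works)
    \<comment> \<open>The leading coefficients are constantly 1, so \<open>X\<close> and
      \<open>Y\<close>, of degrees below \<open>p\<close> and \<open>q\<close>, are the full
      coefficientwise derivatives of \<open>Q\<close> and \<open>R\<close>.\<close>
    define X where "X t = (\<Sum>j<p. monom (Q' j t) j)" for t
    define Y where "Y t = (\<Sum>j<q. monom (R' j t) j)" for t
    have cX: "coeff (X t) j = (if j < p then Q' j t else 0)" for j t by (auto simp: X_def coeff_sum)
    have cY: "coeff (Y t) j = (if j < q then R' j t else 0)" for j t by (auto simp: Y_def coeff_sum)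
    have dX: "((\<lambda>t. coeff (Q t) j) has_vector_derivative coeff (X t) j) (at t)" if "t \<in> S" for j t
    proof (cases "j < p")
      case True
      then show ?thesis using Q'[OF that] by (simp add: cX)
    next
      case False
      then have "coeff (Q s) j = (if j = p then 1 else 0)" if "s \<in> S" for s
        using Q[OF that] by (intro monic_coeff_ge) auto
      then have "((\<lambda>t. coeff (Q t) j) has_vector_derivative 0) (at t)"
        by (intro has_vector_derivative_transform_within_open
          [OF has_vector_derivative_const[of "if j = p then 1 else 0"] \<open>open S\<close> that]) simp
      then show ?thesis using False by (simp add: cX)
    qed
    have dY: "((\<lambda>t. coeff (R t) j) has_vector_derivative coeff (Y t) j) (at t)" if "t \<in> S" for j t
    proof (cases "j < q")
      case True
      then show ?thesis using R'[OF that] by (simp add: cY)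
    next
      case False
      then have "coeff (R s) j = (if j = q then 1 else 0)" if "s \<in> S" for s
        using R[OF that] by (intro monic_coeff_ge) auto
      then have "((\<lambda>t. coeff (R t) j) has_vector_derivative 0) (at t)"
        by (intro has_vector_derivative_transform_within_open
          [OF has_vector_derivative_const[of "if j = q then 1 else 0"] \<open>open S\<close> that]) simp
      then show ?thesis using False by (simp add: cY)
    qed
    define T where "T t = X t * R t + Y t * Q t" for t
    \<comment> \<open>By the product rule \<open>T\<close> is the derivative of \<open>P\<close>,
      whose coefficients are of class C^k.\<close>
    have "coeff (T t) j = P' j t" if "t \<in> S" for t j
    proof -
      have "((\<lambda>t. coeff (Q t * R t) j) has_vector_derivative coeff (T t) j) (at t)"
        unfolding coeff_mult T_def coeff_add mult.commute[of "Y t" "Q t"] sum.distrib[symmetric]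
        by (subst add.commute) (intro has_vector_derivative_sum has_vector_derivative_mult dX[OF that] dY[OF that])
      then have "((\<lambda>t. coeff (P t) j) has_vector_derivative coeff (T t) j) (at t)"
        by (rule has_vector_derivative_transform_within_open[OF _ \<open>open S\<close> that]) (simp add: assms(2))
      then show ?thesis using P'(1)[OF that] by (rule vector_derivative_unique_at)
    qed
    then have "Ck_poly_on k T S"
      unfolding Ck_poly_on_def using P'(2) Ck_on_cong[of S "\<lambda>t. coeff (T t) _" "P' _"] by blast
    moreover have "X t * R t + Y t * Q t = T t" "Y t * Q t + X t * R t = T t" for t
      by (simp_all add: T_def)
    ultimately have "Ck_poly_on k X S" "Ck_poly_on k Y S"
      using Suc.IH Suc.prems co Q R
      by (intro linear_solution_Ck[of k R S Q T X Y p q] linear_solution_Ck[of k Q S R T Y X q p]; force simp: cX cY)+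
    then show ?case
      unfolding Ck_poly_on_def Ck_on.simps using dX dY by (meson has_vector_derivative_at_within)
  qed
  then show ?thesis by blast
qed

section \<open>Continuity of roots and splitting\<close>

definition monic_deg :: "nat \<Rightarrow> complex poly \<Rightarrow> bool" where
  "monic_deg d p \<longleftrightarrow> degree p = d \<and> lead_coeff p = 1"

lemma root_tuple_imp_monic_deg: "root_tuple d \<mu> p \<Longrightarrow> monic_deg d p"
  unfolding monic_deg_def
  by (rule conjI, erule root_tuple_degree) (simp add: root_tuple_def lead_coeff_prod del: One_nat_def)

lemma monic_deg_imp_root_tuple: "monic_deg d p \<Longrightarrow> \<exists>\<mu>. root_tuple d \<mu> p"
  using root_tuple_exists[of p] by (auto simp: monic_deg_def)

lemma root_tuple_poly_eq_0_iff: "root_tuple d \<mu> p \<Longrightarrow> poly p x = 0 \<longleftrightarrow> (\<exists>j\<in>{1..d}. x = \<mu> j)"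
  by (auto simp: root_tuple_def poly_prod)

lemma root_tuple_norm_poly: "root_tuple d \<mu> p \<Longrightarrow> norm (poly p x) = (\<Prod>j=1..d. norm (x - \<mu> j))"
  by (auto simp: root_tuple_def poly_prod prod_norm)

text \<open>The product of the \<open>d\<close> distances from \<open>w\<close> to the roots equals
  |p(w)|, and the smallest distance to the power \<open>d\<close> is at most this product.\<close>

lemma monic_deg_root_near:
  assumes "monic_deg d p" "d > 0"
  shows "\<exists>x. poly p x = 0 \<and> norm (w - x) ^ d \<le> norm (poly p w)"
proof -
  obtain \<mu> where \<mu>: "root_tuple d \<mu> p" using monic_deg_imp_root_tuple assms by blast
  let ?f = "\<lambda>j. norm (w - \<mu> j)"
  obtain i where i: "i \<in> {1..d}" "\<And>j. j \<in> {1..d} \<Longrightarrow> ?f i \<le> ?f j"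
  proof -
    have "Min (?f ` {1..d}) \<in> ?f ` {1..d}" using assms(2) by (intro Min_in) auto
    then obtain i where "i \<in> {1..d}" "?f i = Min (?f ` {1..d})" by auto
    then show ?thesis using that[of i] by (metis Min_le finite_atLeastAtMost finite_imageI imageI)
  qed
  have "norm (w - \<mu> i) ^ d = (\<Prod>j=1..d. ?f i)" by simp
  also have "\<dots> \<le> (\<Prod>j=1..d. ?f j)" using i(2) by (intro prod_mono) auto
  also have "\<dots> = norm (poly p w)" using root_tuple_norm_poly[OF \<mu>] by simp
  finally show ?thesis using root_tuple_poly_eq_0_iff[OF \<mu>] i(1) by blast
qed

text \<open>Synthetic division read from the top: coefficient j of \<open>R\<close> is coefficient
  j+1 of the product plus \<open>x\<close> times coefficient j+1 of \<open>R\<close>. Convergence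
  descends from degree d+1, where all coefficients vanish.\<close>

lemma deflation_tendsto:
  assumes "poly_tendsto (\<lambda>t. [:- x t, 1:] * R t) ([:- x0, 1:] * R0) F" "(x \<longlongrightarrow> x0) F"
    and "\<And>t. degree (R t) \<le> d" "degree R0 \<le> d"
  shows "poly_tendsto R R0 F"
proof -
  \<comment> \<open>\<open>m\<close> counts how far below \<open>d + 1\<close> convergence has been
    reached.\<close>
  have "\<forall>j. d + 1 \<le> j + m \<longrightarrow> ((\<lambda>t. coeff (R t) j) \<longlongrightarrow> coeff R0 j) F" for m
  proof (induction m)
    case 0
    have "coeff (R t) j = 0" "coeff R0 j = 0" if "d + 1 \<le> j" for t j
      using assms(3)[of t] assms(4) that by (auto intro: coeff_eq_0)
    then show ?case by simp
  next
    case (Suc m)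
    show ?case
    proof (intro allI impI)
      fix j assume j: "d + 1 \<le> j + Suc m"
      have *: "coeff p j = coeff ([:- y, 1:] * p) (Suc j) + y * coeff p (Suc j)" for p and y :: complex
        by simp
      have "((\<lambda>t. coeff ([:- x t, 1:] * R t) (Suc j) + x t * coeff (R t) (Suc j)) \<longlongrightarrow>
          coeff ([:- x0, 1:] * R0) (Suc j) + x0 * coeff R0 (Suc j)) F"
        using Suc j assms(1,2) unfolding poly_tendsto_def
        by (intro tendsto_add tendsto_mult) (auto simp del: mult_pCons_left coeff_pCons_Suc)
      then show "((\<lambda>t. coeff (R t) j) \<longlongrightarrow> coeff R0 j) F" by (simp only: *[symmetric])
    qed
  qed
  from this[of "d + 1"] show ?thesis by (auto simp: poly_tendsto_def)
qed

text \<open>Continuity of the roots along an arbitrary filter. For the last root w of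
  \<open>P0\<close>, of degree d+1 in the induction step, some root of \<open>P t\<close> lies
  within |P(t)(w)|^(1/(d+1)) of w and so converges to w. It is divided out, and the quotient is
  handled by induction. The enumerations are chosen separately for each \<open>t\<close>.\<close>

lemma roots_tendsto_aux:
  assumes "root_tuple d w P0" "\<And>t. monic_deg d (P t)" "poly_tendsto P P0 F"
  shows "\<exists>\<mu>. (\<forall>t. root_tuple d (\<mu> t) (P t)) \<and> (\<forall>j\<in>{1..d}. ((\<lambda>t. \<mu> t j) \<longlongrightarrow> w j) F)"
  using assms
proof (induction d arbitrary: P P0)
  case 0
  then have "root_tuple 0 w (P t)" for t using monic_deg_imp_root_tuple[of 0 "P t"] by (auto simp: root_tuple_def)
  then show ?case by (intro exI[of _ "\<lambda>t. w"]) auto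
next
  case (Suc d)
  let ?w = "w (Suc d)"
  obtain x where x: "\<And>t. poly (P t) (x t) = 0" "\<And>t. norm (?w - x t) ^ Suc d \<le> norm (poly (P t) ?w)"
  proof -
    have "\<forall>t. \<exists>x. poly (P t) x = 0 \<and> norm (?w - x) ^ Suc d \<le> norm (poly (P t) ?w)"
      using monic_deg_root_near[OF Suc.prems(2) zero_less_Suc] by simp
    from choice[OF this] show ?thesis using that by auto
  qed
  have "((\<lambda>t. poly (P t) ?w) \<longlongrightarrow> poly P0 ?w) F"
    using Suc.prems(2) root_tuple_imp_monic_deg[OF Suc.prems(1)]
    by (intro poly_tendsto_imp_tendsto_poly[OF Suc.prems(3), of "Suc d"]) (auto simp: monic_deg_def)
  moreover have "poly P0 ?w = 0" using root_tuple_poly_eq_0_iff[OF Suc.prems(1)] by auto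
  ultimately have P0: "((\<lambda>t. poly (P t) ?w) \<longlongrightarrow> 0) F" by simp
  have xl: "(x \<longlongrightarrow> ?w) F"
    unfolding tendsto_iff
  proof (intro allI impI)
    fix e :: real assume "e > 0"
    then have "\<forall>\<^sub>F t in F. norm (poly (P t) ?w) < e ^ Suc d"
      using P0 unfolding tendsto_iff dist_norm diff_zero by (metis zero_less_power)
    then show "\<forall>\<^sub>F t in F. dist (x t) ?w < e"
    proof eventually_elim
      case (elim t)
      then have "norm (?w - x t) ^ Suc d < e ^ Suc d" using x(2)[of t] by linarith
      then have "norm (?w - x t) < e" using \<open>e > 0\<close> by (meson less_imp_le power_less_imp_less_base)
      then show ?case by (simp add: dist_norm norm_minus_commute)
    qed
  qed
  have "\<exists>R. P t = [:- x t, 1:] * R" for t using x(1)[of t] by (metis dvdE poly_eq_0_iff_dvd)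
  then obtain R where R: "\<And>t. P t = [:- x t, 1:] * R t" by metis
  define R0 where "R0 = (\<Prod>j=1..d. [:- w j, 1:])"
  have P0R: "P0 = [:- ?w, 1:] * R0" using Suc.prems(1) by (simp add: root_tuple_def R0_def mult.commute)
  have R0: "root_tuple d w R0" by (simp add: root_tuple_def R0_def)
  have Rm: "monic_deg d (R t)" for t
  proof -
    have "lead_coeff (P t) = lead_coeff (R t)" unfolding R by (subst lead_coeff_mult) simp
    then have 1: "lead_coeff (R t) = 1" using Suc.prems(2)[of t] by (simp add: monic_deg_def)
    then have "R t \<noteq> 0" by auto
    then have "degree (P t) = Suc (degree (R t))" unfolding R by (subst degree_mult_eq) auto
    then show ?thesis using 1 Suc.prems(2)[of t] by (simp add: monic_deg_def)
  qed
  have "poly_tendsto R R0 F"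
    using Suc.prems(3) xl Rm root_tuple_imp_monic_deg[OF R0] unfolding R P0R
    by (intro deflation_tendsto[of x R ?w R0 F d]) (auto simp: monic_deg_def)
  from Suc.IH[OF R0 Rm this] obtain \<mu> where
    \<mu>: "\<And>t. root_tuple d (\<mu> t) (R t)" "\<And>j. j \<in> {1..d} \<Longrightarrow> ((\<lambda>t. \<mu> t j) \<longlongrightarrow> w j) F" by blast
  have "root_tuple (Suc d) ((\<mu> t)(Suc d := x t)) (P t)" for t
  proof -
    have "(\<Prod>j=1..d. [:- ((\<mu> t)(Suc d := x t)) j, 1:]) = (\<Prod>j=1..d. [:- \<mu> t j, 1:])"
      by (rule prod.cong) auto
    then show ?thesis using \<mu>(1)[of t] R[of t] by (simp add: root_tuple_def mult.commute)
  qed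
  moreover have "((\<lambda>t. ((\<mu> t)(Suc d := x t)) j) \<longlongrightarrow> w j) F" if "j \<in> {1..Suc d}" for j
    using that \<mu>(2)[of j] xl by (cases "j = Suc d") auto
  ultimately show ?case by (intro exI[of _ "\<lambda>t. (\<mu> t)(Suc d := x t)"] conjI allI ballI)
qed

lemma roots_tendsto:
  assumes "root_tuple d w P0" "\<forall>\<^sub>F t in F. monic_deg d (P t)" "poly_tendsto P P0 F"
  obtains \<mu> where "\<And>t. monic_deg d (P t) \<Longrightarrow> root_tuple d (\<mu> t) (P t)"
    "\<And>j. j \<in> {1..d} \<Longrightarrow> ((\<lambda>t. \<mu> t j) \<longlongrightarrow> w j) F"
proof -
  \<comment> \<open>\<open>P0\<close> is the default where \<open>P t\<close> is not monic of degree
    \<open>d\<close>, so that roots can be chosen for every index.\<close>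
  define P' where "P' t = (if monic_deg d (P t) then P t else P0)" for t
  have m: "monic_deg d (P' t)" for t
    using root_tuple_imp_monic_deg[OF assms(1)] by (simp add: P'_def)
  have "\<forall>\<^sub>F t in F. P t = P' t"
    using assms(2) by eventually_elim (simp add: P'_def)
  then have "poly_tendsto P' P0 F" using assms(3) poly_tendsto_cong by blast
  from roots_tendsto_aux[OF assms(1) m this] show ?thesis
  proof (elim exE conjE)
    fix \<mu>
    assume \<mu>: "\<forall>t. root_tuple d (\<mu> t) (P' t)" "\<forall>j\<in>{1..d}. ((\<lambda>t. \<mu> t j) \<longlongrightarrow> w j) F"
    have "root_tuple d (\<mu> t) (P t)" if "monic_deg d (P t)" for t
      using \<mu>(1) that unfolding P'_def by metis
    with \<mu>(2) show ?thesis using that by blast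
  qed
qed

lemma eventually_all_roots:
  assumes "monic_deg d P0" "\<forall>\<^sub>F t in F. monic_deg d (P t)" "poly_tendsto P P0 F"
    and "open U" "\<And>z. poly P0 z = 0 \<Longrightarrow> z \<in> U"
  shows "\<forall>\<^sub>F t in F. \<forall>z. poly (P t) z = 0 \<longrightarrow> z \<in> U"
proof -
  obtain w where w: "root_tuple d w P0" using monic_deg_imp_root_tuple assms by blast
  obtain \<mu> where \<mu>: "\<And>t. monic_deg d (P t) \<Longrightarrow> root_tuple d (\<mu> t) (P t)"
    "\<And>j. j \<in> {1..d} \<Longrightarrow> ((\<lambda>t. \<mu> t j) \<longlongrightarrow> w j) F"
    using roots_tendsto[OF w assms(2,3)] by blast
  have "\<forall>\<^sub>F t in F. \<forall>j\<in>{1..d}. \<mu> t j \<in> U"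
  proof (intro eventually_ball_finite ballI)
    fix j assume j: "j \<in> {1..d}"
    then have "w j \<in> U" using assms(5) root_tuple_poly_eq_0_iff[OF w] by blast
    then show "\<forall>\<^sub>F t in F. \<mu> t j \<in> U" using topological_tendstoD[OF \<mu>(2)[OF j] assms(4)] by blast
  qed simp
  with assms(2) show ?thesis
  proof eventually_elim
    case (elim t)
    show ?case
    proof (intro allI impI)
      fix z assume "poly (P t) z = 0"
      then obtain j where "j \<in> {1..d}" "z = \<mu> t j"
        using root_tuple_poly_eq_0_iff[OF \<mu>(1)[OF elim(1)]] by auto
      with elim(2) show "z \<in> U" by auto
    qed
  qed
qed

text \<open>Taken from the multiset of roots, the factor belonging to a region \<open>B\<close> is a
  function of the polynomial alone. For a fixed \<open>B\<close> the factors of \<open>P t\<close>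
  at different \<open>t\<close> therefore fit together without choices.\<close>

definition root_part :: "complex set \<Rightarrow> complex poly \<Rightarrow> complex poly" where
  "root_part B p = (\<Prod>x\<in>#filter_mset (\<lambda>x. x \<in> B) (proots p). [:- x, 1:])"

lemma root_part_eq:
  assumes "root_tuple d \<mu> p"
  shows "root_part B p = (\<Prod>j\<in>{j\<in>{1..d}. \<mu> j \<in> B}. [:- \<mu> j, 1:])"
proof -
  have "filter_mset (\<lambda>x. x \<in> B) (proots p) = image_mset \<mu> (mset_set {j\<in>{1..d}. \<mu> j \<in> B})"
    using root_tuple_proots[OF assms] by (simp add: filter_mset_image_mset filter_mset_mset_set o_def)
  then show ?thesis by (simp add: root_part_def image_mset.compositionality o_def prod_unfold_prod_mset)
qed

lemma root_part_root:
  assumes "monic_deg d p"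
  shows "poly (root_part B p) z = 0 \<longleftrightarrow> poly p z = 0 \<and> z \<in> B"
proof -
  obtain \<mu> where \<mu>: "root_tuple d \<mu> p" using monic_deg_imp_root_tuple assms by blast
  show ?thesis unfolding root_part_eq[OF \<mu>] root_tuple_poly_eq_0_iff[OF \<mu>] by (auto simp: poly_prod)
qed

lemma lead_coeff_root_part: "lead_coeff (root_part B p) = 1"
proof -
  have "lead_coeff (\<Prod>x\<in>#M. [:- x, 1:] :: complex poly) = 1" for M
    by (induction M) (auto simp: lead_coeff_mult simp del: mult_pCons_left)
  then show ?thesis by (simp add: root_part_def)
qed

lemma root_part_mult:
  assumes "monic_deg d p"
  shows "root_part B p * root_part (- B) p = p"
proof -
  obtain \<mu> where \<mu>: "root_tuple d \<mu> p" using monic_deg_imp_root_tuple assms by blast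
  have "{j\<in>{1..d}. \<mu> j \<in> - B} = {1..d} \<inter> - {j. \<mu> j \<in> B}" "{j\<in>{1..d}. \<mu> j \<in> B} = {1..d} \<inter> {j. \<mu> j \<in> B}"
    by auto
  then have "root_part B p * root_part (- B) p = (\<Prod>j=1..d. [:- \<mu> j, 1:])"
    unfolding root_part_eq[OF \<mu>]
    by (simp only:) (subst prod.union_disjoint[symmetric]; auto intro!: prod.cong)
  then show ?thesis using \<mu> by (simp add: root_tuple_def)
qed

text \<open>The condition on the roots of \<open>P0\<close> says that none lies on the boundary of
  \<open>B\<close>. Nearby roots stay on their side, and the factor keeps its set of
  indices.\<close>

lemma root_part_tendsto:
  assumes "monic_deg d P0" "\<forall>\<^sub>F t in F. monic_deg d (P t)" "poly_tendsto P P0 F"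
    and "\<And>z. poly P0 z = 0 \<Longrightarrow> z \<in> interior B \<union> interior (- B)"
  shows "poly_tendsto (\<lambda>t. root_part B (P t)) (root_part B P0) F"
    and "\<forall>\<^sub>F t in F. degree (root_part B (P t)) = degree (root_part B P0)"
proof -
  obtain w where w: "root_tuple d w P0" using monic_deg_imp_root_tuple assms by blast
  obtain \<mu> where \<mu>: "\<And>t. monic_deg d (P t) \<Longrightarrow> root_tuple d (\<mu> t) (P t)"
    "\<And>j. j \<in> {1..d} \<Longrightarrow> ((\<lambda>t. \<mu> t j) \<longlongrightarrow> w j) F"
    using roots_tendsto[OF w assms(2,3)] by blast
  let ?A = "{j\<in>{1..d}. w j \<in> B}"
  have "\<forall>\<^sub>F t in F. \<forall>j\<in>{1..d}. \<mu> t j \<in> B \<longleftrightarrow> w j \<in> B"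
  proof (intro eventually_ball_finite ballI)
    fix j assume j: "j \<in> {1..d}"
    then have "poly P0 (w j) = 0" using root_tuple_poly_eq_0_iff[OF w] by blast
    then consider "w j \<in> interior B" | "w j \<in> interior (- B)" using assms(4) by blast
    then show "\<forall>\<^sub>F t in F. \<mu> t j \<in> B \<longleftrightarrow> w j \<in> B"
    proof cases
      case 1
      from topological_tendstoD[OF \<mu>(2)[OF j] open_interior this] show ?thesis
        using 1 interior_subset by (auto elim!: eventually_mono)
    next
      case 2
      from topological_tendstoD[OF \<mu>(2)[OF j] open_interior this] show ?thesis
        using 2 interior_subset[of "- B"] by (auto elim!: eventually_mono)
    qed
  qed simp
  with assms(2) have ev: "\<forall>\<^sub>F t in F. root_part B (P t) = (\<Prod>j\<in>?A. [:- \<mu> t j, 1:])"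
  proof eventually_elim
    case (elim t)
    then have "{j\<in>{1..d}. \<mu> t j \<in> B} = ?A" by auto
    then show ?case using root_part_eq[OF \<mu>(1)[OF elim(1)]] by simp
  qed
  have "poly_tendsto (\<lambda>t. \<Prod>j\<in>?A. [:- \<mu> t j, 1:]) (\<Prod>j\<in>?A. [:- w j, 1:]) F"
    by (intro poly_tendsto_prod poly_tendsto_linear \<mu>(2)) auto
  then show "poly_tendsto (\<lambda>t. root_part B (P t)) (root_part B P0) F"
    using poly_tendsto_cong[OF ev] root_part_eq[OF w] by simp
  show "\<forall>\<^sub>F t in F. degree (root_part B (P t)) = degree (root_part B P0)"
    using ev by eventually_elim (simp add: root_part_eq[OF w] degree_prod_eq_sum_degree)
qed

lemma eventually_at_imp_ball:
  fixes t0 :: real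
  assumes "\<forall>\<^sub>F t in at t0. p t" "p t0"
  shows "\<exists>e>0. \<forall>t\<in>ball t0 e. p t"
proof -
  obtain d where "d > 0" "\<forall>t. t \<noteq> t0 \<and> dist t t0 < d \<longrightarrow> p t"
    using assms(1) unfolding eventually_at by auto
  then show ?thesis using assms(2) by (intro exI[of _ d]) (metis dist_commute mem_ball)
qed

lemma root_part_Ck:
  assumes "open S" "t0 \<in> S" "\<And>t. t \<in> S \<Longrightarrow> monic_deg d (P t)" "Ck_poly_on n P S"
    and "\<And>z. poly (P t0) z = 0 \<Longrightarrow> z \<in> interior B \<union> interior (- B)"
  obtains e where "e > 0" "ball t0 e \<subseteq> S"
    "\<And>t. t \<in> ball t0 e \<Longrightarrow> degree (root_part B (P t)) = degree (root_part B (P t0))"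
    "Ck_poly_on n (\<lambda>t. root_part B (P t)) (ball t0 e)"
proof -
  let ?U = "interior B \<union> interior (- B)"
  have inS: "\<forall>\<^sub>F t in at s. t \<in> S" if "s \<in> S" for s
    using assms(1) that by (simp add: eventually_at_in_open')
  have ev: "\<forall>\<^sub>F t in at s. monic_deg d (P t)" if "s \<in> S" for s
    using inS[OF that] by eventually_elim (rule assms(3))
  have lim: "poly_tendsto P (P s) (at s)" if "s \<in> S" for s
    using Ck_poly_on_imp_tendsto[OF assms(4,1) that] .
  \<comment> \<open>Smoothness of the factors requires their continuity at every point of a ball,
    not only at \<open>t0\<close>. Hence \<open>p\<close> keeps the roots of \<open>P t\<close> in
    the open set \<open>?U\<close>, off the boundary of \<open>B\<close>, and fixes the degrees of
    both factors.\<close>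
  define p where "p t \<longleftrightarrow> t \<in> S \<and> (\<forall>z. poly (P t) z = 0 \<longrightarrow> z \<in> ?U) \<and>
    degree (root_part B (P t)) = degree (root_part B (P t0)) \<and>
    degree (root_part (- B) (P t)) = degree (root_part (- B) (P t0))" for t
  have "\<forall>\<^sub>F t in at t0. p t"
    unfolding p_def
    using eventually_all_roots[OF assms(3)[OF assms(2)] ev[OF assms(2)] lim[OF assms(2)] _ assms(5)]
      root_part_tendsto(2)[OF assms(3)[OF assms(2)] ev[OF assms(2)] lim[OF assms(2)], of B]
      root_part_tendsto(2)[OF assms(3)[OF assms(2)] ev[OF assms(2)] lim[OF assms(2)], of "- B"]
      inS[OF assms(2)] assms(5)
    by (intro eventually_conj) (auto simp: Un_commute)
  moreover have "p t0" using assms(2,5) by (auto simp: p_def)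
  ultimately obtain e where e: "e > 0" "\<And>t. t \<in> ball t0 e \<Longrightarrow> p t"
    using eventually_at_imp_ball by blast
  have sub: "ball t0 e \<subseteq> S" using e(2) by (auto simp: p_def)
  have "Ck_poly_on n (\<lambda>t. root_part B (P t)) (ball t0 e)"
  proof (rule factor_Ck[where R = "\<lambda>t. root_part (- B) (P t)" and P = P])
    fix t assume t: "t \<in> ball t0 e"
    then have tS: "t \<in> S" and pt: "p t" using sub e(2) by auto
    note m = assms(3)[OF tS]
    show "root_part B (P t) * root_part (- B) (P t) = P t" using root_part_mult[OF m] .
    show "poly_tendsto (\<lambda>t. root_part B (P t)) (root_part B (P t)) (at t)"
      "poly_tendsto (\<lambda>t. root_part (- B) (P t)) (root_part (- B) (P t)) (at t)"
      using pt by (intro root_part_tendsto(1)[OF m ev[OF tS] lim[OF tS]]; force simp: p_def)+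
    show "poly (root_part (- B) (P t)) z \<noteq> 0" if "poly (root_part B (P t)) z = 0" for z
      using that root_part_root[OF m] by simp
    show "degree (root_part B (P t)) = degree (root_part B (P t0)) \<and> lead_coeff (root_part B (P t)) = 1"
      "degree (root_part (- B) (P t)) = degree (root_part (- B) (P t0)) \<and> lead_coeff (root_part (- B) (P t)) = 1"
      using pt lead_coeff_root_part unfolding p_def by blast+
  next
    show "Ck_poly_on n P (ball t0 e)"
      using assms(4) sub by (auto simp: Ck_poly_on_def intro: Ck_on_subset)
  qed auto
  moreover have "degree (root_part B (P t)) = degree (root_part B (P t0))" if "t \<in> ball t0 e" for t
    using e(2)[OF that] unfolding p_def by blast
  ultimately show ?thesis using that[OF e(1) sub] by blast
qed

section \<open>One factor for each distinct root\<close>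

lemma isolating_ball:
  assumes "finite Z"
  shows "\<exists>\<eta>>0. \<forall>z\<in>Z - {\<nu>}. \<eta> < dist \<nu> (z :: complex)"
proof -
  obtain \<eta> where "\<eta> > 0" "\<forall>x\<in>Z. x \<noteq> \<nu> \<longrightarrow> \<eta> \<le> dist \<nu> x"
    using finite_set_avoid[OF assms, of \<nu>] by blast
  then show ?thesis by (intro exI[of _ "\<eta> / 2"]) force
qed

lemma interior_ball_Un:
  assumes "\<eta> > 0" "z \<noteq> \<nu> \<Longrightarrow> \<eta> < dist \<nu> z"
  shows "z \<in> interior (ball \<nu> \<eta>) \<union> interior (- ball \<nu> \<eta>)"
proof (cases "z = \<nu>")
  case False
  then have "z \<in> - cball \<nu> \<eta>" using assms(2) by auto
  moreover have "- cball \<nu> \<eta> \<subseteq> interior (- ball \<nu> \<eta>)"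
    by (intro interior_maximal) auto
  ultimately show ?thesis by blast
qed (use assms in simp)

lemma finite_separated:
  assumes "finite Z"
  shows "\<exists>\<eta>>0. \<forall>y\<in>Z. \<forall>z\<in>Z. y \<noteq> z \<longrightarrow> 2 * \<eta> \<le> dist y (z :: complex)"
proof -
  \<comment> \<open>The element 1 provides a minimum when \<open>Z\<close> has fewer than two
    points.\<close>
  define M where "M = insert 1 ((\<lambda>(y, z). dist y z) ` {(y, z). y \<in> Z \<and> z \<in> Z \<and> y \<noteq> z})"
  have "finite {(y, z). y \<in> Z \<and> z \<in> Z \<and> y \<noteq> z}"
    by (rule finite_subset[of _ "Z \<times> Z"]) (use assms in auto)
  then have M: "finite M" "\<And>x. x \<in> M \<Longrightarrow> x > 0" by (auto simp: M_def)
  then have "Min M > 0" using Min_in[of M] by (auto simp: M_def)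
  moreover have "Min M \<le> dist y z" if "y \<in> Z" "z \<in> Z" "y \<noteq> z" for y z
    using M(1) that by (intro Min_le) (auto simp: M_def)
  ultimately show ?thesis by (intro exI[of _ "Min M / 2"]) auto
qed

text \<open>Condition (3) speaks about every splitting, so it yields something only once a splitting
  exists. The factors are the root parts for disjoint balls about the distinct roots of
  \<open>P t0\<close>.\<close>

lemma splitting_exists:
  assumes "open I" "t0 \<in> I" "\<And>t. t \<in> I \<Longrightarrow> monic_deg d (P t)" "Ck_poly_on n P I"
  shows "\<exists>Q. splitting_at n P t0 (card {z. poly (P t0) z = 0}) Q"
proof -
  define Z where "Z = {z. poly (P t0) z = 0}"
  have m0: "monic_deg d (P t0)" using assms by blast
  then have fin: "finite Z" unfolding Z_def by (intro poly_roots_finite) (auto simp: monic_deg_def)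
  then obtain \<nu> where \<nu>: "bij_betw \<nu> {1..card Z} Z"
    using ex_bij_betw_nat_finite_1 by blast
  obtain \<eta> where \<eta>: "\<eta> > 0" "\<And>y z. y \<in> Z \<Longrightarrow> z \<in> Z \<Longrightarrow> y \<noteq> z \<Longrightarrow> 2 * \<eta> \<le> dist y z"
    using finite_separated[OF fin] by blast
  define B where "B i = ball (\<nu> i) \<eta>" for i
  have \<nu>_surj: "\<exists>i\<in>{1..card Z}. z = \<nu> i" if "poly (P t0) z = 0" for z
  proof -
    have "z \<in> \<nu> ` {1..card Z}" using that bij_betw_imp_surj_on[OF \<nu>] by (simp add: Z_def)
    then show ?thesis by blast
  qed
  have \<nu>Z: "\<nu> i \<in> Z" if "i \<in> {1..card Z}" for i using \<nu> that by (auto simp: bij_betw_def)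
  have inj: "\<nu> i = \<nu> j \<longleftrightarrow> i = j" if "i \<in> {1..card Z}" "j \<in> {1..card Z}" for i j
    using inj_on_eq_iff[OF bij_betw_imp_inj_on[OF \<nu>] that] .
  have disj: "B i \<inter> B j = {}" if "i \<in> {1..card Z}" "j \<in> {1..card Z}" "i \<noteq> j" for i j
  proof (rule ccontr)
    assume "B i \<inter> B j \<noteq> {}"
    then obtain x where "dist (\<nu> i) x < \<eta>" "dist (\<nu> j) x < \<eta>" by (auto simp: B_def)
    then have "dist (\<nu> i) (\<nu> j) < 2 * \<eta>"
      using dist_triangle2[of "\<nu> i" "\<nu> j" x] by simp
    then show False using \<eta>(2)[OF \<nu>Z[OF that(1)] \<nu>Z[OF that(2)]] inj[OF that(1,2)] that(3) by auto
  qed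
  have root: "z = \<nu> i" if "i \<in> {1..card Z}" "z \<in> Z" "z \<in> B i" for z i
    using \<eta>(2)[OF \<nu>Z[OF that(1)] that(2)] that(3) \<open>\<eta> > 0\<close> by (force simp: B_def)
  have intr: "z \<in> interior (B i) \<union> interior (- B i)" if "i \<in> {1..card Z}" "poly (P t0) z = 0" for z i
    unfolding B_def
  proof (rule interior_ball_Un[OF \<eta>(1)])
    assume "z \<noteq> \<nu> i"
    then show "\<eta> < dist (\<nu> i) z"
      using \<eta>(1) \<eta>(2)[OF \<nu>Z[OF that(1)], of z] that(2) by (simp add: Z_def)
  qed
  have "\<exists>e>0. ball t0 e \<subseteq> I \<and>
      (\<forall>t\<in>ball t0 e. degree (root_part (B i) (P t)) = degree (root_part (B i) (P t0))) \<and>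
      Ck_poly_on n (\<lambda>t. root_part (B i) (P t)) (ball t0 e)" if "i \<in> {1..card Z}" for i
    using root_part_Ck[of I t0 d P n "B i"] assms intr[OF that] by metis
  then obtain e where e: "\<And>i. i \<in> {1..card Z} \<Longrightarrow> e i > 0 \<and> ball t0 (e i) \<subseteq> I \<and>
      (\<forall>t\<in>ball t0 (e i). degree (root_part (B i) (P t)) = degree (root_part (B i) (P t0))) \<and>
      Ck_poly_on n (\<lambda>t. root_part (B i) (P t)) (ball t0 (e i))" by metis
  have inI: "\<forall>\<^sub>F t in at t0. t \<in> I" using assms(1,2) by (simp add: eventually_at_in_open')
  then have ev: "\<forall>\<^sub>F t in at t0. monic_deg d (P t)" by eventually_elim (rule assms(3))
  have lim: "poly_tendsto P (P t0) (at t0)" using Ck_poly_on_imp_tendsto[OF assms(4,1,2)] .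
  have "\<forall>\<^sub>F t in at t0. \<forall>z. poly (P t) z = 0 \<longrightarrow> z \<in> (\<Union>i\<in>{1..card Z}. B i)"
  proof (rule eventually_all_roots[OF m0 ev lim])
    fix z assume "poly (P t0) z = 0"
    then obtain i where "i \<in> {1..card Z}" "z = \<nu> i" using \<nu>_surj by blast
    then show "z \<in> (\<Union>i\<in>{1..card Z}. B i)" using \<eta>(1) by (intro UN_I[of i]) (auto simp: B_def)
  qed (auto simp: B_def)
  with inI have "\<forall>\<^sub>F t in at t0. t \<in> I \<and> (\<forall>z. poly (P t) z = 0 \<longrightarrow> z \<in> (\<Union>i\<in>{1..card Z}. B i))"
    by eventually_elim auto
  moreover have "t0 \<in> I \<and> (\<forall>z. poly (P t0) z = 0 \<longrightarrow> z \<in> (\<Union>i\<in>{1..card Z}. B i))"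
  proof (intro conjI allI impI)
    fix z assume "poly (P t0) z = 0"
    then obtain i where "i \<in> {1..card Z}" "z = \<nu> i" using \<nu>_surj by blast
    then show "z \<in> (\<Union>i\<in>{1..card Z}. B i)" using \<eta>(1) by (intro UN_I[of i]) (auto simp: B_def)
  qed (rule assms(2))
  ultimately obtain e0 where e0: "e0 > 0"
    "\<And>t. t \<in> ball t0 e0 \<Longrightarrow> t \<in> I \<and> (\<forall>z. poly (P t) z = 0 \<longrightarrow> z \<in> (\<Union>i\<in>{1..card Z}. B i))"
    using eventually_at_imp_ball[of "\<lambda>t. t \<in> I \<and> (\<forall>z. poly (P t) z = 0 \<longrightarrow> z \<in> (\<Union>i\<in>{1..card Z}. B i))" t0]
    by blast
  \<comment> \<open>Near \<open>t0\<close> every root lies in exactly one of the disjoint balls, so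
    the linear factors can be grouped by balls.\<close>
  have fac: "P t = (\<Prod>i=1..card Z. root_part (B i) (P t))" if t: "t \<in> ball t0 e0" for t
  proof -
    obtain \<mu> where \<mu>: "root_tuple d \<mu> (P t)"
      using monic_deg_imp_root_tuple assms(3) e0(2)[OF t] by blast
    have "{1..d} = (\<Union>i\<in>{1..card Z}. {j\<in>{1..d}. \<mu> j \<in> B i})"
      using e0(2)[OF t] root_tuple_poly_eq_0_iff[OF \<mu>] by fast
    then have "(\<Prod>j=1..d. [:- \<mu> j, 1:]) = (\<Prod>j\<in>(\<Union>i\<in>{1..card Z}. {j\<in>{1..d}. \<mu> j \<in> B i}). [:- \<mu> j, 1:])"
      by (rule prod.cong[OF _ refl])
    also have "\<dots> = (\<Prod>i=1..card Z. \<Prod>j\<in>{j\<in>{1..d}. \<mu> j \<in> B i}. [:- \<mu> j, 1:])"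
      by (rule prod.UNION_disjoint) (simp, simp, use disj in blast)
    finally show ?thesis using \<mu> root_part_eq[OF \<mu>] by (simp add: root_tuple_def)
  qed
  define e' where "e' = Min (insert e0 (e ` {1..card Z}))"
  have e'_pos: "e' > 0" using e e0(1) by (auto simp: e'_def)
  have e'_le: "e' \<le> e0" "\<And>i. i \<in> {1..card Z} \<Longrightarrow> e' \<le> e i" unfolding e'_def by (rule Min_le; simp)+
  define m where "m i = degree (root_part (B i) (P t0))" for i
  obtain w where w: "root_tuple d w (P t0)" using monic_deg_imp_root_tuple m0 by blast
  have Qt0: "root_part (B i) (P t0) = [:- \<nu> i, 1:] ^ m i \<and> 1 \<le> m i" if i: "i \<in> {1..card Z}" for i
  proof -
    let ?A = "{j\<in>{1..d}. w j \<in> B i}"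
    have "w j = \<nu> i" if "j \<in> ?A" for j
    proof -
      have "poly (P t0) (w j) = 0" using that root_tuple_poly_eq_0_iff[OF w] by blast
      then show ?thesis using root[OF i, of "w j"] that by (simp add: Z_def)
    qed
    then have eq: "root_part (B i) (P t0) = [:- \<nu> i, 1:] ^ card ?A"
      unfolding root_part_eq[OF w] prod_constant[symmetric] by (intro prod.cong refl) simp
    then have m: "m i = card ?A" by (simp add: m_def degree_linear_power)
    have "poly (P t0) (\<nu> i) = 0" using \<nu>Z[OF i] by (simp add: Z_def)
    then obtain j where "j \<in> {1..d}" "\<nu> i = w j" using root_tuple_poly_eq_0_iff[OF w] by auto
    then have "j \<in> ?A" using \<eta>(1) by (simp add: B_def)
    then have "?A \<noteq> {}" by blast
    then have "card ?A \<ge> 1" by (simp add: Suc_leI card_gt_0_iff)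
    then show ?thesis using eq m by simp
  qed
  have "splitting_at n P t0 (card Z) (\<lambda>i t. root_part (B i) (P t))"
    unfolding splitting_at_def
  proof (intro exI[of _ \<nu>] exI[of _ m] conjI exI[of _ e'] ballI)
    show "inj_on \<nu> {1..card Z}" using \<nu> by (auto simp: bij_betw_def)
  next
    fix i t assume i: "i \<in> {1..card Z}" and "t \<in> ball t0 e'"
    then have "t \<in> ball t0 (e i)" using subset_ball[OF e'_le(2)[OF i]] by blast
    then show "degree (root_part (B i) (P t)) = m i"
      using e[OF i] unfolding m_def by blast
  next
    fix i assume i: "i \<in> {1..card Z}"
    show "\<forall>j. Ck_on n (\<lambda>t. coeff (root_part (B i) (P t)) j) (ball t0 e')"
      using e[OF i] e'_le(2)[OF i] unfolding Ck_poly_on_def by (meson Ck_on_subset subset_ball)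
  qed (use Qt0 fac e'_pos e'_le(1) lead_coeff_root_part in auto)
  then show ?thesis unfolding Z_def by blast
qed

section \<open>The polynomials \<open>\<Delta>\<^sub>k\<close> and the diameter of the roots\<close>

text \<open>A set of \<open>k\<close> indices has \<open>k * (k - 1)\<close> ordered pairs, and a
  squared difference accounts for both orders up to sign. The cofactors \<open>g i j\<close> are
  indexed by pairs because later they are continuous functions obtained separately for each pair of
  roots.\<close>

lemma Delta_tuple_factor:
  assumes "\<And>i j. i \<in> {1..d} \<Longrightarrow> j \<in> {1..d} \<Longrightarrow> i \<noteq> j \<Longrightarrow> f i - f j = c * g i j"
  shows "Delta_tuple k d f = c ^ (k * (k - 1)) *
    (\<Sum>A | A \<subseteq> {1..d} \<and> card A = k. (-1) ^ (k * (k - 1) div 2) * (\<Prod>i\<in>A. \<Prod>j\<in>A - {i}. g i j))"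
proof -
  have "(\<Prod>i\<in>A. \<Prod>j\<in>{j\<in>A. i < j}. (f i - f j)\<^sup>2) =
      c ^ (k * (k - 1)) * ((-1) ^ (k * (k - 1) div 2) * (\<Prod>i\<in>A. \<Prod>j\<in>A - {i}. g i j))"
    if A: "A \<subseteq> {1..d}" "card A = k" for A
  proof -
    have fin: "finite A" using A by (auto intro: finite_subset)
    have "(\<Prod>i\<in>A. \<Prod>j\<in>A - {i}. f i - f j) = (\<Prod>i\<in>A. c ^ (k - 1) * (\<Prod>j\<in>A - {i}. g i j))"
    proof (rule prod.cong[OF refl])
      fix i assume i: "i \<in> A"
      have "(\<Prod>j\<in>A - {i}. f i - f j) = (\<Prod>j\<in>A - {i}. c * g i j)"
        using A i by (intro prod.cong assms) auto
      then show "(\<Prod>j\<in>A - {i}. f i - f j) = c ^ (k - 1) * (\<Prod>j\<in>A - {i}. g i j)"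
        using A i fin by (simp add: prod.distrib)
    qed
    also have "\<dots> = c ^ (k * (k - 1)) * (\<Prod>i\<in>A. \<Prod>j\<in>A - {i}. g i j)"
      using A by (simp add: prod.distrib mult.commute flip: power_mult)
    finally show ?thesis using prod_square_diff[OF fin, of f] A by simp
  qed
  then show ?thesis unfolding Delta_tuple_def sum_distrib_left by (intro sum.cong refl) blast
qed

text \<open>Homogeneity of degree \<open>k * (k - 1)\<close> combined with translation invariance;
  it serves to normalize the diameter to 1. The instance with constant 1 brings
  \<open>Delta_tuple k d g\<close> into the same product form.\<close>

lemma Delta_tuple_scale:
  assumes "\<And>i j. i \<in> {1..d} \<Longrightarrow> j \<in> {1..d} \<Longrightarrow> f i - f j = c * (g i - g j)"
  shows "Delta_tuple k d f = c ^ (k * (k - 1)) * Delta_tuple k d g"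
  using Delta_tuple_factor[of d f c "\<lambda>i j. g i - g j" k] Delta_tuple_factor[of d g 1 "\<lambda>i j. g i - g j" k] assms
  by simp

lemma Delta_tuple_tendsto:
  assumes "\<And>j. j \<in> {1..d} \<Longrightarrow> ((\<lambda>t. w t j) \<longlongrightarrow> w0 j) F"
  shows "((\<lambda>t. Delta_tuple k d (w t)) \<longlongrightarrow> Delta_tuple k d w0) F"
  unfolding Delta_tuple_def by (intro tendsto_intros assms) auto

text \<open>A set of \<open>k\<close> indices contributes to \<open>\<Delta>\<^sub>k\<close> only if it meets every group of equal roots
  exactly once, and all these contributions are equal.\<close>

lemma Delta_tuple_card_nonzero: "Delta_tuple (card (w ` {1..d})) d w \<noteq> 0"
proof -
  define V where "V = w ` {1..d}"
  define D where "D = (\<Prod>u\<in>V. \<Prod>v\<in>V - {u}. u - v)"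
  define s :: complex where "s = (-1) ^ (card V * (card V - 1) div 2)"
  let ?S = "{A. A \<subseteq> {1..d} \<and> card A = card V}"
  have fV: "finite V" by (simp add: V_def)
  have summand: "(\<Prod>i\<in>A. \<Prod>j\<in>{j\<in>A. i < j}. (w i - w j)\<^sup>2) = (if inj_on w A then s * D else 0)"
    if "A \<in> ?S" for A
  proof -
    have A: "finite A" "A \<subseteq> {1..d}" "card A = card V" using that by (auto intro: finite_subset)
    have "(\<Prod>i\<in>A. \<Prod>j\<in>A - {i}. w i - w j) = (if inj_on w A then D else 0)"
    proof (cases "inj_on w A")
      case True
      have "w ` A \<subseteq> V" "card (w ` A) = card V" using A True by (auto simp: V_def card_image)
      then have "w ` A = V" using fV by (intro card_subset_eq) auto
      have "D = (\<Prod>u\<in>w ` A. \<Prod>v\<in>w ` A - {u}. u - v)" by (simp add: D_def \<open>w ` A = V\<close>)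
      also have "\<dots> = (\<Prod>i\<in>A. \<Prod>v\<in>w ` A - {w i}. w i - v)"
        using True by (simp add: prod.reindex)
      also have "\<dots> = (\<Prod>i\<in>A. \<Prod>j\<in>A - {i}. w i - w j)"
      proof (rule prod.cong[OF refl])
        fix i assume "i \<in> A"
        then have "w ` A - {w i} = w ` (A - {i})" using True by (auto simp: inj_on_def)
        then show "(\<Prod>v\<in>w ` A - {w i}. w i - v) = (\<Prod>j\<in>A - {i}. w i - w j)"
          using True by (simp add: prod.reindex inj_on_diff)
      qed
      finally show ?thesis using True by simp
    next
      case False
      then obtain i j where "i \<in> A" "j \<in> A" "i \<noteq> j" "w i = w j" by (auto simp: inj_on_def)
      then have "(\<Prod>j\<in>A - {i}. w i - w j) = 0" using A by (intro prod_zero) auto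
      then have "(\<Prod>i\<in>A. \<Prod>j\<in>A - {i}. w i - w j) = 0" using A \<open>i \<in> A\<close> by (intro prod_zero) auto
      then show ?thesis using False by simp
    qed
    then show ?thesis using prod_square_diff[OF A(1), of w] A by (simp add: s_def)
  qed
  have fS: "finite ?S" by (rule finite_subset[of _ "Pow {1..d}"]) auto
  have "Delta_tuple (card V) d w = (\<Sum>A\<in>?S. if inj_on w A then s * D else 0)"
    unfolding Delta_tuple_def using summand by (intro sum.cong) auto
  also have "\<dots> = (\<Sum>A\<in>{A\<in>?S. inj_on w A}. s * D)"
    using fS by (intro sum.mono_neutral_cong_right) auto
  also have "\<dots> = of_nat (card {A\<in>?S. inj_on w A}) * (s * D)" by simp
  finally have eq: "Delta_tuple (card V) d w = of_nat (card {A\<in>?S. inj_on w A}) * (s * D)" .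
  \<comment> \<open>One index from each group of equal values gives a set that does contribute, and
    a positive multiple of a nonzero complex number is nonzero.\<close>
  obtain A where "A \<subseteq> {1..d}" "inj_on w A" "V = w ` A"
    using subset_image_inj[of V w "{1..d}"] by (auto simp: V_def)
  then have "A \<in> {A\<in>?S. inj_on w A}" by (auto simp: card_image)
  then have "card {A\<in>?S. inj_on w A} \<noteq> 0" using fS by (auto simp: card_eq_0_iff)
  moreover have "D \<noteq> 0" using fV by (auto simp: D_def)
  ultimately show ?thesis using eq by (simp add: V_def s_def)
qed

lemma bounded_tuple_subseq:
  fixes w :: "nat \<Rightarrow> nat \<Rightarrow> complex"
  assumes "\<And>s j. j \<in> {1..d} \<Longrightarrow> norm (w s j) \<le> B"
  shows "\<exists>r l. strict_mono (r :: nat \<Rightarrow> nat) \<and> (\<forall>j\<in>{1..d}. (\<lambda>s. w (r s) j) \<longlonglongrightarrow> l j)"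
  using assms
proof (induction d)
  case 0
  then show ?case by (intro exI[of _ id]) (auto simp: strict_mono_def)
next
  case (Suc d)
  then obtain r l where r: "strict_mono r" "\<And>j. j \<in> {1..d} \<Longrightarrow> (\<lambda>s. w (r s) j) \<longlonglongrightarrow> l j"
    by (metis atLeastAtMost_iff le_SucI)
  have "seq_compact (cball 0 B :: complex set)" by (simp add: compact_imp_seq_compact)
  moreover have "\<forall>s. w (r s) (Suc d) \<in> cball 0 B" using Suc.prems[of "Suc d"] by simp
  ultimately obtain l' r' where r': "strict_mono r'" "((\<lambda>s. w (r s) (Suc d)) \<circ> r') \<longlonglongrightarrow> l'"
    by (metis seq_compactE)
  have "(\<lambda>s. w ((r \<circ> r') s) j) \<longlonglongrightarrow> (l(Suc d := l')) j" if "j \<in> {1..Suc d}" for j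
  proof (cases "j = Suc d")
    case True
    then show ?thesis using r' by (simp add: o_def)
  next
    case False
    then have "(\<lambda>s. w (r s) j) \<longlonglongrightarrow> l j" using r(2) that by auto
    from LIMSEQ_subseq_LIMSEQ[OF this r'(1)] show ?thesis using False by (simp add: o_def)
  qed
  moreover have "strict_mono (r \<circ> r')" using r(1) r'(1) by (rule strict_mono_o)
  ultimately show ?case by blast
qed

text \<open>Compactness of the set of tuples of diameter one, up to translation.\<close>

lemma Delta_tuple_lower_bound:
  "\<exists>c>0. \<forall>\<mu> D. D > 0 \<and> (\<forall>i\<in>{1..d}. \<forall>j\<in>{1..d}. norm (\<mu> i - \<mu> j) \<le> D) \<and>
      (\<exists>i\<in>{1..d}. \<exists>j\<in>{1..d}. norm (\<mu> i - \<mu> j) = D) \<longrightarrow>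
    (\<exists>k\<in>{2..d}. c * D ^ (k * (k - 1)) \<le> norm (Delta_tuple k d \<mu>))"
proof -
  define G where "G \<mu> D \<longleftrightarrow> D > 0 \<and> (\<forall>i\<in>{1..d}. \<forall>j\<in>{1..d}. norm (\<mu> i - \<mu> j) \<le> D) \<and>
      (\<exists>i\<in>{1..d}. \<exists>j\<in>{1..d}. norm (\<mu> i - \<mu> j) = D)" for \<mu> :: "nat \<Rightarrow> complex" and D :: real
  have "\<exists>c>0. \<forall>\<mu> D. G \<mu> D \<longrightarrow> (\<exists>k\<in>{2..d}. c * D ^ (k * (k - 1)) \<le> norm (Delta_tuple k d \<mu>))"
  proof (rule ccontr)
    assume neg: "\<not> ?thesis"
    \<comment> \<open>If no constant works, then 1/(s+1) fails for every \<open>s\<close>, which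
      gives a sequence of counterexamples.\<close>
    have "\<forall>s::nat. \<exists>x. G (fst x) (snd x) \<and>
        (\<forall>k\<in>{2..d}. norm (Delta_tuple k d (fst x)) < inverse (real (Suc s)) * snd x ^ (k * (k - 1)))"
    proof
      fix s :: nat
      have "inverse (real (Suc s)) > 0" by simp
      then obtain \<mu> D where "G \<mu> D"
        "\<not> (\<exists>k\<in>{2..d}. inverse (real (Suc s)) * D ^ (k * (k - 1)) \<le> norm (Delta_tuple k d \<mu>))"
        using neg by blast
      then show "\<exists>x. G (fst x) (snd x) \<and>
        (\<forall>k\<in>{2..d}. norm (Delta_tuple k d (fst x)) < inverse (real (Suc s)) * snd x ^ (k * (k - 1)))"
        by (intro exI[of _ "(\<mu>, D)"]) (auto simp: not_le)
    qed
    from choice[OF this] obtain x where x: "\<And>s. G (fst (x s)) (snd (x s))"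
      "\<And>s k. k \<in> {2..d} \<Longrightarrow> norm (Delta_tuple k d (fst (x s))) < inverse (real (Suc s)) * snd (x s) ^ (k * (k - 1))"
      by blast
    define \<mu> D where "\<mu> s = fst (x s)" and "D s = snd (x s)" for s
    have \<mu>: "\<And>s. D s > 0"
      "\<And>s i j. i \<in> {1..d} \<Longrightarrow> j \<in> {1..d} \<Longrightarrow> norm (\<mu> s i - \<mu> s j) \<le> D s"
      "\<And>s. \<exists>i\<in>{1..d}. \<exists>j\<in>{1..d}. norm (\<mu> s i - \<mu> s j) = D s"
      "\<And>s k. k \<in> {2..d} \<Longrightarrow> norm (Delta_tuple k d (\<mu> s)) < inverse (real (Suc s)) * D s ^ (k * (k - 1))"
      using x unfolding G_def \<mu>_def D_def by blast+
    \<comment> \<open>Translating the first root to 0 and dividing by the diameter puts all tuples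
      into the unit ball, with diameter exactly 1.\<close>
    define w where "w s j = inverse (of_real (D s)) * (\<mu> s j - \<mu> s 1)" for s j
    have wd: "w s i - w s j = inverse (of_real (D s)) * (\<mu> s i - \<mu> s j)" for s i j
      by (simp add: w_def algebra_simps)
    have "norm (w s j) \<le> 1" if "j \<in> {1..d}" for s j
    proof -
      have "norm (w s j) = norm (\<mu> s j - \<mu> s 1) / D s"
        using \<mu>(1)[of s] by (simp add: w_def norm_mult norm_inverse divide_inverse mult.commute)
      then show ?thesis using \<mu>(2)[OF that, of 1 s] that \<mu>(1)[of s] by simp
    qed
    then obtain r l where r: "strict_mono r" "\<And>j. j \<in> {1..d} \<Longrightarrow> (\<lambda>s. w (r s) j) \<longlonglongrightarrow> l j"
      using bounded_tuple_subseq[of d w 1] by blast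
    \<comment> \<open>The double sum stands in for the diameter: it passes to the limit directly,
      and its lower bound 1 shows that the limit tuple is not constant.\<close>
    have "(\<lambda>s. \<Sum>i\<in>{1..d}. \<Sum>j\<in>{1..d}. norm (w (r s) i - w (r s) j)) \<longlonglongrightarrow>
        (\<Sum>i\<in>{1..d}. \<Sum>j\<in>{1..d}. norm (l i - l j))"
      by (intro tendsto_intros r(2))
    moreover have "1 \<le> (\<Sum>i\<in>{1..d}. \<Sum>j\<in>{1..d}. norm (w s i - w s j))" for s
    proof -
      obtain i j where ij: "i \<in> {1..d}" "j \<in> {1..d}" "norm (\<mu> s i - \<mu> s j) = D s" using \<mu>(3) by blast
      have "1 = norm (w s i - w s j)"
        using \<mu>(1)[of s] by (simp add: wd norm_mult norm_inverse ij(3))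
      also have "\<dots> \<le> (\<Sum>j\<in>{1..d}. norm (w s i - w s j))"
        using ij by (intro member_le_sum) auto
      also have "\<dots> \<le> (\<Sum>i\<in>{1..d}. \<Sum>j\<in>{1..d}. norm (w s i - w s j))"
        using ij by (intro member_le_sum[of i _ "\<lambda>i. \<Sum>j\<in>{1..d}. norm (w s i - w s j)"] sum_nonneg) auto
      finally show ?thesis .
    qed
    ultimately have ge1: "1 \<le> (\<Sum>i\<in>{1..d}. \<Sum>j\<in>{1..d}. norm (l i - l j))"
      by (intro LIMSEQ_le_const) auto
    have "\<exists>i\<in>{1..d}. \<exists>j\<in>{1..d}. l i \<noteq> l j"
    proof (rule ccontr)
      assume "\<not> ?thesis"
      then have *: "l i = l j" if "i \<in> {1..d}" "j \<in> {1..d}" for i j using that by blast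
      have "\<forall>i\<in>{1..d}. \<forall>j\<in>{1..d}. norm (l i - l j) = 0"
      proof (intro ballI)
        fix i j assume "i \<in> {1..d}" "j \<in> {1..d}"
        from *[OF this] show "norm (l i - l j) = 0" by simp
      qed
      then have "\<forall>i\<in>{1..d}. (\<Sum>j\<in>{1..d}. norm (l i - l j)) = 0" by (meson sum.neutral)
      then have "(\<Sum>i\<in>{1..d}. \<Sum>j\<in>{1..d}. norm (l i - l j)) = 0" by (rule sum.neutral)
      with ge1 show False by simp
    qed
    then obtain i j where ij: "i \<in> {1..d}" "j \<in> {1..d}" "l i \<noteq> l j" by blast
    \<comment> \<open>With \<open>k\<close> the number of distinct values of the limit tuple, at
      least 2, \<open>Delta_tuple k\<close> is nonzero at the limit, whereas the choice of the
      sequence makes it tend to 0.\<close>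
    define k where "k = card (l ` {1..d})"
    have "card {l i, l j} \<le> k" unfolding k_def using ij by (intro card_mono) auto
    moreover have "k \<le> d" unfolding k_def using card_image_le[of "{1..d}" l] by simp
    ultimately have k: "k \<in> {2..d}" using ij by simp
    have "(\<lambda>s. Delta_tuple k d (w (r s))) \<longlonglongrightarrow> 0"
    proof (rule Lim_null_comparison)
      have "norm (Delta_tuple k d (w s)) \<le> inverse (real (Suc s))" for s
      proof -
        have "Delta_tuple k d (w s) = inverse (of_real (D s)) ^ (k * (k - 1)) * Delta_tuple k d (\<mu> s)"
          by (rule Delta_tuple_scale) (rule wd)
        then have c: "Delta_tuple k d (w s) * of_real (D s) ^ (k * (k - 1)) = Delta_tuple k d (\<mu> s)"
          using \<mu>(1)[of s] by (simp add: field_simps)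
        have "norm (Delta_tuple k d (w s)) * D s ^ (k * (k - 1)) = norm (Delta_tuple k d (\<mu> s))"
          unfolding c[symmetric] norm_mult norm_power using \<mu>(1)[of s] by simp
        also have "\<dots> \<le> inverse (real (Suc s)) * D s ^ (k * (k - 1))" using \<mu>(4)[OF k, of s] by simp
        finally show ?thesis using \<mu>(1)[of s] by (simp only: mult_le_cancel_right_pos zero_less_power)
      qed
      then have "norm (Delta_tuple k d (w (r s))) \<le> inverse (real (Suc (r s)))" for s by blast
      moreover have "inverse (real (Suc (r s))) \<le> inverse (real (Suc s))" for s
        using seq_suble[OF r(1), of s] by (simp add: field_simps)
      ultimately show "\<forall>\<^sub>F s in sequentially. norm (Delta_tuple k d (w (r s))) \<le> inverse (real (Suc s))"
        by (intro always_eventually allI) (meson order_trans)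
    qed (rule LIMSEQ_inverse_real_of_nat)
    moreover have "(\<lambda>s. Delta_tuple k d (w (r s))) \<longlonglongrightarrow> Delta_tuple k d l"
      by (rule Delta_tuple_tendsto) (rule r(2))
    ultimately have "Delta_tuple k d l = 0" by (meson LIMSEQ_unique)
    then show False using Delta_tuple_card_nonzero[of l d] by (simp add: k_def)
  qed
  then show ?thesis unfolding G_def .
qed

text \<open>Contact is stated for the set of roots instead of a parameterization: it makes sense
  before any parameterization is known, and it passes to factors of \<open>P\<close>. The constant
  may depend on \<open>t0\<close> and on the root \<nu>.\<close>

definition contact_at :: "(real \<Rightarrow> complex poly) \<Rightarrow> real \<Rightarrow> bool" where
  "contact_at P t0 \<longleftrightarrow> (\<forall>\<nu>. poly (P t0) \<nu> = 0 \<longrightarrow> (\<exists>C U. open U \<and> \<nu> \<in> U \<and>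
     (\<forall>\<^sub>F t in at t0. \<forall>x\<in>U. \<forall>y\<in>U. poly (P t) x = 0 \<and> poly (P t) y = 0 \<longrightarrow>
        norm (x - y) \<le> C * \<bar>t - t0\<bar>)))"

text \<open>The multiplicity is a supremum in \<open>enat\<close>, possibly infinite, so the
  exponent found may exceed \<open>N\<close>. For \<open>N = 0\<close> there may be no admissible
  exponent at all, namely if \<open>f\<close> is not continuous near \<open>t0\<close>.\<close>

lemma mult_at_imp_factor:
  assumes "enat N \<le> mult_at t0 f" "N \<ge> 1"
  shows "\<exists>p\<ge>N. \<exists>g. \<exists>e>0. continuous_on (ball t0 e) g \<and>
     (\<forall>t\<in>ball t0 e. f t = of_real (t - t0) ^ p * g t)"
proof -
  define S where "S = {p. \<exists>g. \<exists>e>0. continuous_on (ball t0 e) g \<and>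
     (\<forall>t\<in>ball t0 e. f t = of_real (t - t0) ^ p * g t)}"
  have "\<exists>p\<in>S. p \<ge> N"
  proof (rule ccontr)
    assume "\<not> ?thesis"
    then have "mult_at t0 f \<le> enat (N - 1)"
      unfolding mult_at_def by (intro Sup_least) (force simp: S_def)
    with assms have "enat N \<le> enat (N - 1)" by (meson order_trans)
    with assms(2) show False by simp
  qed
  then show ?thesis unfolding S_def by blast
qed

lemma mult_at_imp_bound:
  assumes "enat N \<le> mult_at t0 f" "N \<ge> 1"
  shows "\<exists>K. \<forall>\<^sub>F t in at t0. norm (f t) \<le> K * \<bar>t - t0\<bar> ^ N"
proof -
  obtain p g e where pge: "p \<ge> N" "e > 0" "continuous_on (ball t0 e) g"
    "\<forall>t\<in>ball t0 e. f t = of_real (t - t0) ^ p * g t"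
    using mult_at_imp_factor[OF assms] by (elim exE conjE) (rule that; assumption)
  have "isCont g t0" using pge(2,3) by (simp add: continuous_on_eq_continuous_at)
  then have "((\<lambda>t. norm (g t)) \<longlongrightarrow> norm (g t0)) (at t0)"
    unfolding isCont_def by (rule tendsto_norm)
  then have "\<forall>\<^sub>F t in at t0. norm (g t) < norm (g t0) + 1"
    by (rule order_tendstoD) simp
  \<comment> \<open>Within distance 1 of \<open>t0\<close> the power with exponent \<open>p\<close>
    is dominated by the one with exponent \<open>N\<close>.\<close>
  moreover have "\<forall>\<^sub>F t in at t0. t \<in> ball t0 (min e 1)"
    using pge(2) by (intro eventually_at_in_open') auto
  ultimately have "\<forall>\<^sub>F t in at t0. norm (f t) \<le> (norm (g t0) + 1) * \<bar>t - t0\<bar> ^ N"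
  proof eventually_elim
    case (elim t)
    then have t: "t \<in> ball t0 e" "\<bar>t - t0\<bar> \<le> 1" by (auto simp: dist_real_def)
    have "norm (f t) = \<bar>t - t0\<bar> ^ p * norm (g t)"
      by (simp add: bspec[OF pge(4) t(1)] norm_mult norm_power flip: of_real_diff)
    also have "\<dots> \<le> \<bar>t - t0\<bar> ^ N * (norm (g t0) + 1)"
      using t(2) pge(1) elim(1) by (intro mult_mono power_decreasing) auto
    finally show ?case by (simp add: mult.commute)
  qed
  then show ?thesis by blast
qed

text \<open>For the diameter D of the roots, some \<open>k\<close> satisfies c D^N \<le> |Delta_k|
  \<le> K_k |t - t0|^N with N = k(k-1), and taking N-th roots gives D = O(|t - t0|). Since this
  \<open>k\<close> varies with \<open>t\<close>, the constant has to serve all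
  \<open>k\<close>.\<close>

lemma Delta_mult_imp_close_roots:
  assumes "\<forall>\<^sub>F t in at t0. monic_deg d (Q t)"
    and "\<And>k. 2 \<le> k \<Longrightarrow> k \<le> d \<Longrightarrow> enat (k * (k - 1)) \<le> mult_at t0 (\<lambda>t. Delta k (Q t))"
  shows "\<exists>C. \<forall>\<^sub>F t in at t0. \<forall>x y. poly (Q t) x = 0 \<and> poly (Q t) y = 0 \<longrightarrow> norm (x - y) \<le> C * \<bar>t - t0\<bar>"
proof -
  have "\<exists>K. \<forall>\<^sub>F t in at t0. norm (Delta k (Q t)) \<le> K * \<bar>t - t0\<bar> ^ (k * (k - 1))" if k: "k \<in> {2..d}" for k
    using k by (intro mult_at_imp_bound assms(2)) (auto simp: Suc_leI)
  then obtain K where K: "\<And>k. k \<in> {2..d} \<Longrightarrow>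
      \<forall>\<^sub>F t in at t0. norm (Delta k (Q t)) \<le> K k * \<bar>t - t0\<bar> ^ (k * (k - 1))" by metis
  have evK: "\<forall>\<^sub>F t in at t0. \<forall>k\<in>{2..d}. norm (Delta k (Q t)) \<le> K k * \<bar>t - t0\<bar> ^ (k * (k - 1))"
    by (intro eventually_ball_finite ballI K) auto
  obtain c where c: "c > 0" "\<And>\<mu> D. D > 0 \<Longrightarrow> \<forall>i\<in>{1..d}. \<forall>j\<in>{1..d}. norm (\<mu> i - \<mu> j) \<le> D \<Longrightarrow>
      \<exists>i\<in>{1..d}. \<exists>j\<in>{1..d}. norm (\<mu> i - \<mu> j) = D \<Longrightarrow>
      \<exists>k\<in>{2..d}. c * D ^ (k * (k - 1)) \<le> norm (Delta_tuple k d \<mu>)"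
    using Delta_tuple_lower_bound[of d] by blast
  \<comment> \<open>The sum dominates every \<open>K k / c\<close>, with absolute values since
    \<open>K k\<close> may be negative. The summand 1 ensures C \<le> C^N, so that the N-th root can
    be taken.\<close>
  define C where "C = 1 + (\<Sum>k\<in>{2..d}. \<bar>K k\<bar>) / c"
  have C1: "C \<ge> 1" using c(1) by (auto simp: C_def intro!: sum_nonneg divide_nonneg_pos)
  have CK: "K k / c \<le> C" if "k \<in> {2..d}" for k
  proof -
    have "K k \<le> (\<Sum>k\<in>{2..d}. \<bar>K k\<bar>)"
      using member_le_sum[OF that, of "\<lambda>k. \<bar>K k\<bar>"] by force
    then have "K k / c \<le> (\<Sum>k\<in>{2..d}. \<bar>K k\<bar>) / c" using c(1) by (intro divide_right_mono) auto
    then show ?thesis by (simp add: C_def)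
  qed
  have "\<forall>\<^sub>F t in at t0. \<forall>x y. poly (Q t) x = 0 \<and> poly (Q t) y = 0 \<longrightarrow> norm (x - y) \<le> C * \<bar>t - t0\<bar>"
    using assms(1) evK
  proof eventually_elim
    case (elim t)
    obtain \<mu> where \<mu>: "root_tuple d \<mu> (Q t)" using monic_deg_imp_root_tuple elim(1) by blast
    show ?case
    proof (intro allI impI)
      fix x y assume "poly (Q t) x = 0 \<and> poly (Q t) y = 0"
      then obtain i0 j0 where ij0: "i0 \<in> {1..d}" "j0 \<in> {1..d}" "x = \<mu> i0" "y = \<mu> j0"
        using root_tuple_poly_eq_0_iff[OF \<mu>] by auto
      define M where "M = (\<lambda>(i, j). norm (\<mu> i - \<mu> j)) ` ({1..d} \<times> {1..d})"
      define D where "D = Max M"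
      have "finite M" by (simp add: M_def)
      have le: "norm (\<mu> i - \<mu> j) \<le> D" if "i \<in> {1..d}" "j \<in> {1..d}" for i j
        unfolding D_def using that \<open>finite M\<close> by (intro Max_ge) (auto simp: M_def)
      have "M \<noteq> {}" using ij0 by (auto simp: M_def)
      then have "D \<in> M" unfolding D_def using \<open>finite M\<close> by (rule Max_in[rotated])
      then have ex: "\<exists>i\<in>{1..d}. \<exists>j\<in>{1..d}. norm (\<mu> i - \<mu> j) = D" by (auto simp: M_def)
      have "D \<le> C * \<bar>t - t0\<bar>"
      proof (cases "D > 0")
        case True
        obtain k where k: "k \<in> {2..d}" "c * D ^ (k * (k - 1)) \<le> norm (Delta_tuple k d \<mu>)"
          using c(2)[OF True _ ex] le by blast
        define N where "N = k * (k - 1)"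
        have N: "N \<ge> 1" using k(1) by (auto simp: N_def Suc_leI)
        have "c * D ^ N \<le> K k * \<bar>t - t0\<bar> ^ N"
          using k elim(2) Delta_eq[OF \<mu>] by (force simp: N_def)
        then have "D ^ N \<le> (K k / c) * \<bar>t - t0\<bar> ^ N"
          using c(1) by (simp add: field_simps)
        also have "\<dots> \<le> C * \<bar>t - t0\<bar> ^ N" using CK[OF k(1)] by (intro mult_right_mono) auto
        also have "\<dots> \<le> C ^ N * \<bar>t - t0\<bar> ^ N"
          using self_le_power[OF C1, of N] N by (intro mult_right_mono) auto
        finally have "D ^ N \<le> (C * \<bar>t - t0\<bar>) ^ N" by (simp add: power_mult_distrib)
        moreover obtain N' where "N = Suc N'" using N by (cases N) auto
        ultimately show ?thesis using C1 power_le_imp_le_base[of D N' "C * \<bar>t - t0\<bar>"] by simp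
      next
        case False
        then show ?thesis using C1 by (meson abs_ge_zero dual_order.trans mult_nonneg_nonneg not_less zero_le_one)
      qed
      then show "norm (x - y) \<le> C * \<bar>t - t0\<bar>" using le[OF ij0(1,2)] ij0(3,4) by simp
    qed
  qed
  then show ?thesis by blast
qed

text \<open>What is used of a splitting later on, in a form valid for \<open>t\<close> near
  \<open>t0\<close>. The last clause, that all roots of \<open>Q i t\<close> approach
  \<open>\<nu> i\<close>, is where the continuity of the coefficients of the factors enters.\<close>

lemma splitting_at_factor_roots:
  assumes "splitting_at n P t0 l Q"
  shows "\<exists>\<nu> m. inj_on \<nu> {1..l} \<and>
    (\<forall>i\<in>{1..l}. 1 \<le> m i \<and> Q i t0 = [:- \<nu> i, 1:] ^ m i) \<and>
    P t0 = (\<Prod>i=1..l. Q i t0) \<and>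
    (\<forall>\<^sub>F t in at t0. P t = (\<Prod>i=1..l. Q i t)) \<and>
    (\<forall>i\<in>{1..l}. \<forall>\<^sub>F t in at t0. monic_deg (m i) (Q i t)) \<and>
    (\<forall>i\<in>{1..l}. \<forall>U. open U \<longrightarrow> \<nu> i \<in> U \<longrightarrow>
        (\<forall>\<^sub>F t in at t0. \<forall>z. poly (Q i t) z = 0 \<longrightarrow> z \<in> U))"
proof -
  obtain \<nu> m e where \<nu>: "inj_on \<nu> {1..l}"
    and Qt0: "\<forall>i\<in>{1..l}. 1 \<le> m i \<and> Q i t0 = [:- \<nu> i, 1:] ^ m i"
    and e: "e > 0" "\<forall>t\<in>ball t0 e. P t = (\<Prod>i=1..l. Q i t)"
    and QC: "\<forall>i\<in>{1..l}. (\<forall>t\<in>ball t0 e. lead_coeff (Q i t) = 1 \<and> degree (Q i t) = m i) \<and>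
        (\<forall>j. Ck_on n (\<lambda>t. coeff (Q i t) j) (ball t0 e))"
    using assms unfolding splitting_at_def by (elim exE conjE) (rule that; assumption)
  have Q: "monic_deg (m i) (Q i t)" if "i \<in> {1..l}" "t \<in> ball t0 e" for i t
    using QC that unfolding monic_deg_def by blast
  have Ck: "Ck_poly_on n (Q i) (ball t0 e)" if "i \<in> {1..l}" for i
    using QC that unfolding Ck_poly_on_def by blast
  have ev: "\<forall>\<^sub>F t in at t0. t \<in> ball t0 e" using e(1) by (intro eventually_at_in_open') auto
  have t0: "t0 \<in> ball t0 e" using e(1) by simp
  have evQ: "\<forall>\<^sub>F t in at t0. monic_deg (m i) (Q i t)" if "i \<in> {1..l}" for i
    using ev by eventually_elim (rule Q[OF that])
  have roots: "\<forall>\<^sub>F t in at t0. \<forall>z. poly (Q i t) z = 0 \<longrightarrow> z \<in> U"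
    if i: "i \<in> {1..l}" and U: "open U" "\<nu> i \<in> U" for i U
    by (rule eventually_all_roots[OF Q[OF i t0] evQ[OF i] Ck_poly_on_imp_tendsto[OF Ck[OF i] open_ball t0] U(1)])
      (use bspec[OF Qt0 i] U(2) in \<open>auto simp: poly_power\<close>)
  have evP: "\<forall>\<^sub>F t in at t0. P t = (\<Prod>i=1..l. Q i t)" using ev by eventually_elim (rule bspec[OF e(2)])
  show ?thesis
    by (intro exI[of _ \<nu>] exI[of _ m] conjI \<nu> Qt0 evP bspec[OF e(2) t0] ballI allI impI evQ roots; assumption)
qed

lemma splitting_imp_contact_at:
  assumes "splitting_at n P t0 l Q"
    and "\<And>i k. i \<in> {1..l} \<Longrightarrow> 2 \<le> k \<Longrightarrow> k \<le> degree (Q i t0) \<Longrightarrow>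
      enat (k * (k - 1)) \<le> mult_at t0 (\<lambda>t. Delta k (Q i t))"
  shows "contact_at P t0"
  unfolding contact_at_def
proof (intro allI impI)
  fix z assume z: "poly (P t0) z = 0"
  obtain \<nu> m where \<nu>: "inj_on \<nu> {1..l}"
    and Qt0: "\<And>i. i \<in> {1..l} \<Longrightarrow> 1 \<le> m i \<and> Q i t0 = [:- \<nu> i, 1:] ^ m i"
    and Pt0: "P t0 = (\<Prod>i=1..l. Q i t0)"
    and evP: "\<forall>\<^sub>F t in at t0. P t = (\<Prod>i=1..l. Q i t)"
    and evQ: "\<And>i. i \<in> {1..l} \<Longrightarrow> \<forall>\<^sub>F t in at t0. monic_deg (m i) (Q i t)"
    and roots: "\<And>i U. i \<in> {1..l} \<Longrightarrow> open U \<Longrightarrow> \<nu> i \<in> U \<Longrightarrow>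
        \<forall>\<^sub>F t in at t0. \<forall>z. poly (Q i t) z = 0 \<longrightarrow> z \<in> U"
    using splitting_at_factor_roots[OF assms(1)] by (elim exE conjE) (rule that; blast)
  obtain i where i: "i \<in> {1..l}" "poly (Q i t0) z = 0"
    using z unfolding Pt0 poly_prod by auto
  then have zi: "z = \<nu> i" using Qt0[OF i(1)] by (simp add: poly_power)
  have "degree (Q i t0) = m i" using Qt0[OF i(1)] by (simp add: degree_linear_power)
  then obtain C where C: "\<forall>\<^sub>F t in at t0. \<forall>x y. poly (Q i t) x = 0 \<and> poly (Q i t) y = 0 \<longrightarrow>
      norm (x - y) \<le> C * \<bar>t - t0\<bar>"
    using Delta_mult_imp_close_roots[OF evQ[OF i(1)]] assms(2)[OF i(1)] by auto
  obtain \<eta> where \<eta>: "\<eta> > 0" "\<forall>y\<in>\<nu> ` {1..l} - {z}. \<eta> < dist z y"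
    using isolating_ball[of "\<nu> ` {1..l}" z] by auto
  have far: "\<nu> j \<in> - cball z \<eta>" if "j \<in> {1..l} - {i}" for j
  proof -
    have "\<nu> j \<noteq> z" using inj_on_eq_iff[OF \<nu>, of j i] that i(1) zi by auto
    then have "\<eta> < dist z (\<nu> j)" using \<eta>(2) that by blast
    then show ?thesis by simp
  qed
  \<comment> \<open>The roots of the other factors stay off a closed ball about \<open>z\<close>, so
    near \<open>z\<close> the roots of \<open>P t\<close> are those of \<open>Q i t\<close>.\<close>
  have "\<forall>\<^sub>F t in at t0. \<forall>j\<in>{1..l} - {i}. \<forall>x. poly (Q j t) x = 0 \<longrightarrow> x \<in> - cball z \<eta>"
    by (intro eventually_ball_finite ballI roots) (use far in auto)
  then have "\<forall>\<^sub>F t in at t0. \<forall>x\<in>ball z \<eta>. \<forall>y\<in>ball z \<eta>. poly (P t) x = 0 \<and> poly (P t) y = 0 \<longrightarrow>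
      norm (x - y) \<le> C * \<bar>t - t0\<bar>"
    using C evP
  proof eventually_elim
    case (elim t)
    have "poly (Q i t) x = 0" if "x \<in> ball z \<eta>" "poly (P t) x = 0" for x
    proof -
      have "(\<Prod>j=1..l. poly (Q j t) x) = 0" using that(2) unfolding elim(3) poly_prod .
      then obtain j where j: "j \<in> {1..l}" "poly (Q j t) x = 0" by auto
      have "j = i"
      proof (rule ccontr)
        assume "j \<noteq> i"
        then have "x \<in> - cball z \<eta>" using elim(1) j by blast
        then show False using that(1) by simp
      qed
      then show ?thesis using j by simp
    qed
    then show ?case using elim(2) by blast
  qed
  then show "\<exists>C U. open U \<and> z \<in> U \<and> (\<forall>\<^sub>F t in at t0. \<forall>x\<in>U. \<forall>y\<in>U.
      poly (P t) x = 0 \<and> poly (P t) y = 0 \<longrightarrow> norm (x - y) \<le> C * \<bar>t - t0\<bar>)"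
    using \<eta>(1) by (intro exI[of _ C] exI[of _ "ball z \<eta>"]) auto
qed

section \<open>Gluing differentiable parameterizations\<close>

text \<open>Differentiability is asked at \<open>t\<close> in the full line rather than within
  \<open>S\<close>. On open sets this is the same, and it makes restriction to subsets
  immediate.\<close>

definition diff_param ::
  "nat \<Rightarrow> (real \<Rightarrow> complex poly) \<Rightarrow> real set \<Rightarrow> (nat \<Rightarrow> real \<Rightarrow> complex) \<Rightarrow> bool" where
  "diff_param d P S \<rho> \<longleftrightarrow> root_parameterization d \<rho> P S \<and> (\<forall>j\<in>{1..d}. \<forall>t\<in>S. \<rho> j differentiable (at t))"

lemma diff_param_root_tuple: "diff_param d P S \<rho> \<Longrightarrow> t \<in> S \<Longrightarrow> root_tuple d (\<lambda>j. \<rho> j t) (P t)"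
  by (simp add: diff_param_def root_parameterization_def)

lemma diff_param_differentiable: "diff_param d P S \<rho> \<Longrightarrow> j \<in> {1..d} \<Longrightarrow> t \<in> S \<Longrightarrow> \<rho> j differentiable (at t)"
  by (simp add: diff_param_def)

lemma diff_param_subset: "diff_param d P S \<rho> \<Longrightarrow> T \<subseteq> S \<Longrightarrow> diff_param d P T \<rho>"
  by (auto simp: diff_param_def root_parameterization_def)

section \<open>Permutations relating two parameterizations\<close>

lemma root_tuple_permute:
  assumes "root_tuple d \<mu> p" "root_tuple d \<mu>' p"
  shows "\<exists>\<pi>. \<pi> permutes {1..d} \<and> (\<forall>j\<in>{1..d}. \<mu> j = \<mu>' (\<pi> j))"
proof -
  have "image_mset \<mu> (mset_set {1..d}) = image_mset \<mu>' (mset_set {1..d})"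
    using root_tuple_proots assms by metis
  from image_mset_eq_implies_permutes[OF _ this] show ?thesis by auto
qed

lemma root_tuple_comp_permutes:
  assumes "root_tuple d \<mu> p" "\<pi> permutes {1..d}"
  shows "root_tuple d (\<lambda>j. \<mu> (\<pi> j)) p"
proof -
  have "(\<Prod>j\<in>{1..d}. [:- \<mu> j, 1:]) = (\<Prod>j\<in>{1..d}. [:- \<mu> (\<pi> j), 1:])"
    using prod.permute[OF assms(2), of "\<lambda>j. [:- \<mu> j, 1:]"] by (simp add: o_def)
  then show ?thesis using assms(1) by (simp only: root_tuple_def)
qed

lemma differentiable_transform_open:
  assumes "f differentiable (at t)" "open S" "t \<in> S" "\<And>s. s \<in> S \<Longrightarrow> f s = g s"
  shows "g differentiable (at t)"
  using assms unfolding differentiable_def by (meson has_derivative_transform_within_open)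

lemma finite_frequently:
  assumes "finite A" "F \<noteq> bot" "\<forall>\<^sub>F x in F. \<exists>a\<in>A. p a x"
  shows "\<exists>a\<in>A. \<exists>\<^sub>F x in F. p a x"
proof (rule ccontr)
  assume "\<not> ?thesis"
  then have "\<forall>\<^sub>F x in F. \<forall>a\<in>A. \<not> p a x"
    using assms(1) by (intro eventually_ball_finite) (auto simp: not_frequently)
  with assms(3) have "\<forall>\<^sub>F x in F. False" by eventually_elim blast
  with assms(2) show False by (simp add: eventually_False)
qed

lemma tendsto_frequently_eq:
  fixes f g :: "'a \<Rightarrow> complex"
  assumes "(f \<longlongrightarrow> a) F" "(g \<longlongrightarrow> b) F" "\<exists>\<^sub>F x in F. f x = g x"
  shows "a = b"
proof (rule ccontr)
  assume "a \<noteq> b"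
  have "((\<lambda>x. f x - g x) \<longlongrightarrow> a - b) F" using assms by (intro tendsto_diff)
  then have "\<forall>\<^sub>F x in F. f x - g x \<noteq> 0" using \<open>a \<noteq> b\<close> by (intro tendsto_imp_eventually_ne) auto
  with assms(3) show False by (auto simp: frequently_def elim: eventually_mono)
qed

text \<open>Along \<open>F\<close>, one of the finitely many permutations relates the two tuples infinitely often.\<close>

lemma root_tuples_frequently_permuted:
  assumes "F \<noteq> bot" "\<forall>\<^sub>F t in F. root_tuple d (\<mu> t) (P t) \<and> root_tuple d (\<mu>' t) (P t)"
  shows "\<exists>\<pi>. \<pi> permutes {1..d} \<and> (\<exists>\<^sub>F t in F. \<forall>j\<in>{1..d}. \<mu> t j = \<mu>' t (\<pi> j))"
proof -
  have "\<forall>\<^sub>F t in F. \<exists>\<pi>\<in>{\<pi>. \<pi> permutes {1..d}}. \<forall>j\<in>{1..d}. \<mu> t j = \<mu>' t (\<pi> j)"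
    using assms(2) by eventually_elim (use root_tuple_permute in blast)
  from finite_frequently[OF finite_permutations assms(1) this] show ?thesis by auto
qed

text \<open>One permutation matches the two tuples at points arbitrarily close to \<open>s\<close>.
  It may fail in between, but along these points values and difference quotients agree, and both
  have limits at \<open>s\<close>.\<close>

lemma diff_params_match:
  assumes "diff_param d P S \<tau>" "diff_param d P T \<sigma>" "open S" "open T" "s \<in> S" "s \<in> T"
  shows "\<exists>\<pi>. \<pi> permutes {1..d} \<and> (\<forall>j\<in>{1..d}. \<tau> j s = \<sigma> (\<pi> j) s \<and>
    vector_derivative (\<tau> j) (at s) = vector_derivative (\<sigma> (\<pi> j)) (at s))"
proof -
  have "\<forall>\<^sub>F t in at s. t \<in> S" "\<forall>\<^sub>F t in at s. t \<in> T"
    using assms(3-6) by (simp_all add: eventually_at_in_open')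
  then have "\<forall>\<^sub>F t in at s. root_tuple d (\<lambda>j. \<tau> j t) (P t) \<and> root_tuple d (\<lambda>j. \<sigma> j t) (P t)"
    by eventually_elim (use assms(1,2) diff_param_root_tuple in blast)
  from root_tuples_frequently_permuted[OF _ this] obtain \<pi> where
    \<pi>: "\<pi> permutes {1..d}" "\<exists>\<^sub>F t in at s. \<forall>j\<in>{1..d}. \<tau> j t = \<sigma> (\<pi> j) t" by auto
  have "\<tau> j s = \<sigma> (\<pi> j) s \<and> vector_derivative (\<tau> j) (at s) = vector_derivative (\<sigma> (\<pi> j)) (at s)"
    if j: "j \<in> {1..d}" for j
  proof -
    have \<pi>j: "\<pi> j \<in> {1..d}" using permutes_in_image[OF \<pi>(1)] j by blast
    have d: "\<tau> j differentiable (at s)" "\<sigma> (\<pi> j) differentiable (at s)"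
      using assms j \<pi>j diff_param_differentiable by blast+
    have fr: "\<exists>\<^sub>F t in at s. \<tau> j t = \<sigma> (\<pi> j) t"
      using \<pi>(2) by (rule frequently_elim1) (use j in blast)
    have v: "\<tau> j s = \<sigma> (\<pi> j) s"
      using differentiable_imp_continuous_within[OF d(1)] differentiable_imp_continuous_within[OF d(2)]
      unfolding continuous_at by (rule tendsto_frequently_eq) (rule fr)
    have "((\<lambda>t. (\<tau> j t - \<tau> j s) / of_real (t - s)) \<longlongrightarrow> vector_derivative (\<tau> j) (at s)) (at s)"
      "((\<lambda>t. (\<sigma> (\<pi> j) t - \<sigma> (\<pi> j) s) / of_real (t - s)) \<longlongrightarrow> vector_derivative (\<sigma> (\<pi> j)) (at s)) (at s)"
      using d by (simp_all only: vector_derivative_works has_vector_derivative_iff_quotient_tendsto)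
    then have "vector_derivative (\<tau> j) (at s) = vector_derivative (\<sigma> (\<pi> j)) (at s)"
      by (rule tendsto_frequently_eq) (use fr v in \<open>auto elim: frequently_elim1\<close>)
    with v show ?thesis by blast
  qed
  with \<pi>(1) show ?thesis by blast
qed

text \<open>The base value is \<open>h s\<close> on both sides, so \<open>f\<close> and
  \<open>g\<close> may take any value at \<open>s\<close> itself. This covers families that
  parameterize the roots only on one side of \<open>s\<close>.\<close>

lemma has_vector_derivative_glue:
  fixes f g h :: "real \<Rightarrow> complex"
  assumes "((\<lambda>t. (f t - h s) / of_real (t - s)) \<longlongrightarrow> l) (at_left s)"
    and "((\<lambda>t. (g t - h s) / of_real (t - s)) \<longlongrightarrow> l) (at_right s)"
    and "\<And>t. t < s \<Longrightarrow> h t = f t" "\<And>t. t > s \<Longrightarrow> h t = g t"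
  shows "(h has_vector_derivative l) (at s)"
  unfolding has_vector_derivative_iff_quotient_tendsto
proof (rule filterlim_split_at)
  have "\<forall>\<^sub>F t in at_left s. (f t - h s) / of_real (t - s) = (h t - h s) / of_real (t - s)"
    using assms(3) by (auto simp: eventually_at_filter)
  with assms(1) show "((\<lambda>t. (h t - h s) / of_real (t - s)) \<longlongrightarrow> l) (at_left s)"
    by (rule Lim_transform_eventually)
  have "\<forall>\<^sub>F t in at_right s. (g t - h s) / of_real (t - s) = (h t - h s) / of_real (t - s)"
    using assms(4) by (auto simp: eventually_at_filter)
  with assms(2) show "((\<lambda>t. (h t - h s) / of_real (t - s)) \<longlongrightarrow> l) (at_right s)"
    by (rule Lim_transform_eventually)
qed

lemma diff_param_glue:
  assumes "diff_param d P S \<tau>" "diff_param d P T \<sigma>" "open S" "open T" "s \<in> S" "s \<in> T"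
  obtains \<pi> where "\<pi> permutes {1..d}" "\<And>j. j \<in> {1..d} \<Longrightarrow> \<tau> j s = \<sigma> (\<pi> j) s"
    "diff_param d P (S \<inter> {..s} \<union> T \<inter> {s..}) (\<lambda>j t. if t \<le> s then \<tau> j t else \<sigma> (\<pi> j) t)"
proof -
  obtain \<pi> where \<pi>: "\<pi> permutes {1..d}" "\<And>j. j \<in> {1..d} \<Longrightarrow> \<tau> j s = \<sigma> (\<pi> j) s"
    "\<And>j. j \<in> {1..d} \<Longrightarrow> vector_derivative (\<tau> j) (at s) = vector_derivative (\<sigma> (\<pi> j)) (at s)"
    using diff_params_match[OF assms] by blast
  let ?\<rho> = "\<lambda>j t. if t \<le> s then \<tau> j t else \<sigma> (\<pi> j) t"
  have "diff_param d P (S \<inter> {..s} \<union> T \<inter> {s..}) ?\<rho>"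
    unfolding diff_param_def root_parameterization_def
  proof (intro conjI ballI)
    fix t assume t: "t \<in> S \<inter> {..s} \<union> T \<inter> {s..}"
    show "root_tuple d (\<lambda>j. ?\<rho> j t) (P t)"
    proof (cases "t \<le> s")
      case True
      then have "t \<in> S" using t assms(5) by (cases "t = s") auto
      then show ?thesis using True diff_param_root_tuple[OF assms(1)] by simp
    next
      case False
      then have "t \<in> T" using t by auto
      then show ?thesis
        using False root_tuple_comp_permutes[OF diff_param_root_tuple[OF assms(2)] \<pi>(1)] by simp
    qed
  next
    fix j t assume j: "j \<in> {1..d}" and t: "t \<in> S \<inter> {..s} \<union> T \<inter> {s..}"
    have \<pi>j: "\<pi> j \<in> {1..d}" using permutes_in_image[OF \<pi>(1)] j by blast
    consider "t < s" | "t = s" | "t > s" by linarith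
    then show "?\<rho> j differentiable (at t)"
    proof cases
      case 1
      then have "\<tau> j differentiable (at t)" using t diff_param_differentiable[OF assms(1) j] by auto
      then show ?thesis by (rule differentiable_transform_open[of _ _ "{..<s}"]) (use 1 in auto)
    next
      case 2
      have d: "\<tau> j differentiable (at s)" "\<sigma> (\<pi> j) differentiable (at s)"
        using assms j \<pi>j diff_param_differentiable by blast+
      have "((\<lambda>t. (\<tau> j t - \<tau> j s) / of_real (t - s)) \<longlongrightarrow> vector_derivative (\<tau> j) (at s)) (at s)"
        "((\<lambda>t. (\<sigma> (\<pi> j) t - \<sigma> (\<pi> j) s) / of_real (t - s)) \<longlongrightarrow> vector_derivative (\<sigma> (\<pi> j)) (at s)) (at s)"
        using d by (simp_all only: vector_derivative_works has_vector_derivative_iff_quotient_tendsto)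
      then have "(?\<rho> j has_vector_derivative vector_derivative (\<tau> j) (at s)) (at s)"
        using \<pi>(2,3)[OF j]
        by (intro has_vector_derivative_glue[of "\<tau> j" _ _ _ "\<sigma> (\<pi> j)"])
          (auto simp: filterlim_at_split)
      then show ?thesis using 2 differentiableI_vector by blast
    next
      case 3
      then have "\<sigma> (\<pi> j) differentiable (at t)" using t diff_param_differentiable[OF assms(2) \<pi>j] by auto
      then show ?thesis by (rule differentiable_transform_open[of _ _ "{s<..}"]) (use 3 in auto)
    qed
  qed
  with \<pi>(1,2) show ?thesis using that by blast
qed

lemma diff_param_comp_permutes:
  assumes "diff_param d P S \<rho>" "\<pi> permutes {1..d}"
  shows "diff_param d P S (\<lambda>j. \<rho> (\<pi> j))"
  unfolding diff_param_def root_parameterization_def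
  using root_tuple_comp_permutes[OF diff_param_root_tuple[OF assms(1)] assms(2)]
    diff_param_differentiable[OF assms(1)] permutes_in_image[OF assms(2)] by simp

lemma diff_param_extend_right:
  assumes "diff_param d P S \<tau>" "diff_param d P T \<sigma>" "open S" "open T" "s \<in> S" "s \<in> T"
  shows "\<exists>\<rho>. diff_param d P (S \<inter> {..s} \<union> T \<inter> {s..}) \<rho> \<and> (\<forall>j\<in>{1..d}. \<forall>t\<le>s. \<rho> j t = \<tau> j t)"
  by (rule diff_param_glue[OF assms])
    (intro exI[of _ "\<lambda>j t. if t \<le> s then \<tau> j t else \<sigma> (_ j) t"] conjI; auto)

text \<open>The glued family carries the labels of \<open>\<tau>\<close>; composing it with the
  inverse permutation restores those of \<open>\<sigma>\<close>.\<close>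

lemma diff_param_extend_left:
  assumes "diff_param d P S \<tau>" "diff_param d P T \<sigma>" "open S" "open T" "s \<in> S" "s \<in> T"
  shows "\<exists>\<rho>. diff_param d P (S \<inter> {..s} \<union> T \<inter> {s..}) \<rho> \<and> (\<forall>j\<in>{1..d}. \<forall>t\<ge>s. \<rho> j t = \<sigma> j t)"
proof -
  obtain \<pi> where \<pi>: "\<pi> permutes {1..d}" "\<And>j. j \<in> {1..d} \<Longrightarrow> \<tau> j s = \<sigma> (\<pi> j) s"
    "diff_param d P (S \<inter> {..s} \<union> T \<inter> {s..}) (\<lambda>j t. if t \<le> s then \<tau> j t else \<sigma> (\<pi> j) t)"
    using diff_param_glue[OF assms] by blast
  let ?i = "inv_into UNIV \<pi>"
  note i = permutes_inv[OF \<pi>(1)]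
  have "diff_param d P (S \<inter> {..s} \<union> T \<inter> {s..}) (\<lambda>j t. if t \<le> s then \<tau> (?i j) t else \<sigma> (\<pi> (?i j)) t)"
    using diff_param_comp_permutes[OF \<pi>(3) i] .
  moreover have "(if t \<le> s then \<tau> (?i j) t else \<sigma> (\<pi> (?i j)) t) = \<sigma> j t" if "j \<in> {1..d}" "t \<ge> s" for j t
  proof -
    have "?i j \<in> {1..d}" using permutes_in_image[OF i] that(1) by blast
    then show ?thesis using \<pi>(2)[of "?i j"] permutes_inverses(1)[OF \<pi>(1)] that(2) by auto
  qed
  ultimately show ?thesis by blast
qed

text \<open>Bisection in place of a finite subcover. The margin \<open>e\<close> beyond both ends
  makes adjacent pieces overlap around their common endpoint, where they are glued.\<close>

lemma diff_param_compact_interval: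
  assumes "a \<le> b" "\<And>x. x \<in> {a..b} \<Longrightarrow> \<exists>e>0. \<exists>\<rho>. diff_param d P (ball x e) \<rho>"
  shows "\<exists>e>0. \<exists>\<rho>. diff_param d P {a - e<..<b + e} \<rho>"
  using assms(1)
proof (induction rule: Bolzano)
  case (trans a b c)
  then obtain e \<tau> e' \<sigma> where e: "e > 0" "diff_param d P {a - e<..<b + e} \<tau>"
    "e' > 0" "diff_param d P {b - e'<..<c + e'} \<sigma>" by blast
  obtain \<rho> where "diff_param d P ({a - e<..<b + e} \<inter> {..b} \<union> {b - e'<..<c + e'} \<inter> {b..}) \<rho>"
    using diff_param_extend_right[OF e(2,4), of b] e(1,3) trans by auto
  moreover have "{a - min e e'<..<c + min e e'} \<subseteq> {a - e<..<b + e} \<inter> {..b} \<union> {b - e'<..<c + e'} \<inter> {b..}"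
    using e(1,3) by auto
  ultimately show ?case using diff_param_subset e(1,3) by (metis min_less_iff_conj)
next
  case (local x)
  then have "x \<in> {a..b}" by simp
  from assms(2)[OF this] obtain e \<rho> where e: "e > 0" "diff_param d P (ball x e) \<rho>" by blast
  show ?case
  proof (rule exI[of _ "e / 2"], intro conjI allI impI)
    fix u v assume "u \<le> x \<and> x \<le> v \<and> v - u < e / 2"
    \<comment> \<open>An interval around \<open>x\<close> of length below \<open>e / 2\<close>,
      widened by \<open>e / 2\<close> on either side, still lies within distance \<open>e\<close> of
      \<open>x\<close>.\<close>
    then have "{u - e / 2<..<v + e / 2} \<subseteq> ball x e" by (auto simp: dist_real_def)
    then show "\<exists>e>0. \<exists>\<rho>. diff_param d P {u - e<..<v + e} \<rho>"
      using diff_param_subset[OF e(2)] e(1) half_gt_zero by blast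
  qed (use e(1) in simp)
qed

section \<open>From local parameterizations to open intervals and open sets\<close>

lemma open_interval_exhaustion:
  fixes S :: "real set"
  assumes "open S" "is_interval S" "S \<noteq> {}"
  obtains \<alpha> \<beta> :: "nat \<Rightarrow> real" where "\<And>k. \<alpha> k \<le> \<beta> k" "\<And>k. {\<alpha> k..\<beta> k} \<subseteq> S"
    "\<And>k. \<alpha> (Suc k) \<le> \<alpha> k" "\<And>k. \<beta> k \<le> \<beta> (Suc k)" "\<And>t. t \<in> S \<Longrightarrow> \<exists>k. \<alpha> k < t \<and> t < \<beta> k"
proof -
  obtain C :: "nat \<Rightarrow> real set" where C: "\<And>k. compact (C k)" "\<And>k. C k \<subseteq> S"
    "\<And>k. C k \<subseteq> interior (C (Suc k))" "\<Union> (range C) = S"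
    using open_Union_compact_subsets[OF assms(1)] by metis
  obtain p where p: "p \<in> S" using assms(3) by blast
  \<comment> \<open>A fixed point in every stage keeps infima and suprema meaningful when early
    stages of \<open>C\<close> are empty.\<close>
  define K where "K k = insert p (C k)" for k
  have K: "compact (K k)" "K k \<noteq> {}" "K k \<subseteq> S" for k using C(1,2) p by (auto simp: K_def)
  have mono: "K k \<subseteq> K (Suc k)" for k using C(3)[of k] interior_subset[of "C (Suc k)"] by (auto simp: K_def)
  have bd: "bdd_below (K k)" "bdd_above (K k)" for k
    using compact_imp_bounded[OF K(1)[of k]]
    by (rule bounded_imp_bdd_below, rule bounded_imp_bdd_above)
  have mem: "Inf (K k) \<in> K k" "Sup (K k) \<in> K k" for k
    using closed_contains_Inf[OF K(2) bd(1)] closed_contains_Sup[OF K(2) bd(2)] K(1) compact_imp_closed by blast+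
  show ?thesis
  proof (rule that[of "\<lambda>k. Inf (K k)" "\<lambda>k. Sup (K k)"])
    fix k
    show "Inf (K k) \<le> Sup (K k)" using K(2) bd by (intro cInf_le_cSup)
    show "{Inf (K k)..Sup (K k)} \<subseteq> S"
      using mem[of k] K(3)[of k] assms(2) unfolding is_interval_1 by (meson atLeastAtMost_iff subsetD subsetI)
    show "Inf (K (Suc k)) \<le> Inf (K k)" using mono K(2) bd by (intro cInf_superset_mono)
    show "Sup (K k) \<le> Sup (K (Suc k))" using mono K(2) bd by (intro cSup_subset_mono)
  next
    fix t assume "t \<in> S"
    then obtain e where e: "e > 0" "ball t e \<subseteq> S" using assms(1) open_contains_ball by blast
    have "t - e / 2 \<in> S" "t + e / 2 \<in> S" using e by (auto simp: dist_real_def intro!: subsetD[OF e(2)])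
    then obtain k1 k2 where "t - e / 2 \<in> C k1" "t + e / 2 \<in> C k2" using C(4) by blast
    moreover have "K k \<subseteq> K m" if "k \<le> m" for k m using mono that by (rule lift_Suc_mono_le)
    ultimately have "t - e / 2 \<in> K (max k1 k2)" "t + e / 2 \<in> K (max k1 k2)"
      unfolding K_def by (meson insertI2 max.cobounded1 max.cobounded2 subsetD)+
    then have "Inf (K (max k1 k2)) \<le> t - e / 2" "t + e / 2 \<le> Sup (K (max k1 k2))"
      using bd by (auto intro: cInf_lower cSup_upper)
    then show "\<exists>k. Inf (K k) < t \<and> t < Sup (K k)" using e(1) by (intro exI[of _ "max k1 k2"]) auto
  qed
qed

text \<open>Parameterizations on two intervals agree only up to a permutation, so passing to the
  union of an exhaustion requires each extension to leave the earlier values unchanged. Dependent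
  choice builds such a sequence, extending to the right and then to the left in each step.\<close>

lemma diff_param_interval:
  assumes "open S" "is_interval S" "\<And>x. x \<in> S \<Longrightarrow> \<exists>e>0. \<exists>\<rho>. diff_param d P (ball x e) \<rho>"
  shows "\<exists>\<rho>. diff_param d P S \<rho>"
proof (cases "S = {}")
  case True
  then show ?thesis by (auto simp: diff_param_def root_parameterization_def)
next
  case False
  obtain \<alpha> \<beta> where \<alpha>\<beta>: "\<And>k. \<alpha> k \<le> \<beta> k" "\<And>k. {\<alpha> k..\<beta> k} \<subseteq> S" "\<And>k. \<alpha> (Suc k) \<le> \<alpha> k"
      "\<And>k. \<beta> k \<le> \<beta> (Suc k)" "\<And>t. t \<in> S \<Longrightarrow> \<exists>k. \<alpha> k < t \<and> t < \<beta> k"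
    using open_interval_exhaustion[OF assms(1,2) False] by blast
  have loc: "\<exists>e>0. \<exists>\<rho>. diff_param d P {\<alpha> k - e<..<\<beta> k + e} \<rho>" for k
    using \<alpha>\<beta>(2)[of k] assms(3) by (intro diff_param_compact_interval[OF \<alpha>\<beta>(1)]) blast
  define good where "good k \<rho> \<longleftrightarrow> (\<exists>e>0. diff_param d P {\<alpha> k - e<..<\<beta> k + e} \<rho>)" for k \<rho>
  define agree where "agree k \<rho> \<rho>' \<longleftrightarrow> (\<forall>j\<in>{1..d}. \<forall>t\<in>{\<alpha> k..\<beta> k}. \<rho>' j t = \<rho> j t)"
    for k and \<rho> \<rho>' :: "nat \<Rightarrow> real \<Rightarrow> complex"
  have "\<exists>f. \<forall>k. good k (f k) \<and> agree k (f k) (f (Suc k))"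
  proof (rule dependent_nat_choice)
    show "\<exists>\<rho>. good 0 \<rho>" using loc[of 0] by (auto simp: good_def)
  next
    fix \<tau> k assume "good k \<tau>"
    then obtain e where e: "e > 0" "diff_param d P {\<alpha> k - e<..<\<beta> k + e} \<tau>" by (auto simp: good_def)
    obtain e' \<sigma> where e': "e' > 0" "diff_param d P {\<alpha> (Suc k) - e'<..<\<beta> (Suc k) + e'} \<sigma>"
      using loc by blast
    note le = \<alpha>\<beta>(1)[of k] \<alpha>\<beta>(3,4)[of k]
    obtain \<rho>1 where \<rho>1: "diff_param d P ({\<alpha> k - e<..<\<beta> k + e} \<inter> {..\<beta> k} \<union>
        {\<alpha> (Suc k) - e'<..<\<beta> (Suc k) + e'} \<inter> {\<beta> k..}) \<rho>1" "\<And>j t. j \<in> {1..d} \<Longrightarrow> t \<le> \<beta> k \<Longrightarrow> \<rho>1 j t = \<tau> j t"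
      using diff_param_extend_right[OF e(2) e'(2), of "\<beta> k"] le e(1) e'(1) by auto
    have \<rho>1': "diff_param d P {\<alpha> k - e<..<\<beta> (Suc k) + e'} \<rho>1"
      by (rule diff_param_subset[OF \<rho>1(1)]) (use le e(1) e'(1) in auto)
    obtain \<rho>2 where \<rho>2: "diff_param d P ({\<alpha> (Suc k) - e'<..<\<beta> (Suc k) + e'} \<inter> {..\<alpha> k} \<union>
        {\<alpha> k - e<..<\<beta> (Suc k) + e'} \<inter> {\<alpha> k..}) \<rho>2" "\<And>j t. j \<in> {1..d} \<Longrightarrow> t \<ge> \<alpha> k \<Longrightarrow> \<rho>2 j t = \<rho>1 j t"
      using diff_param_extend_left[OF e'(2) \<rho>1', of "\<alpha> k"] le e(1) e'(1) by auto
    have "diff_param d P {\<alpha> (Suc k) - e'<..<\<beta> (Suc k) + e'} \<rho>2"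
      by (rule diff_param_subset[OF \<rho>2(1)]) (use le e(1) e'(1) in auto)
    then have "good (Suc k) \<rho>2" using e'(1) by (auto simp: good_def)
    moreover have "agree k \<tau> \<rho>2" using \<rho>1(2) \<rho>2(2) by (auto simp: agree_def)
    ultimately show "\<exists>\<rho>. good (Suc k) \<rho> \<and> agree k \<tau> \<rho>" by blast
  qed
  then obtain f where f: "\<And>k. good k (f k)" "\<And>k. agree k (f k) (f (Suc k))" by blast
  have nest: "\<alpha> m \<le> \<alpha> k \<and> \<beta> k \<le> \<beta> m" if "k \<le> m" for k m
    using that by (induction m rule: dec_induct) (use \<alpha>\<beta>(3,4) order_trans in blast)+
  have stable: "f m j t = f k j t" if "k \<le> m" "j \<in> {1..d}" "t \<in> {\<alpha> k..\<beta> k}" for k m j t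
    using that(1)
  proof (induction m rule: dec_induct)
    case (step m)
    have "t \<in> {\<alpha> m..\<beta> m}" using nest[OF step(1)] that(3) by auto
    then show ?case using f(2)[of m] that(2) step by (auto simp: agree_def)
  qed simp
  \<comment> \<open>The strict inequalities put \<open>t\<close> in the interior of the interval. By
    \<open>stable\<close> the value does not depend on which such interval is chosen, so near
    \<open>t\<close> a single \<open>f k\<close> describes \<rho>.\<close>
  define \<kappa> where "\<kappa> t = (SOME k. \<alpha> k < t \<and> t < \<beta> k)" for t
  have \<kappa>: "\<alpha> (\<kappa> t) < t \<and> t < \<beta> (\<kappa> t)" if "t \<in> S" for t
    unfolding \<kappa>_def using \<alpha>\<beta>(5)[OF that] by (rule someI_ex)
  define \<rho> where "\<rho> j t = f (\<kappa> t) j t" for j t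
  have eq: "\<rho> j t = f k j t" if "j \<in> {1..d}" "t \<in> {\<alpha> k<..<\<beta> k}" for j t k
  proof -
    have "t \<in> S" using that(2) \<alpha>\<beta>(2)[of k] by auto
    from \<kappa>[OF this] show ?thesis
      unfolding \<rho>_def using stable[of k "\<kappa> t" j t] stable[of "\<kappa> t" k j t] that
      by (cases "k \<le> \<kappa> t") auto
  qed
  have "diff_param d P S \<rho>"
    unfolding diff_param_def root_parameterization_def
  proof (intro conjI ballI)
    fix t assume t: "t \<in> S"
    then obtain k where k: "t \<in> {\<alpha> k<..<\<beta> k}" using \<alpha>\<beta>(5) by auto
    obtain e where e: "e > 0" "diff_param d P {\<alpha> k - e<..<\<beta> k + e} (f k)" using f(1) by (auto simp: good_def)
    have tk: "t \<in> {\<alpha> k - e<..<\<beta> k + e}" using k e(1) by auto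
    have "(\<Prod>j=1..d. [:- \<rho> j t, 1:]) = (\<Prod>j=1..d. [:- f k j t, 1:])"
      by (rule prod.cong) (use eq[OF _ k] in auto)
    then show "root_tuple d (\<lambda>j. \<rho> j t) (P t)"
      using diff_param_root_tuple[OF e(2) tk] by (simp add: root_tuple_def)
    fix j assume j: "j \<in> {1..d}"
    show "\<rho> j differentiable (at t)"
      by (rule differentiable_transform_open[OF diff_param_differentiable[OF e(2) j tk] _ k])
        (use eq[OF j] in auto)
  qed
  then show ?thesis by blast
qed

lemma diff_param_open:
  assumes "open S" "\<And>x. x \<in> S \<Longrightarrow> \<exists>e>0. \<exists>\<rho>. diff_param d P (ball x e) \<rho>"
  shows "\<exists>\<rho>. diff_param d P S \<rho>"
proof -
  let ?C = "connected_component_set S"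
  have "\<exists>\<rho>. diff_param d P (?C t) \<rho>" for t
    using assms connected_component_subset[of S t]
    by (intro diff_param_interval) (auto simp: is_interval_connected_1 intro: open_connected_component)
  \<comment> \<open>The choice depends on the component as a set, so all points of a component share
    one parameterization.\<close>
  moreover define r where "r C = (SOME \<rho>. diff_param d P C \<rho>)" for C
  ultimately have r: "diff_param d P (?C t) (r (?C t))" for t by (metis someI_ex)
  define \<rho> where "\<rho> j t = r (?C t) j t" for j t
  have eq: "\<rho> j s = r (?C t) j s" if "s \<in> ?C t" for j s t
    using connected_component_eq[OF that] by (simp add: \<rho>_def)
  have "diff_param d P S \<rho>"
    unfolding diff_param_def root_parameterization_def
  proof (intro conjI ballI)
    fix t assume "t \<in> S"
    then have t: "t \<in> ?C t" by simp
    show "root_tuple d (\<lambda>j. \<rho> j t) (P t)"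
      using diff_param_root_tuple[OF r t] by (simp add: \<rho>_def)
    fix j assume j: "j \<in> {1..d}"
    show "\<rho> j differentiable (at t)"
      by (rule differentiable_transform_open[OF diff_param_differentiable[OF r j t] open_connected_component[OF assms(1)] t])
        (simp add: eq)
  qed
  then show ?thesis by blast
qed

section \<open>Slopes of the roots at a point where all roots coincide\<close>

text \<open>The coefficient of z^i is homogeneous of degree \<open>card A - i\<close> in the roots;
  the factor \<open>s ^ i\<close> on the left avoids a truncated subtraction.\<close>

lemma coeff_prod_linear_scale:
  fixes y :: "'b \<Rightarrow> complex"
  shows "coeff (\<Prod>j\<in>A. [:- (s * y j), 1:]) i * s ^ i = s ^ card A * coeff (\<Prod>j\<in>A. [:- y j, 1:]) i"
proof (cases "finite A")
  case True
  then show ?thesis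
  proof (induction A arbitrary: i)
    case empty
    then show ?case by (cases i) auto
  next
    case (insert a A)
    show ?case
    proof (cases i)
      case 0
      then show ?thesis using insert.IH[of 0] insert.hyps by (simp add: algebra_simps)
    next
      case (Suc k)
      then show ?thesis using insert.IH[of k] insert.IH[of "Suc k"] insert.hyps
        by (simp add: algebra_simps)
    qed
  qed
qed (cases i; simp)

lemma norm_coeff_prod_linear_le:
  fixes y :: "'b \<Rightarrow> complex"
  assumes "finite A" "\<And>j. j \<in> A \<Longrightarrow> norm (y j) \<le> M" "M \<ge> 0"
  shows "norm (coeff (\<Prod>j\<in>A. [:- y j, 1:]) i) \<le> (1 + M) ^ card A"
  using assms(1,2)
proof (induction A arbitrary: i)
  case empty
  then show ?case by (cases i) auto
next
  case (insert a A)
  let ?p = "\<Prod>j\<in>A. [:- y j, 1:]"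
  have ya: "norm (y a) \<le> M" using insert.prems by simp
  have IH: "norm (coeff ?p k) \<le> (1 + M) ^ card A" for k using insert by simp
  have "norm (y a * coeff ?p i) \<le> M * (1 + M) ^ card A"
    unfolding norm_mult using ya IH assms(3) by (intro mult_mono) auto
  moreover have "coeff (\<Prod>j\<in>insert a A. [:- y j, 1:]) i =
      (case i of 0 \<Rightarrow> 0 | Suc k \<Rightarrow> coeff ?p k) - y a * coeff ?p i"
    using insert.hyps by (cases i) auto
  moreover have "norm (case i of 0 \<Rightarrow> 0 | Suc k \<Rightarrow> coeff ?p k) \<le> (1 + M) ^ card A"
    using IH assms(3) by (cases i) auto
  ultimately have "norm (coeff (\<Prod>j\<in>insert a A. [:- y j, 1:]) i) \<le> (1 + M) ^ card A + M * (1 + M) ^ card A"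
    by (simp only:) (rule order_trans[OF norm_triangle_ineq4 add_mono])
  then show ?case using insert.hyps by (simp add: algebra_simps)
qed

lemma coeff_prod_linear_sum:
  fixes \<mu> :: "'b \<Rightarrow> complex"
  assumes "finite A" "card A = Suc d"
  shows "coeff (\<Prod>j\<in>A. [:- \<mu> j, 1:]) d = - (\<Sum>j\<in>A. \<mu> j)"
  using assms
proof (induction A arbitrary: d)
  case (insert a A)
  let ?p = "\<Prod>j\<in>A. [:- \<mu> j, 1:]"
  have "degree ?p = card A" by (simp add: degree_prod_eq_sum_degree)
  moreover have "lead_coeff ?p = 1" by (simp add: lead_coeff_prod)
  ultimately have c: "coeff ?p (card A) = 1" by simp
  have d: "card A = d" using insert by simp
  show ?case
  proof (cases d)
    case 0
    then show ?thesis using d insert by simp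
  next
    case (Suc d')
    then show ?thesis using insert.IH[of d'] insert.hyps c d by (simp add: algebra_simps)
  qed
qed simp

lemma coeff_root_tuple_sum:
  assumes "root_tuple (Suc d) \<mu> p"
  shows "coeff p d = - (\<Sum>j=1..Suc d. \<mu> j)"
  using coeff_prod_linear_sum[of "{1..Suc d}" d \<mu>] assms by (simp only: root_tuple_def) simp

text \<open>The substitution z |-> c + z for polynomials of degree at most \<open>d\<close>, written
  as a fixed finite sum so that its coefficients are visibly linear combinations, with constant
  weights, of those of \<open>p\<close>.\<close>

definition shift_poly :: "nat \<Rightarrow> complex \<Rightarrow> complex poly \<Rightarrow> complex poly" where
  "shift_poly d c p = (\<Sum>j\<le>d. Polynomial.smult (coeff p j) ([:c, 1:] ^ j))"

lemma shift_poly_root_tuple: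
  assumes "root_tuple d \<mu> p"
  shows "shift_poly d c p = (\<Prod>j=1..d. [:- (\<mu> j - c), 1:])"
proof -
  have "degree p \<le> d" using root_tuple_degree[OF assms] by simp
  then have "poly (shift_poly d c p) z = poly p (c + z)" for z
    unfolding shift_poly_def poly_eq_sum_upto[OF \<open>degree p \<le> d\<close>] by (simp add: poly_sum poly_power)
  also have "poly p (c + z) = poly (\<Prod>j=1..d. [:- (\<mu> j - c), 1:]) z" for z
    using assms by (simp add: root_tuple_def poly_prod algebra_simps)
  finally have "poly (shift_poly d c p) = poly (\<Prod>j=1..d. [:- (\<mu> j - c), 1:])" by (intro ext)
  then show ?thesis by (simp only: poly_eq_poly_eq_iff)
qed

lemma Ck_shift_poly: "Ck_poly_on n P S \<Longrightarrow> Ck_poly_on n (\<lambda>t. shift_poly d c (P t)) S"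
  unfolding shift_poly_def Ck_poly_on_def coeff_sum coeff_smult
  by (intro allI Ck_on_sum Ck_on_mult) auto

text \<open>Contact bounds the mutual distances of the roots, not their distances from \<nu>. The
  centroid closes this gap: it is a multiple of the coefficient of z^(d-1), hence differentiable at
  \<open>t0\<close>, and its value there is \<nu>.\<close>

lemma contact_imp_slopes_bounded:
  assumes "open S" "t0 \<in> S" "\<And>t. t \<in> S \<Longrightarrow> monic_deg d (P t)" "Ck_poly_on n P S" "1 \<le> d" "d \<le> n"
    and "\<And>z. poly (P t0) z = 0 \<Longrightarrow> z = \<nu>" "contact_at P t0"
  shows "\<exists>M\<ge>0. \<forall>\<^sub>F t in at t0. \<forall>x. poly (P t) x = 0 \<longrightarrow> norm (x - \<nu>) \<le> M * \<bar>t - t0\<bar>"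
proof -
  have inS: "\<forall>\<^sub>F t in at t0. t \<in> S" using assms(1,2) by (simp add: eventually_at_in_open')
  then have ev: "\<forall>\<^sub>F t in at t0. monic_deg d (P t)" by eventually_elim (rule assms(3))
  obtain w0 where w0: "root_tuple d w0 (P t0)" using monic_deg_imp_root_tuple assms by blast
  have w0\<nu>: "w0 j = \<nu>" if "j \<in> {1..d}" for j
    using root_tuple_poly_eq_0_iff[OF w0] assms(7) that by blast
  then have "poly (P t0) \<nu> = 0" using root_tuple_poly_eq_0_iff[OF w0] assms(5) by force
  then obtain C U where CU: "open U" "\<nu> \<in> U" "\<forall>\<^sub>F t in at t0. \<forall>x\<in>U. \<forall>y\<in>U.
      poly (P t) x = 0 \<and> poly (P t) y = 0 \<longrightarrow> norm (x - y) \<le> C * \<bar>t - t0\<bar>"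
    using assms(8) unfolding contact_at_def by blast
  have evU: "\<forall>\<^sub>F t in at t0. \<forall>z. poly (P t) z = 0 \<longrightarrow> z \<in> U"
    using assms(7) CU(2)
    by (intro eventually_all_roots[OF assms(3)[OF assms(2)] ev Ck_poly_on_imp_tendsto[OF assms(4,1,2)] CU(1)]) auto
  obtain d' where d': "d = Suc d'" using assms(5) by (cases d) auto
  define a where "a t = - coeff (P t) d' / of_nat d" for t
  obtain l where "((\<lambda>t. coeff (P t) d') has_vector_derivative l) (at t0)"
    using Ck_poly_on_differentiable[OF assms(4) _ assms(1,2)] assms(5,6) by auto
  then have "(a has_vector_derivative (- l / of_nat d)) (at t0)"
    unfolding a_def by (intro has_vector_derivative_divide has_vector_derivative_minus)
  then have "((\<lambda>t. norm ((a t - a t0) / of_real (t - t0))) \<longlongrightarrow> norm (- l / of_nat d)) (at t0)"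
    unfolding has_vector_derivative_iff_quotient_tendsto by (rule tendsto_norm)
  moreover define K where "K = norm (- l / of_nat d) + 1"
  ultimately have evK: "\<forall>\<^sub>F t in at t0. norm ((a t - a t0) / of_real (t - t0)) < K"
    by (intro order_tendstoD) auto
  have mean: "a t = (\<Sum>j=1..d. \<mu> j) / of_nat d" if "root_tuple d \<mu> (P t)" for \<mu> t
    using coeff_root_tuple_sum[of d' \<mu> "P t"] that by (simp add: a_def d')
  have a0: "a t0 = \<nu>" using mean[OF w0] w0\<nu> assms(5) by simp
  have K0: "K \<ge> 0" by (simp add: K_def)
  have neq: "\<forall>\<^sub>F t in at t0. t \<noteq> t0" by (simp add: eventually_at_filter)
  have "\<forall>\<^sub>F t in at t0. \<forall>x. poly (P t) x = 0 \<longrightarrow> norm (x - \<nu>) \<le> (\<bar>C\<bar> + K) * \<bar>t - t0\<bar>"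
    using ev CU(3) evU evK neq
  proof eventually_elim
    case (elim t)
    obtain \<mu> where \<mu>: "root_tuple d \<mu> (P t)" using monic_deg_imp_root_tuple elim(1) by blast
    show ?case
    proof (intro allI impI)
      fix x assume x: "poly (P t) x = 0"
      have cl: "norm (x - \<mu> j) \<le> \<bar>C\<bar> * \<bar>t - t0\<bar>" if "j \<in> {1..d}" for j
      proof -
        have "poly (P t) (\<mu> j) = 0" using root_tuple_poly_eq_0_iff[OF \<mu>] that by blast
        then have "norm (x - \<mu> j) \<le> C * \<bar>t - t0\<bar>" using elim(2,3) x by blast
        also have "\<dots> \<le> \<bar>C\<bar> * \<bar>t - t0\<bar>" by (intro mult_right_mono) auto
        finally show ?thesis .
      qed
      have "x - a t = (\<Sum>j=1..d. x - \<mu> j) / of_nat d"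
        using mean[OF \<mu>] assms(5) by (simp add: sum_subtractf field_simps)
      then have "norm (x - a t) = norm (\<Sum>j=1..d. x - \<mu> j) / real d" by (simp add: norm_divide)
      also have "\<dots> \<le> (\<Sum>j=1..d. \<bar>C\<bar> * \<bar>t - t0\<bar>) / real d"
        by (intro divide_right_mono sum_norm_le cl) auto
      also have "\<dots> = \<bar>C\<bar> * \<bar>t - t0\<bar>" using assms(5) by simp
      finally have 1: "norm (x - a t) \<le> \<bar>C\<bar> * \<bar>t - t0\<bar>" .
      have "norm (a t - \<nu>) \<le> K * \<bar>t - t0\<bar>"
        using elim(4,5) by (simp add: a0 norm_divide field_simps flip: of_real_diff)
      with 1 norm_triangle_ineq[of "x - a t" "a t - \<nu>"] show "norm (x - \<nu>) \<le> (\<bar>C\<bar> + K) * \<bar>t - t0\<bar>"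
        by (simp add: algebra_simps)
    qed
  qed
  then show ?thesis using K0 by (intro exI[of _ "\<bar>C\<bar> + K"]) auto
qed

text \<open>The coefficient of \<open>z\<^sup>i\<close> of \<open>P t\<close>, recentred at \<open>\<nu>\<close>, is of class \<open>C\<^sup>n\<close> and of order
  \<open>(t - t0)\<^bsup>d-i\<^esup>\<close>, so the polynomial of the slopes converges.\<close>

lemma contact_imp_slopes_tendsto:
  assumes "open S" "t0 \<in> S" "\<And>t. t \<in> S \<Longrightarrow> monic_deg d (P t)" "Ck_poly_on n P S" "1 \<le> d" "d \<le> n"
    and "\<And>z. poly (P t0) z = 0 \<Longrightarrow> z = \<nu>" "contact_at P t0"
  shows "\<exists>\<mu> w. (\<forall>\<^sub>F t in at t0. root_tuple d (\<lambda>j. \<nu> + of_real (t - t0) * \<mu> t j) (P t)) \<and>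
    (\<forall>j\<in>{1..d}. ((\<lambda>t. \<mu> t j) \<longlongrightarrow> w j) (at t0))"
proof -
  obtain M where M: "M \<ge> 0" "\<forall>\<^sub>F t in at t0. \<forall>x. poly (P t) x = 0 \<longrightarrow> norm (x - \<nu>) \<le> M * \<bar>t - t0\<bar>"
    using contact_imp_slopes_bounded[OF assms] by blast
  have inS: "\<forall>\<^sub>F t in at t0. t \<in> S" using assms(1,2) by (simp add: eventually_at_in_open')
  have neq: "\<forall>\<^sub>F t in at t0. t \<noteq> t0" by (simp add: eventually_at_filter)
  define x where "x t = (SOME \<mu>. root_tuple d \<mu> (P t))" for t
  have x: "root_tuple d (x t) (P t)" if "t \<in> S" for t
    unfolding x_def using monic_deg_imp_root_tuple[OF assms(3)[OF that]] by (rule someI_ex)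
  define y where "y t j = (x t j - \<nu>) / of_real (t - t0)" for t j
  define q where "q t = (\<Prod>j=1..d. [:- y t j, 1:])" for t
  define B where "B t = shift_poly d \<nu> (P t)" for t
  have xy: "x t j - \<nu> = of_real (t - t0) * y t j" if "t \<noteq> t0" for t j
    using that by (simp add: y_def flip: of_real_diff)
  have BC: "coeff (B t) i * of_real (t - t0) ^ i = of_real (t - t0) ^ d * coeff (q t) i"
    if "t \<in> S" "t \<noteq> t0" for t i
    using coeff_prod_linear_scale[of "of_real (t - t0)" "y t" "{1..d}" i]
    unfolding B_def shift_poly_root_tuple[OF x[OF that(1)]] q_def xy[OF that(2)] by simp
  have Bq: "coeff (B t) i = of_real (t - t0) ^ (d - i) * coeff (q t) i" if "t \<in> S" "t \<noteq> t0" "i \<le> d" for t i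
  proof -
    have "(of_real (t - t0) :: complex) \<noteq> 0" using that(2) by (simp flip: of_real_diff)
    moreover have "(of_real (t - t0) :: complex) ^ d = of_real (t - t0) ^ (d - i) * of_real (t - t0) ^ i"
      using that(3) by (simp flip: power_add)
    ultimately show ?thesis using BC[OF that(1,2), of i] by (simp del: of_real_diff)
  qed
  obtain e where e: "e > 0" "ball t0 e \<subseteq> S" using assms(1,2) open_contains_ball by blast
  have lim: "\<exists>L. ((\<lambda>t. coeff (q t) i) \<longlongrightarrow> L) (at t0)" if i: "i \<le> d" for i
  proof -
    \<comment> \<open>The order \<open>d - i\<close> never exceeds \<open>n\<close> because
      \<open>d \<le> n\<close>; this is where the class C^n is used up.\<close>
    have "Ck_on (d - i) (\<lambda>t. coeff (B t) i) (ball t0 e)"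
      using Ck_shift_poly[OF assms(4), of d \<nu>] assms(6) e(2)
      unfolding Ck_poly_on_def B_def by (meson Ck_on_mono Ck_on_subset diff_le_self order_trans)
    moreover have "\<forall>\<^sub>F t in at t0. norm (coeff (B t) i) \<le> (1 + M) ^ d * \<bar>t - t0\<bar> ^ (d - i)"
      using inS neq M(2)
    proof eventually_elim
      case (elim t)
      have "norm (y t j) \<le> M" if "j \<in> {1..d}" for j
      proof -
        have "poly (P t) (x t j) = 0" using root_tuple_poly_eq_0_iff[OF x[OF elim(1)]] that by blast
        then have "norm (x t j - \<nu>) \<le> M * \<bar>t - t0\<bar>" using elim(3) by blast
        then show ?thesis using elim(2) by (simp add: y_def norm_divide field_simps flip: of_real_diff)
      qed
      then have "norm (coeff (q t) i) \<le> (1 + M) ^ d"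
        unfolding q_def using norm_coeff_prod_linear_le[of "{1..d}" "y t" M i] M(1) by simp
      then have "\<bar>t - t0\<bar> ^ (d - i) * norm (coeff (q t) i) \<le> \<bar>t - t0\<bar> ^ (d - i) * (1 + M) ^ d"
        by (intro mult_left_mono) auto
      then show ?case
        by (simp add: Bq[OF elim(1,2) i] norm_mult norm_power mult.commute flip: of_real_diff)
    qed
    ultimately obtain L where L: "((\<lambda>t. coeff (B t) i / of_real (t - t0) ^ (d - i)) \<longlongrightarrow> L) (at t0)"
      using Ck_on_bound_imp_quotient_tendsto[OF _ e(1)] by blast
    have "\<forall>\<^sub>F t in at t0. coeff (B t) i / of_real (t - t0) ^ (d - i) = coeff (q t) i"
      using inS neq by eventually_elim (simp add: Bq[OF _ _ i] flip: of_real_diff)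
    with L show ?thesis by (blast intro: Lim_transform_eventually)
  qed
  then obtain L where L: "\<And>i. i \<le> d \<Longrightarrow> ((\<lambda>t. coeff (q t) i) \<longlongrightarrow> L i) (at t0)" by metis
  have qt: "root_tuple d (y t) (q t)" for t by (simp add: root_tuple_def q_def)
  note qm = root_tuple_imp_monic_deg[OF qt]
  define q0 where "q0 = (\<Sum>i\<le>d. monom (L i) i)"
  have cq0: "coeff q0 i = (if i \<le> d then L i else 0)" for i by (auto simp: q0_def coeff_sum)
  have ql: "poly_tendsto q q0 (at t0)"
    unfolding poly_tendsto_def
  proof
    fix i
    show "((\<lambda>t. coeff (q t) i) \<longlongrightarrow> coeff q0 i) (at t0)"
    proof (cases "i \<le> d")
      case False
      then have "coeff (q t) i = 0" for t using qm[of t] by (auto simp: monic_deg_def intro: coeff_eq_0)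
      then show ?thesis using False by (simp add: cq0)
    qed (use L cq0 in auto)
  qed
  \<comment> \<open>The leading coefficients are constantly 1, so no root is lost in the limit and
    \<open>q0\<close> has degree \<open>d\<close>.\<close>
  have "coeff (q t) d = 1" for t using qm[of t] by (auto simp: monic_deg_def)
  then have "L d = 1" using L[of d] by (simp add: tendsto_const_iff)
  then have "coeff q0 d = 1" by (simp add: cq0)
  moreover have "degree q0 \<le> d" by (rule degree_le) (simp add: cq0)
  ultimately have "monic_deg d q0"
    unfolding monic_deg_def by (metis le_degree nle_le one_neq_zero)
  then obtain w where "root_tuple d w q0" using monic_deg_imp_root_tuple by blast
  from roots_tendsto[OF this _ ql] qm obtain \<mu> where
    \<mu>: "\<And>t. root_tuple d (\<mu> t) (q t)" "\<And>j. j \<in> {1..d} \<Longrightarrow> ((\<lambda>t. \<mu> t j) \<longlongrightarrow> w j) (at t0)"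
    by auto
  \<comment> \<open>The convergent enumeration \<open>\<mu> t\<close> of the slopes is a permutation
    of \<open>y t\<close>, which was chosen for each \<open>t\<close> separately.\<close>
  have "\<forall>\<^sub>F t in at t0. root_tuple d (\<lambda>j. \<nu> + of_real (t - t0) * \<mu> t j) (P t)"
    using inS neq
  proof eventually_elim
    case (elim t)
    obtain \<pi> where \<pi>: "\<pi> permutes {1..d}" "\<forall>j\<in>{1..d}. \<mu> t j = y t (\<pi> j)"
      using root_tuple_permute[OF \<mu>(1) qt] by blast
    have "root_tuple d (\<lambda>j. x t (\<pi> j)) (P t)"
      using root_tuple_comp_permutes[OF x[OF elim(1)] \<pi>(1)] .
    moreover have "\<nu> + of_real (t - t0) * \<mu> t j = x t (\<pi> j)" if "j \<in> {1..d}" for j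
      using \<pi>(2) that xy[OF elim(2), of "\<pi> j"] by (simp add: algebra_simps)
    then have "(\<Prod>j=1..d. [:- (\<nu> + of_real (t - t0) * \<mu> t j), 1:]) = (\<Prod>j=1..d. [:- x t (\<pi> j), 1:])"
      by (intro prod.cong refl) (simp only:)
    ultimately show ?case by (simp only: root_tuple_def)
  qed
  with \<mu>(2) show ?thesis by blast
qed

text \<open>A continuous selection from finitely many convergent families converges, because near the
  limit it cannot leave the small ball around one of the limits.\<close>

lemma continuous_selection_tendsto:
  fixes f :: "real \<Rightarrow> complex" and \<mu> :: "real \<Rightarrow> nat \<Rightarrow> complex"
  assumes conn: "\<And>p. \<forall>\<^sub>F t in F. p t \<Longrightarrow> \<exists>A. connected A \<and> A \<noteq> {} \<and> (\<forall>t\<in>A. p t) \<and> (\<forall>\<^sub>F t in F. t \<in> A)"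
    and "F \<noteq> bot" "continuous_on D f" "\<forall>\<^sub>F t in F. t \<in> D"
    and sel: "\<forall>\<^sub>F t in F. \<exists>i\<in>{1..d}. f t = \<mu> t i"
    and lim: "\<And>i. i \<in> {1..d} \<Longrightarrow> ((\<lambda>t. \<mu> t i) \<longlongrightarrow> w i) F"
  shows "\<exists>L. (f \<longlongrightarrow> L) F"
proof -
  define W where "W = w ` {1..d}"
  have fW: "finite W" by (simp add: W_def)
  obtain \<eta> where \<eta>: "\<eta> > 0" "\<And>u v. u \<in> W \<Longrightarrow> v \<in> W \<Longrightarrow> u \<noteq> v \<Longrightarrow> 2 * \<eta> \<le> dist u v"
    using finite_separated[OF fW] by blast
  \<comment> \<open>For each radius the connected image lies in one of the disjoint balls. The
    centre could still depend on \<open>\<delta>\<close>; comparison with the fixed radius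
    \<open>\<eta>\<close> excludes this afterwards.\<close>
  have step: "\<exists>v\<in>W. \<forall>\<^sub>F t in F. f t \<in> ball v \<delta>" if \<delta>: "0 < \<delta>" "\<delta> \<le> \<eta>" for \<delta>
  proof -
    have "\<forall>\<^sub>F t in F. \<forall>i\<in>{1..d}. dist (\<mu> t i) (w i) < \<delta>"
      using lim \<delta>(1) by (intro eventually_ball_finite ballI tendstoD) auto
    with sel have "\<forall>\<^sub>F t in F. t \<in> D \<and> f t \<in> (\<Union>v\<in>W. ball v \<delta>)"
      using assms(4)
    proof eventually_elim
      case (elim t)
      then obtain i where i: "i \<in> {1..d}" "f t = \<mu> t i" by blast
      then have "f t \<in> ball (w i) \<delta>" using elim(2) by (simp add: dist_commute)
      moreover have "w i \<in> W" using i(1) by (simp add: W_def)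
      ultimately show ?case using elim(3) by blast
    qed
    from conn[OF this] obtain A where A: "connected A" "A \<noteq> {}"
      "\<forall>t\<in>A. t \<in> D \<and> f t \<in> (\<Union>v\<in>W. ball v \<delta>)" "\<forall>\<^sub>F t in F. t \<in> A" by blast
    have "continuous_on A f" using assms(3) A(3) continuous_on_subset by blast
    then have cA: "connected (f ` A)" using A(1) by (rule connected_continuous_image)
    obtain t where t: "t \<in> A" using A(2) by blast
    then obtain v where v: "v \<in> W" "f t \<in> ball v \<delta>" using A(3) by blast
    have "ball v \<delta> \<inter> f ` A = {} \<or> (\<Union>u\<in>W - {v}. ball u \<delta>) \<inter> f ` A = {}"
    proof (rule connectedD[OF cA])
      show "f ` A \<subseteq> ball v \<delta> \<union> (\<Union>u\<in>W - {v}. ball u \<delta>)" using A(3) by blast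
      have "ball v \<delta> \<inter> ball u \<delta> = {}" if "u \<in> W - {v}" for u
      proof (rule ccontr)
        assume "ball v \<delta> \<inter> ball u \<delta> \<noteq> {}"
        then obtain z where "dist v z < \<delta>" "dist u z < \<delta>" by auto
        then have "dist v u < 2 * \<eta>" using dist_triangle2[of v u z] \<delta>(2) by linarith
        then show False using \<eta>(2)[OF v(1), of u] that by auto
      qed
      then show "ball v \<delta> \<inter> (\<Union>u\<in>W - {v}. ball u \<delta>) \<inter> f ` A = {}" by blast
    qed auto
    then have "f ` A \<subseteq> ball v \<delta>" using v t A(3) by blast
    then have "\<forall>\<^sub>F t in F. f t \<in> ball v \<delta>" by (intro eventually_mono[OF A(4)]) blast
    then show ?thesis using v(1) by blast
  qed
  obtain v where v: "v \<in> W" "\<forall>\<^sub>F t in F. f t \<in> ball v \<eta>" using step[of \<eta>] \<eta>(1) by blast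
  have "(f \<longlongrightarrow> v) F"
    unfolding tendsto_iff
  proof (intro allI impI)
    fix r :: real assume "r > 0"
    then obtain u where u: "u \<in> W" "\<forall>\<^sub>F t in F. f t \<in> ball u (min r \<eta>)"
      using step[of "min r \<eta>"] \<eta>(1) by auto
    have "\<forall>\<^sub>F t in F. u = v"
      using v(2) u(2)
    proof eventually_elim
      case (elim t)
      then have "dist u v < 2 * \<eta>" using dist_triangle2[of u v "f t"] by simp
      then show ?case using \<eta>(2)[OF u(1) v(1)] by force
    qed
    then have "u = v" using assms(2) by (simp add: eventually_const)
    then show "\<forall>\<^sub>F t in F. dist (f t) v < r"
      using u(2) by (auto simp: dist_commute elim: eventually_mono)
  qed
  then show ?thesis by blast
qed

text \<open>Punctured two-sided neighbourhoods are disconnected, so the filter \<open>at t0\<close>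
  has no such basis. Slopes are therefore treated on each side separately and matched later.\<close>

lemma one_sided_connected_basis:
  fixes t0 :: real
  shows "\<forall>\<^sub>F t in at_right t0. p t \<Longrightarrow> \<exists>A. connected A \<and> A \<noteq> {} \<and> (\<forall>t\<in>A. p t) \<and> (\<forall>\<^sub>F t in at_right t0. t \<in> A)"
    and "\<forall>\<^sub>F t in at_left t0. p t \<Longrightarrow> \<exists>A. connected A \<and> A \<noteq> {} \<and> (\<forall>t\<in>A. p t) \<and> (\<forall>\<^sub>F t in at_left t0. t \<in> A)"
proof -
  assume "\<forall>\<^sub>F t in at_right t0. p t"
  then obtain b where "b > t0" "\<forall>t>t0. t < b \<longrightarrow> p t"
    using eventually_at_right[of t0 "t0 + 1"] by auto
  then show "\<exists>A. connected A \<and> A \<noteq> {} \<and> (\<forall>t\<in>A. p t) \<and> (\<forall>\<^sub>F t in at_right t0. t \<in> A)"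
    by (intro exI[of _ "{t0<..<b}"]) (auto simp: eventually_at_right[of t0 b] dest: dense)
next
  assume "\<forall>\<^sub>F t in at_left t0. p t"
  then obtain b where "b < t0" "\<forall>t>b. t < t0 \<longrightarrow> p t"
    using eventually_at_left[of "t0 - 1" t0] by auto
  then show "\<exists>A. connected A \<and> A \<noteq> {} \<and> (\<forall>t\<in>A. p t) \<and> (\<forall>\<^sub>F t in at_left t0. t \<in> A)"
    by (intro exI[of _ "{b<..<t0}"]) (auto simp: eventually_at_left[of b t0] dest: dense)
qed

text \<open>Continuity gives each slope a limit, but not that the limits together exhaust the
  \<open>w j\<close> with multiplicities. A permutation that is valid frequently along
  \<open>F\<close> identifies all of them at once.\<close>

lemma one_sided_slopes:
  assumes conn: "\<And>p. \<forall>\<^sub>F t in F. p t \<Longrightarrow> \<exists>A. connected A \<and> A \<noteq> {} \<and> (\<forall>t\<in>A. p t) \<and> (\<forall>\<^sub>F t in F. t \<in> A)"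
    and F: "F \<noteq> bot" "F \<le> at t0" and \<rho>: "diff_param d P D \<rho>" "\<forall>\<^sub>F t in F. t \<in> D"
    and \<mu>: "\<forall>\<^sub>F t in at t0. root_tuple d (\<lambda>j. \<nu> + of_real (t - t0) * \<mu> t j) (P t)"
    and w: "\<And>j. j \<in> {1..d} \<Longrightarrow> ((\<lambda>t. \<mu> t j) \<longlongrightarrow> w j) (at t0)"
  shows "\<exists>\<pi>. \<pi> permutes {1..d} \<and>
    (\<forall>j\<in>{1..d}. ((\<lambda>t. (\<rho> j t - \<nu>) / of_real (t - t0)) \<longlongrightarrow> w (\<pi> j)) F)"
proof -
  have \<mu>F: "\<forall>\<^sub>F t in F. root_tuple d (\<lambda>j. \<nu> + of_real (t - t0) * \<mu> t j) (P t)"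
    using filter_leD[OF F(2) \<mu>] .
  have neq: "\<forall>\<^sub>F t in F. t \<noteq> t0" by (rule filter_leD[OF F(2)]) (simp add: eventually_at_filter)
  have wF: "((\<lambda>t. \<mu> t j) \<longlongrightarrow> w j) F" if "j \<in> {1..d}" for j
    using tendsto_mono[OF F(2) w[OF that]] .
  have "\<forall>\<^sub>F t in F. root_tuple d (\<lambda>j. \<rho> j t) (P t) \<and> root_tuple d (\<lambda>j. \<nu> + of_real (t - t0) * \<mu> t j) (P t)"
    using \<mu>F \<rho>(2) by eventually_elim (use diff_param_root_tuple[OF \<rho>(1)] in blast)
  from root_tuples_frequently_permuted[OF F(1) this] obtain \<pi> where
    \<pi>: "\<pi> permutes {1..d}" "\<exists>\<^sub>F t in F. \<forall>j\<in>{1..d}. \<rho> j t = \<nu> + of_real (t - t0) * \<mu> t (\<pi> j)" by blast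
  have "((\<lambda>t. (\<rho> j t - \<nu>) / of_real (t - t0)) \<longlongrightarrow> w (\<pi> j)) F" if j: "j \<in> {1..d}" for j
  proof -
    let ?f = "\<lambda>t. (\<rho> j t - \<nu>) / of_real (t - t0)"
    have "continuous_on (D - {t0}) (\<rho> j)"
      using diff_param_differentiable[OF \<rho>(1) j]
      by (intro continuous_at_imp_continuous_on) (auto intro: differentiable_imp_continuous_within)
    then have cont: "continuous_on (D - {t0}) ?f" by (intro continuous_intros) auto
    have DF: "\<forall>\<^sub>F t in F. t \<in> D - {t0}" using \<rho>(2) neq by eventually_elim auto
    have sel: "\<forall>\<^sub>F t in F. \<exists>i\<in>{1..d}. ?f t = \<mu> t i"
      using \<rho>(2) neq \<mu>F
    proof eventually_elim
      case (elim t)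
      have "poly (P t) (\<rho> j t) = 0"
        using root_tuple_poly_eq_0_iff[OF diff_param_root_tuple[OF \<rho>(1) elim(1)]] j by blast
      then obtain i where "i \<in> {1..d}" "\<rho> j t = \<nu> + of_real (t - t0) * \<mu> t i"
        using root_tuple_poly_eq_0_iff[OF elim(3)] by blast
      then show ?case using elim(2) by (auto intro!: bexI[of _ i] simp flip: of_real_diff)
    qed
    obtain L where L: "(?f \<longlongrightarrow> L) F"
      using continuous_selection_tendsto[OF conn F(1) cont DF sel wF] by blast
    have "\<exists>\<^sub>F t in F. t \<noteq> t0 \<and> (\<forall>j\<in>{1..d}. \<rho> j t = \<nu> + of_real (t - t0) * \<mu> t (\<pi> j))"
      using \<pi>(2) neq by (rule frequently_eventually_frequently[THEN frequently_elim1]) auto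
    then have "\<exists>\<^sub>F t in F. ?f t = \<mu> t (\<pi> j)"
      by (rule frequently_elim1) (use j in \<open>auto simp flip: of_real_diff\<close>)
    moreover have "\<pi> j \<in> {1..d}" using permutes_in_image[OF \<pi>(1)] j by blast
    ultimately have "L = w (\<pi> j)" using L wF by (intro tendsto_frequently_eq)
    then show ?thesis using L by simp
  qed
  then show ?thesis using \<pi>(1) by blast
qed

section \<open>Existence of a differentiable parameterization\<close>

lemma contact_at_divisor:
  assumes "contact_at P t0" "\<forall>\<^sub>F t in at t0. \<forall>z. poly (Q t) z = 0 \<longrightarrow> poly (P t) z = 0"
    and "\<And>z. poly (Q t0) z = 0 \<Longrightarrow> poly (P t0) z = 0"
  shows "contact_at Q t0"
  unfolding contact_at_def
proof (intro allI impI)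
  fix \<nu> assume "poly (Q t0) \<nu> = 0"
  then obtain C U where U: "open U" "\<nu> \<in> U" "\<forall>\<^sub>F t in at t0. \<forall>x\<in>U. \<forall>y\<in>U.
      poly (P t) x = 0 \<and> poly (P t) y = 0 \<longrightarrow> norm (x - y) \<le> C * \<bar>t - t0\<bar>"
    using assms(1,3) unfolding contact_at_def by blast
  from assms(2) U(3) have "\<forall>\<^sub>F t in at t0. \<forall>x\<in>U. \<forall>y\<in>U.
      poly (Q t) x = 0 \<and> poly (Q t) y = 0 \<longrightarrow> norm (x - y) \<le> C * \<bar>t - t0\<bar>"
    by eventually_elim blast
  with U(1,2) show "\<exists>C U. open U \<and> \<nu> \<in> U \<and> (\<forall>\<^sub>F t in at t0. \<forall>x\<in>U. \<forall>y\<in>U.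
      poly (Q t) x = 0 \<and> poly (Q t) y = 0 \<longrightarrow> norm (x - y) \<le> C * \<bar>t - t0\<bar>)" by blast
qed

lemma root_tuple_append:
  assumes "root_tuple p \<mu> f" "root_tuple q \<mu>' g"
  shows "root_tuple (p + q) (\<lambda>j. if j \<le> p then \<mu> j else \<mu>' (j - p)) (f * g)"
proof -
  let ?h = "\<lambda>j. [:- (if j \<le> p then \<mu> j else \<mu>' (j - p)), 1:]"
  have "{1..p + q} = {1..p} \<union> {p + 1..p + q}" by auto
  then have "(\<Prod>j=1..p + q. ?h j) = (\<Prod>j=1..p. ?h j) * (\<Prod>j=p + 1..p + q. ?h j)"
    by (simp only:) (rule prod.union_disjoint, auto)
  also have "(\<Prod>j=1..p. ?h j) = f"
    using assms(1) unfolding root_tuple_def by (auto intro: prod.cong)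
  also have "(\<Prod>j=p + 1..p + q. ?h j) = (\<Prod>j=1..q. [:- \<mu>' j, 1:])"
    by (rule prod.reindex_bij_witness[of _ "\<lambda>j. j + p" "\<lambda>j. j - p"]) auto
  also have "\<dots> = g" using assms(2) by (simp only: root_tuple_def)
  finally show ?thesis by (simp only: root_tuple_def)
qed

lemma diff_param_append:
  assumes "diff_param p F S \<tau>" "diff_param q G S \<sigma>" "\<And>t. t \<in> S \<Longrightarrow> P t = F t * G t"
  shows "\<exists>\<rho>. diff_param (p + q) P S \<rho>"
proof -
  let ?\<rho> = "\<lambda>j t. if j \<le> p then \<tau> j t else \<sigma> (j - p) t"
  have "diff_param (p + q) P S ?\<rho>"
    unfolding diff_param_def root_parameterization_def
  proof (intro conjI ballI)
    fix t assume t: "t \<in> S"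
    show "root_tuple (p + q) (\<lambda>j. ?\<rho> j t) (P t)"
      using root_tuple_append[OF diff_param_root_tuple[OF assms(1) t] diff_param_root_tuple[OF assms(2) t]]
        assms(3)[OF t] by simp
    fix j assume "j \<in> {1..p + q}"
    then show "?\<rho> j differentiable (at t)"
      using diff_param_differentiable[OF assms(1) _ t, of j] diff_param_differentiable[OF assms(2) _ t, of "j - p"]
      by (cases "j \<le> p") (auto simp: Suc_le_eq)
  qed
  then show ?thesis by blast
qed

lemma monic_deg_root_part:
  assumes "monic_deg d p"
  shows "degree (root_part B p) + degree (root_part (- B) p) = d"
proof -
  have "root_part B p \<noteq> 0" for B using lead_coeff_root_part[of B p] by auto
  then have "degree (root_part B p * root_part (- B) p) = degree (root_part B p) + degree (root_part (- B) p)"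
    by (intro degree_mult_eq)
  then show ?thesis using assms root_part_mult[OF assms] by (simp add: monic_deg_def)
qed

lemma degree_pos_if_root:
  fixes p :: "complex poly"
  assumes "poly p z = 0" "lead_coeff p = 1"
  shows "degree p > 0"
proof (rule ccontr)
  assume "\<not> ?thesis"
  then obtain c where "p = [:c:]" by (auto elim: degree_eq_zeroE)
  with assms show False by simp
qed

text \<open>The slopes from the left and from the right are rearrangements of the same two-sided
  limits \<open>w j\<close>. Relabelling each side by its inverse permutation gives the function
  with index \<open>j\<close> the slope \<open>w j\<close> from both sides.\<close>

lemma diff_param_at_cluster:
  assumes d: "1 \<le> d" and e: "e > 0"
    and L: "diff_param d P {t0 - e<..<t0} \<rho>L" and R: "diff_param d P {t0<..<t0 + e} \<rho>R"
    and P0: "root_tuple d (\<lambda>j. \<nu>) (P t0)"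
    and \<mu>: "\<forall>\<^sub>F t in at t0. root_tuple d (\<lambda>j. \<nu> + of_real (t - t0) * \<mu> t j) (P t)"
    and w: "\<And>j. j \<in> {1..d} \<Longrightarrow> ((\<lambda>t. \<mu> t j) \<longlongrightarrow> w j) (at t0)"
  shows "\<exists>\<rho>. diff_param d P (ball t0 e) \<rho>"
proof -
  have evL: "\<forall>\<^sub>F t in at_left t0. t \<in> {t0 - e<..<t0}" and evR: "\<forall>\<^sub>F t in at_right t0. t \<in> {t0<..<t0 + e}"
    using e by (auto intro!: eventually_at_left_real eventually_at_right_real simp del: greaterThanLessThan_iff)
  obtain \<pi>L where \<pi>L: "\<pi>L permutes {1..d}"
    "\<forall>j\<in>{1..d}. ((\<lambda>t. (\<rho>L j t - \<nu>) / of_real (t - t0)) \<longlongrightarrow> w (\<pi>L j)) (at_left t0)"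
    using one_sided_slopes[OF one_sided_connected_basis(2)[of _ t0] _ _ L evL \<mu> w] by (auto simp: at_le)
  obtain \<pi>R where \<pi>R: "\<pi>R permutes {1..d}"
    "\<forall>j\<in>{1..d}. ((\<lambda>t. (\<rho>R j t - \<nu>) / of_real (t - t0)) \<longlongrightarrow> w (\<pi>R j)) (at_right t0)"
    using one_sided_slopes[OF one_sided_connected_basis(1)[of _ t0] _ _ R evR \<mu> w] by (auto simp: at_le)
  let ?l = "inv_into UNIV \<pi>L" and ?r = "inv_into UNIV \<pi>R"
  note l = permutes_inv[OF \<pi>L(1)] and r = permutes_inv[OF \<pi>R(1)]
  note L' = diff_param_comp_permutes[OF L l] and R' = diff_param_comp_permutes[OF R r]
  define \<rho> where "\<rho> j t = (if t < t0 then \<rho>L (?l j) t else if t = t0 then \<nu> else \<rho>R (?r j) t)" for j t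
  have "diff_param d P (ball t0 e) \<rho>"
    unfolding diff_param_def root_parameterization_def
  proof (intro conjI ballI)
    fix t assume t: "t \<in> ball t0 e"
    consider "t < t0" | "t = t0" | "t > t0" by linarith
    note t_cases = this
    show "root_tuple d (\<lambda>j. \<rho> j t) (P t)"
      using t_cases
    proof cases
      case 1
      then have "t \<in> {t0 - e<..<t0}" using t by (auto simp: dist_real_def)
      from diff_param_root_tuple[OF L' this] 1 show ?thesis by (simp add: \<rho>_def)
    next
      case 2
      then show ?thesis using P0 by (simp add: \<rho>_def)
    next
      case 3
      then have "t \<in> {t0<..<t0 + e}" using t by (auto simp: dist_real_def)
      from diff_param_root_tuple[OF R' this] 3 show ?thesis by (simp add: \<rho>_def)
    qed
    fix j assume j: "j \<in> {1..d}"
    show "\<rho> j differentiable (at t)"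
      using t_cases
    proof cases
      case 1
      then have tL: "t \<in> {t0 - e<..<t0}" using t by (auto simp: dist_real_def)
      show ?thesis
        by (rule differentiable_transform_open[OF diff_param_differentiable[OF L' j tL] _ tL]) (auto simp: \<rho>_def)
    next
      case 2
      have lj: "?l j \<in> {1..d}" and rj: "?r j \<in> {1..d}"
        using permutes_in_image[OF l] permutes_in_image[OF r] j by blast+
      have "((\<lambda>t. (\<rho>L (?l j) t - \<nu>) / of_real (t - t0)) \<longlongrightarrow> w j) (at_left t0)"
        using bspec[OF \<pi>L(2) lj] permutes_inverses(1)[OF \<pi>L(1)] by simp
      moreover have "((\<lambda>t. (\<rho>R (?r j) t - \<nu>) / of_real (t - t0)) \<longlongrightarrow> w j) (at_right t0)"
        using bspec[OF \<pi>R(2) rj] permutes_inverses(1)[OF \<pi>R(1)] by simp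
      moreover have "\<rho> j t0 = \<nu>" by (simp add: \<rho>_def)
      ultimately have "(\<rho> j has_vector_derivative w j) (at t0)"
        by (intro has_vector_derivative_glue[of "\<rho>L (?l j)" _ _ _ "\<rho>R (?r j)"]) (auto simp: \<rho>_def)
      then show ?thesis using 2 differentiableI_vector by blast
    next
      case 3
      then have tR: "t \<in> {t0<..<t0 + e}" using t by (auto simp: dist_real_def)
      show ?thesis
        by (rule differentiable_transform_open[OF diff_param_differentiable[OF R' j tR] _ tR]) (auto simp: \<rho>_def)
    qed
  qed
  then show ?thesis by blast
qed

text \<open>Whenever all roots of \<open>P t\<close> coincide, so do all \<open>\<mu> t j\<close>.
  As this happens arbitrarily close to \<open>t0\<close>, the limits \<open>w j\<close> are equal,
  and every selection of a root has this common slope, whatever its labels.\<close>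

lemma cluster_accumulation_differentiable:
  assumes d: "j \<in> {1..d}"
    and \<mu>: "\<forall>\<^sub>F t in at t0. root_tuple d (\<lambda>j. \<nu> + of_real (t - t0) * \<mu> t j) (P t)"
    and w: "\<And>j. j \<in> {1..d} \<Longrightarrow> ((\<lambda>t. \<mu> t j) \<longlongrightarrow> w j) (at t0)"
    and acc: "\<exists>\<^sub>F t in at t0. \<exists>c. \<forall>z. poly (P t) z = 0 \<longrightarrow> z = c"
    and \<rho>: "\<forall>\<^sub>F t in at t0. root_tuple d (\<lambda>j. \<rho> j t) (P t)" "\<rho> j t0 = \<nu>"
  shows "\<rho> j differentiable (at t0)"
proof -
  have neq: "\<forall>\<^sub>F t in at t0. t \<noteq> t0" by (simp add: eventually_at_filter)
  have weq: "w i = w j" if i: "i \<in> {1..d}" for i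
  proof (rule tendsto_frequently_eq[OF w[OF i] w[OF d]])
    have "\<exists>\<^sub>F t in at t0. (\<exists>c. \<forall>z. poly (P t) z = 0 \<longrightarrow> z = c) \<and>
        root_tuple d (\<lambda>j. \<nu> + of_real (t - t0) * \<mu> t j) (P t) \<and> t \<noteq> t0"
      by (rule frequently_eventually_frequently[OF acc eventually_conj[OF \<mu> neq]])
    then show "\<exists>\<^sub>F t in at t0. \<mu> t i = \<mu> t j"
    proof (rule frequently_elim1)
      fix t
      assume t: "(\<exists>c. \<forall>z. poly (P t) z = 0 \<longrightarrow> z = c) \<and>
        root_tuple d (\<lambda>j. \<nu> + of_real (t - t0) * \<mu> t j) (P t) \<and> t \<noteq> t0"
      then have "poly (P t) (\<nu> + of_real (t - t0) * \<mu> t k) = 0" if "k \<in> {1..d}" for k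
        using root_tuple_poly_eq_0_iff that by blast
      from this[OF i] this[OF d] t have "\<nu> + of_real (t - t0) * \<mu> t i = \<nu> + of_real (t - t0) * \<mu> t j" by metis
      then show "\<mu> t i = \<mu> t j" using t by (simp flip: of_real_diff)
    qed
  qed
  have "((\<lambda>t. (\<rho> j t - \<rho> j t0) / of_real (t - t0)) \<longlongrightarrow> w j) (at t0)"
    unfolding tendsto_iff
  proof (intro allI impI)
    fix r :: real assume "r > 0"
    then have "\<forall>\<^sub>F t in at t0. \<forall>i\<in>{1..d}. dist (\<mu> t i) (w i) < r"
      using w by (intro eventually_ball_finite ballI tendstoD) auto
    then show "\<forall>\<^sub>F t in at t0. dist ((\<rho> j t - \<rho> j t0) / of_real (t - t0)) (w j) < r"
      using \<mu> \<rho>(1) neq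
    proof eventually_elim
      case (elim t)
      have "poly (P t) (\<rho> j t) = 0" using root_tuple_poly_eq_0_iff[OF elim(3)] d by blast
      then obtain i where i: "i \<in> {1..d}" "\<rho> j t = \<nu> + of_real (t - t0) * \<mu> t i"
        using root_tuple_poly_eq_0_iff[OF elim(2)] by blast
      then have "(\<rho> j t - \<rho> j t0) / of_real (t - t0) = \<mu> t i"
        using elim(4) \<rho>(2) by (simp flip: of_real_diff)
      then show ?case using bspec[OF elim(1) i(1)] weq[OF i(1)] by (simp only:)
    qed
  qed
  then have "(\<rho> j has_vector_derivative w j) (at t0)"
    by (simp only: has_vector_derivative_iff_quotient_tendsto)
  then show ?thesis by (rule differentiableI_vector)
qed

text \<open>Induction on the degree. Away from the closed set \<open>E\<close> where all roots coincide the curve splits.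
  At an isolated point of \<open>E\<close> the two sides are matched by their slopes, and at an accumulation
  point of \<open>E\<close> all slopes are equal, so that no matching is needed.\<close>

lemma contact_imp_diff_param:
  assumes "open S" "\<And>t. t \<in> S \<Longrightarrow> monic_deg d (P t)" "Ck_poly_on n P S" "d \<le> n"
    and "\<And>t. t \<in> S \<Longrightarrow> contact_at P t"
  shows "\<exists>\<rho>. diff_param d P S \<rho>"
  using assms
proof (induction d arbitrary: S P rule: less_induct)
  case (less d)
  note S = less.prems(1) and m = less.prems(2) and Ck = less.prems(3) and dn = less.prems(4)
    and ct = less.prems(5)
  show ?case
  proof (cases "d = 0")
    case True
    then have "root_tuple d (\<lambda>j. 0) (P t)" if "t \<in> S" for t
      using monic_deg_imp_root_tuple[OF m[OF that]] by (auto simp: root_tuple_def)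
    then have "diff_param d P S (\<lambda>j t. 0)" by (simp add: diff_param_def root_parameterization_def)
    then show ?thesis by blast
  next
    case False
    then have d1: "1 \<le> d" by simp
    define E where "E = {t\<in>S. \<exists>\<nu>. \<forall>z. poly (P t) z = 0 \<longrightarrow> z = \<nu>}"
    have one_root: "\<exists>\<nu>. poly (P t) \<nu> = 0" if "t \<in> S" for t
      using monic_deg_root_near[OF m[OF that]] d1 by auto
    \<comment> \<open>A ball about one root of \<open>P t0\<close> and its complement both contain
      roots, so both factors have degree below \<open>d\<close>. They inherit contact and the class
      C^n, with the same \<open>n\<close>, and the induction hypothesis applies to each.\<close>
    have off: "\<exists>e>0. ball t0 e \<subseteq> S - E \<and> (\<exists>\<rho>. diff_param d P (ball t0 e) \<rho>)" if t0: "t0 \<in> S - E" for t0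
    proof -
      have t0S: "t0 \<in> S" using t0 by blast
      obtain \<nu> where \<nu>: "poly (P t0) \<nu> = 0" using one_root[OF t0S] by blast
      obtain \<nu>' where \<nu>': "poly (P t0) \<nu>' = 0" "\<nu>' \<noteq> \<nu>" using t0 unfolding E_def by blast
      have "finite {z. poly (P t0) z = 0}"
        using m[OF t0S] by (intro poly_roots_finite) (auto simp: monic_deg_def)
      from isolating_ball[OF this, of \<nu>] obtain \<eta> where
        \<eta>: "\<eta> > 0" "\<And>z. poly (P t0) z = 0 \<Longrightarrow> z \<noteq> \<nu> \<Longrightarrow> \<eta> < dist \<nu> z" by auto
      define B where "B = ball \<nu> \<eta>"
      have int: "z \<in> interior B \<union> interior (- B)" if "poly (P t0) z = 0" for z
        unfolding B_def using \<eta> that by (intro interior_ball_Un) auto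
      then have int': "z \<in> interior (- B) \<union> interior (- (- B))" if "poly (P t0) z = 0" for z
        using that by auto
      obtain e1 where e1: "e1 > 0" "ball t0 e1 \<subseteq> S"
        "\<And>t. t \<in> ball t0 e1 \<Longrightarrow> degree (root_part B (P t)) = degree (root_part B (P t0))"
        "Ck_poly_on n (\<lambda>t. root_part B (P t)) (ball t0 e1)"
        using root_part_Ck[OF S t0S m Ck int] by blast
      obtain e2 where e2: "e2 > 0" "ball t0 e2 \<subseteq> S"
        "\<And>t. t \<in> ball t0 e2 \<Longrightarrow> degree (root_part (- B) (P t)) = degree (root_part (- B) (P t0))"
        "Ck_poly_on n (\<lambda>t. root_part (- B) (P t)) (ball t0 e2)"
        using root_part_Ck[OF S t0S m Ck int'] by blast
      define e where "e = min e1 e2"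
      define p where "p = degree (root_part B (P t0))"
      define q where "q = degree (root_part (- B) (P t0))"
      have e: "e > 0" "ball t0 e \<subseteq> ball t0 e1" "ball t0 e \<subseteq> ball t0 e2" using e1(1) e2(1) by (auto simp: e_def)
      have pq: "p + q = d" using monic_deg_root_part[OF m[OF t0S]] by (simp add: p_def q_def)
      have "poly (root_part B (P t0)) \<nu> = 0" using root_part_root[OF m[OF t0S]] \<nu> \<eta>(1) by (simp add: B_def)
      then have "p > 0" unfolding p_def by (rule degree_pos_if_root) (rule lead_coeff_root_part)
      have "poly (root_part (- B) (P t0)) \<nu>' = 0"
        using root_part_root[OF m[OF t0S]] \<nu>' \<eta>(2)[OF \<nu>'] by (simp add: B_def)
      then have "q > 0" unfolding q_def by (rule degree_pos_if_root) (rule lead_coeff_root_part)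
      have mB: "monic_deg p (root_part B (P t))" "monic_deg q (root_part (- B) (P t))" if "t \<in> ball t0 e" for t
        using e1(3)[of t] e2(3)[of t] e(2,3) that lead_coeff_root_part unfolding monic_deg_def p_def q_def by blast+
      have ctB: "contact_at (\<lambda>t. root_part A (P t)) t" if t: "t \<in> ball t0 e" for A t
      proof (rule contact_at_divisor)
        have tS: "t \<in> S" using t e(2) e1(2) by blast
        then show "contact_at P t" by (rule ct)
        have "\<forall>\<^sub>F s in at t. s \<in> S" using S tS by (simp add: eventually_at_in_open')
        then show "\<forall>\<^sub>F s in at t. \<forall>z. poly (root_part A (P s)) z = 0 \<longrightarrow> poly (P s) z = 0"
          by eventually_elim (use root_part_root m in blast)
        show "poly (P t) z = 0" if "poly (root_part A (P t)) z = 0" for z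
          using root_part_root[OF m[OF tS]] that by blast
      qed
      have CkB: "Ck_poly_on n (\<lambda>t. root_part B (P t)) (ball t0 e)" "Ck_poly_on n (\<lambda>t. root_part (- B) (P t)) (ball t0 e)"
        using e1(4) e2(4) e(2,3) unfolding Ck_poly_on_def by (blast intro: Ck_on_subset)+
      obtain \<tau> where \<tau>: "diff_param p (\<lambda>t. root_part B (P t)) (ball t0 e) \<tau>"
        using less.IH[of p "ball t0 e" "\<lambda>t. root_part B (P t)"] mB CkB ctB pq \<open>q > 0\<close> dn by auto
      obtain \<sigma> where \<sigma>: "diff_param q (\<lambda>t. root_part (- B) (P t)) (ball t0 e) \<sigma>"
        using less.IH[of q "ball t0 e" "\<lambda>t. root_part (- B) (P t)"] mB CkB ctB pq \<open>p > 0\<close> dn by auto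
      have "P t = root_part B (P t) * root_part (- B) (P t)" if "t \<in> ball t0 e" for t
        using root_part_mult[OF m] that e(2) e1(2) by (metis subsetD)
      from diff_param_append[OF \<tau> \<sigma> this] pq have "\<exists>\<rho>. diff_param d P (ball t0 e) \<rho>" by simp
      moreover have "ball t0 e \<subseteq> S - E"
      proof
        fix t assume t: "t \<in> ball t0 e"
        then have tS: "t \<in> S" using e(2) e1(2) by blast
        obtain x where "poly (root_part B (P t)) x = 0"
          using monic_deg_root_near[OF mB(1)[OF t] \<open>p > 0\<close>] by blast
        then have x: "poly (P t) x = 0" "x \<in> B" using root_part_root[OF m[OF tS], of B x] by auto
        obtain y where "poly (root_part (- B) (P t)) y = 0"
          using monic_deg_root_near[OF mB(2)[OF t] \<open>q > 0\<close>] by blast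
        then have y: "poly (P t) y = 0" "y \<notin> B" using root_part_root[OF m[OF tS], of "- B" y] by auto
        show "t \<in> S - E" using tS x y unfolding E_def by blast
      qed
      ultimately show ?thesis using e(1) by blast
    qed
    have cluster: "\<exists>\<nu> \<mu> w. root_tuple d (\<lambda>j. \<nu>) (P t0) \<and>
        (\<forall>\<^sub>F t in at t0. root_tuple d (\<lambda>j. \<nu> + of_real (t - t0) * \<mu> t j) (P t)) \<and>
        (\<forall>j\<in>{1..d}. ((\<lambda>t. \<mu> t j) \<longlongrightarrow> w j) (at t0))" if t0: "t0 \<in> E" for t0
    proof -
      have t0S: "t0 \<in> S" using t0 by (simp add: E_def)
      obtain \<nu> where \<nu>: "\<And>z. poly (P t0) z = 0 \<Longrightarrow> z = \<nu>" using t0 by (auto simp: E_def)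
      obtain w0 where w0: "root_tuple d w0 (P t0)" using monic_deg_imp_root_tuple[OF m[OF t0S]] by blast
      have "w0 j = \<nu>" if "j \<in> {1..d}" for j
        using root_tuple_poly_eq_0_iff[OF w0] \<nu> that by blast
      then have "(\<Prod>j=1..d. [:- w0 j, 1:]) = (\<Prod>j=1..d. [:- \<nu>, 1:])" by (intro prod.cong refl) simp
      then have "root_tuple d (\<lambda>j. \<nu>) (P t0)" using w0 by (simp only: root_tuple_def)
      moreover from contact_imp_slopes_tendsto[OF S t0S m Ck d1 dn \<nu> ct[OF t0S]] obtain \<mu> w where
        "\<forall>\<^sub>F t in at t0. root_tuple d (\<lambda>j. \<nu> + of_real (t - t0) * \<mu> t j) (P t)"
        "\<forall>j\<in>{1..d}. ((\<lambda>t. \<mu> t j) \<longlongrightarrow> w j) (at t0)" by blast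
      ultimately show ?thesis by blast
    qed
    \<comment> \<open>The points of \<open>S\<close> at which \<open>E\<close> does not accumulate.
      This set is open and contains the isolated points of \<open>E\<close>.\<close>
    define U where "U = {t\<in>S. \<exists>e>0. ball t e \<subseteq> S \<and> ball t e \<inter> E \<subseteq> {t}}"
    have "open U"
      unfolding open_contains_ball
    proof
      fix t assume "t \<in> U"
      then obtain e where e: "e > 0" "ball t e \<subseteq> S" "ball t e \<inter> E \<subseteq> {t}" by (auto simp: U_def)
      have "s \<in> U" if s: "s \<in> ball t e" for s
      proof (cases "s = t")
        case True
        then show ?thesis using \<open>t \<in> U\<close> by simp
      next
        case False
        have "open (ball t e - {t})" by (intro open_Diff) auto
        then obtain r where "r > 0" "ball s r \<subseteq> ball t e - {t}" using s False open_contains_ball by blast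
        then show ?thesis using e s unfolding U_def by blast
      qed
      then show "\<exists>e>0. ball t e \<subseteq> U" using e(1) by blast
    qed
    have loc: "\<exists>e>0. \<exists>\<rho>. diff_param d P (ball t e) \<rho>" if t: "t \<in> U" for t
    proof (cases "t \<in> E")
      case False
      then show ?thesis using off[of t] t by (auto simp: U_def)
    next
      case True
      obtain e where e: "e > 0" "ball t e \<subseteq> S" "ball t e \<inter> E \<subseteq> {t}" using t by (auto simp: U_def)
      \<comment> \<open>On either side of \<open>t\<close> the interval avoids \<open>E\<close>, so
        the local parameterizations there combine to one on each side.\<close>
      have half: "\<exists>\<rho>. diff_param d P T \<rho>" if "open T" "T \<subseteq> ball t e - {t}" for T
        by (rule diff_param_open[OF that(1)]) (use off that(2) e in blast)
      have "{t - e<..<t} \<subseteq> ball t e - {t}" "{t<..<t + e} \<subseteq> ball t e - {t}" by (auto simp: dist_real_def)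
      then obtain \<rho>L \<rho>R where "diff_param d P {t - e<..<t} \<rho>L" "diff_param d P {t<..<t + e} \<rho>R"
        using half by (meson open_greaterThanLessThan)
      moreover obtain \<nu> \<mu> w where "root_tuple d (\<lambda>j. \<nu>) (P t)"
        "\<forall>\<^sub>F s in at t. root_tuple d (\<lambda>j. \<nu> + of_real (s - t) * \<mu> s j) (P s)"
        "\<forall>j\<in>{1..d}. ((\<lambda>s. \<mu> s j) \<longlongrightarrow> w j) (at t)"
        using cluster[OF True] by (elim exE conjE) (rule that; assumption)
      ultimately show ?thesis using diff_param_at_cluster[OF d1 e(1)] e(1) by blast
    qed
    then obtain \<rho>U where \<rho>U: "diff_param d P U \<rho>U" using diff_param_open[OF \<open>open U\<close>] by blast
    have US: "U \<subseteq> S" by (auto simp: U_def)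
    have SUE: "t \<in> E" if "t \<in> S - U" for t
    proof (rule ccontr)
      assume "t \<notin> E"
      then obtain e where "e > 0" "ball t e \<subseteq> S - E" using off[of t] \<open>t \<in> S - U\<close> by blast
      then have "t \<in> U" using that unfolding U_def by blast
      with that show False by blast
    qed
    have acc: "\<exists>\<^sub>F s in at t. \<exists>c. \<forall>z. poly (P s) z = 0 \<longrightarrow> z = c" if t: "t \<in> S - U" for t
    proof -
      have "\<exists>\<^sub>F s in at t. s \<in> E"
      proof (rule ccontr)
        assume "\<not> ?thesis"
        then have "\<forall>\<^sub>F s in at t. s \<notin> E" by (simp add: not_frequently)
        moreover have "\<forall>\<^sub>F s in at t. s \<in> S" using S t by (simp add: eventually_at_in_open')
        ultimately have "\<forall>\<^sub>F s in at t. s \<in> S \<and> (s \<in> E \<longrightarrow> s = t)" by eventually_elim blast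
        from eventually_at_imp_ball[OF this] t obtain e where
          "e > 0" "\<forall>s\<in>ball t e. s \<in> S \<and> (s \<in> E \<longrightarrow> s = t)" by blast
        then have "t \<in> U" using t unfolding U_def by blast
        then show False using t by blast
      qed
      then show ?thesis by (rule frequently_elim1) (simp add: E_def)
    qed
    define c where "c t = (SOME \<nu>. root_tuple d (\<lambda>j. \<nu>) (P t))" for t
    have c: "root_tuple d (\<lambda>j. c t) (P t)" if "t \<in> E" for t
    proof -
      have "\<exists>\<nu>. root_tuple d (\<lambda>j. \<nu>) (P t)" using cluster[OF that] by blast
      then show ?thesis unfolding c_def by (rule someI_ex)
    qed
    \<comment> \<open>Since \<open>S - U\<close> is contained in \<open>E\<close>, outside
      \<open>U\<close> the root tuple is forced to be constant in \<open>j\<close>.\<close>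
    define \<rho> where "\<rho> j t = (if t \<in> U then \<rho>U j t else c t)" for j t
    have \<rho>: "root_tuple d (\<lambda>j. \<rho> j t) (P t)" if "t \<in> S" for t
      using diff_param_root_tuple[OF \<rho>U, of t] c[OF SUE, of t] that by (cases "t \<in> U") (simp_all add: \<rho>_def)
    have "diff_param d P S \<rho>"
      unfolding diff_param_def root_parameterization_def
    proof (intro conjI ballI)
      fix j t assume j: "j \<in> {1..d}" and tS: "t \<in> S"
      show "\<rho> j differentiable (at t)"
      proof (cases "t \<in> U")
        case True
        show ?thesis
          by (rule differentiable_transform_open[OF diff_param_differentiable[OF \<rho>U j True] \<open>open U\<close> True])
            (simp add: \<rho>_def)
      next
        case False
        then have tSU: "t \<in> S - U" using tS by blast
        obtain \<nu> \<mu> w where \<nu>: "root_tuple d (\<lambda>j. \<nu>) (P t)"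
          and \<mu>: "\<forall>\<^sub>F s in at t. root_tuple d (\<lambda>j. \<nu> + of_real (s - t) * \<mu> s j) (P s)"
          and w: "\<forall>j\<in>{1..d}. ((\<lambda>s. \<mu> s j) \<longlongrightarrow> w j) (at t)"
          using cluster[OF SUE[OF tSU]] by (elim exE conjE) (rule that; assumption)
        have "poly (P t) (\<rho> j t) = 0" using root_tuple_poly_eq_0_iff[OF \<rho>[OF tS]] j by blast
        then have \<rho>t: "\<rho> j t = \<nu>" using root_tuple_poly_eq_0_iff[OF \<nu>] by blast
        have "\<forall>\<^sub>F s in at t. s \<in> S" using S tS by (simp add: eventually_at_in_open')
        then have "\<forall>\<^sub>F s in at t. root_tuple d (\<lambda>j. \<rho> j s) (P s)" by eventually_elim (rule \<rho>)
        from cluster_accumulation_differentiable[OF j \<mu> bspec[OF w] acc[OF tSU] this \<rho>t] show ?thesis .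
      qed
    qed (rule \<rho>)
    then show ?thesis by blast
  qed
qed

section \<open>The equivalence\<close>

lemma coeff_monic_curve:
  "coeff (monic_curve n a t) i = (if i = n then 1 else if i < n then (-1) ^ (n - i) * a (n - i) t else 0)"
proof -
  have "coeff (monic_curve n a t) i =
      (if i = n then 1 else 0) + (\<Sum>j=1..n. if n - j = i then (-1) ^ j * a j t else 0)"
    by (auto simp: monic_curve_def coeff_sum)
  also have "(\<Sum>j=1..n. if n - j = i then (-1) ^ j * a j t else 0) =
      (\<Sum>j=1..n. if j = n - i then (if i < n then (-1) ^ j * a j t else 0) else 0)"
    by (intro sum.cong refl) auto
  also have "\<dots> = (if i < n then (-1) ^ (n - i) * a (n - i) t else 0)"
    by (auto simp: sum.delta)
  finally show ?thesis by auto
qed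

lemma monic_deg_monic_curve: "monic_deg n (monic_curve n a t)"
proof -
  have "degree (monic_curve n a t) \<le> n" by (rule degree_le) (simp add: coeff_monic_curve)
  moreover have "coeff (monic_curve n a t) n = 1" by (simp add: coeff_monic_curve)
  ultimately show ?thesis
    unfolding monic_deg_def by (metis le_degree nle_le one_neq_zero)
qed

lemma Ck_monic_curve:
  assumes "\<forall>j\<in>{1..n}. Ck_on k (a j) S"
  shows "Ck_poly_on k (monic_curve n a) S"
  unfolding Ck_poly_on_def
proof
  fix i
  consider "i = n" | "i < n" | "i > n" by linarith
  then show "Ck_on k (\<lambda>t. coeff (monic_curve n a t) i) S"
  proof cases
    case 2
    then have "Ck_on k (a (n - i)) S" using assms by auto
    then show ?thesis using 2 by (simp add: coeff_monic_curve Ck_on_mult)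
  qed (simp_all add: coeff_monic_curve)
qed

lemma diff_param_iff:
  assumes "open S"
  shows "diff_param d P S \<rho> \<longleftrightarrow> root_parameterization d \<rho> P S \<and> (\<forall>j\<in>{1..d}. \<rho> j differentiable_on S)"
  using at_within_open[OF _ assms] by (simp add: diff_param_def differentiable_on_def)

lemma mult_at_geI:
  assumes "e > 0" "continuous_on (ball t0 e) g" "\<And>t. t \<in> ball t0 e \<Longrightarrow> f t = of_real (t - t0) ^ p * g t"
  shows "enat p \<le> mult_at t0 f"
  unfolding mult_at_def by (rule Sup_upper) (use assms in blast)

text \<open>The quotient \<open>f t / (t - t0)\<close>, filled in by the derivative, is continuous
  at \<open>t0\<close> by differentiability at that one point, and elsewhere because
  \<open>f\<close> is.\<close>

lemma differentiable_zero_factor: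
  fixes f :: "real \<Rightarrow> complex"
  assumes "open S" "continuous_on S f" "f differentiable (at t0)" "f t0 = 0"
  shows "\<exists>g. continuous_on S g \<and> (\<forall>t. f t = of_real (t - t0) * g t)"
proof -
  obtain l where l: "((\<lambda>t. (f t - f t0) / of_real (t - t0)) \<longlongrightarrow> l) (at t0)"
    using assms(3) vector_derivative_works has_vector_derivative_iff_quotient_tendsto by blast
  define g where "g t = (if t = t0 then l else f t / of_real (t - t0))" for t
  have "isCont g t" if t: "t \<in> S" for t
  proof (cases "t = t0")
    case True
    have "\<forall>\<^sub>F t in at t0. (f t - f t0) / of_real (t - t0) = g t"
      using assms(4) by (simp add: eventually_at_filter g_def)
    from Lim_transform_eventually[OF l this] show ?thesis unfolding True isCont_def by (simp add: g_def[abs_def])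
  next
    case False
    have "isCont f t" using assms(1,2) t by (simp add: continuous_on_eq_continuous_at)
    then have "isCont (\<lambda>t. f t / of_real (t - t0)) t"
      using False by (intro continuous_intros) auto
    moreover have "\<forall>\<^sub>F s in nhds t. f s / of_real (s - t0) = g s"
      using False by (intro eventually_nhds_in_open[of "- {t0}", THEN eventually_mono]) (auto simp: g_def)
    ultimately show ?thesis using isCont_cong by fastforce
  qed
  then have "continuous_on S g" by (intro continuous_at_imp_continuous_on) auto
  moreover have "f t = of_real (t - t0) * g t" for t
    using assms(4) by (cases "t = t0") (auto simp: g_def simp flip: of_real_diff)
  ultimately show ?thesis by blast
qed

lemma mult_at_ge_1_imp_differentiable:
  assumes "1 \<le> mult_at t0 f"
  shows "f differentiable (at t0)"
proof -
  obtain p g e where pg: "p \<ge> 1" "e > 0" "continuous_on (ball t0 e) g"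
    "\<forall>t\<in>ball t0 e. f t = of_real (t - t0) ^ p * g t"
    using mult_at_imp_factor[of 1 t0 f] assms by (auto simp: one_enat_def)
  define h where "h t = of_real (t - t0) ^ (p - 1) * g t" for t
  \<comment> \<open>Surplus factors \<open>t - t0\<close> are absorbed into the continuous
    cofactor.\<close>
  have fh: "f t = of_real (t - t0) * h t" if "t \<in> ball t0 e" for t
    using pg(1) bspec[OF pg(4) that] by (cases p) (simp_all add: h_def)
  have "isCont g t0" using pg(2,3) by (simp add: continuous_on_eq_continuous_at)
  then have "isCont h t0" unfolding h_def by (intro continuous_intros)
  then have "(h \<longlongrightarrow> h t0) (at t0)" by (simp add: isCont_def)
  moreover have "\<forall>\<^sub>F t in at t0. t \<in> ball t0 e" using pg(2) by (intro eventually_at_in_open') auto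
  then have "\<forall>\<^sub>F t in at t0. t \<in> ball t0 e \<and> t \<noteq> t0"
    by (simp add: eventually_conj_iff eventually_at_filter)
  then have "\<forall>\<^sub>F t in at t0. h t = (f t - f t0) / of_real (t - t0)"
    by eventually_elim (use fh[of t0] fh pg(2) in \<open>auto simp flip: of_real_diff\<close>)
  ultimately have "((\<lambda>t. (f t - f t0) / of_real (t - t0)) \<longlongrightarrow> h t0) (at t0)"
    by (rule Lim_transform_eventually)
  then have "(f has_vector_derivative h t0) (at t0)"
    by (simp only: has_vector_derivative_iff_quotient_tendsto)
  then show ?thesis by (rule differentiableI_vector)
qed

lemma diff_param_imp_contact:
  assumes "open S" "diff_param d P S \<rho>" "t0 \<in> S" "i \<in> {1..d}" "j \<in> {1..d}" "\<rho> i t0 = \<rho> j t0"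
  obtains g where "continuous_on S g" "\<And>t. \<rho> i t - \<rho> j t = of_real (t - t0) * g t"
proof -
  have "continuous_on S (\<lambda>t. \<rho> i t - \<rho> j t)"
    using assms(4,5) diff_param_differentiable[OF assms(2)]
    by (intro continuous_at_imp_continuous_on ballI continuous_diff)
      (auto intro: differentiable_imp_continuous_within)
  moreover have "(\<lambda>t. \<rho> i t - \<rho> j t) differentiable (at t0)"
    using assms(3-5) diff_param_differentiable[OF assms(2)] by (intro differentiable_diff) auto
  ultimately show ?thesis
    using differentiable_zero_factor[OF assms(1), of "\<lambda>t. \<rho> i t - \<rho> j t" t0] assms(6) that by auto
qed

text \<open>The sum of the roots in a cluster is a coefficient of a factor in the splitting, hence
  differentiable, and the differences are differentiable by the order of contact.\<close>

lemma contact_param_imp_differentiable: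
  assumes "open S" "t0 \<in> S" "Ck_poly_on n P S" "1 \<le> n"
    and \<rho>: "root_parameterization d \<rho> P S" "\<And>j. j \<in> {1..d} \<Longrightarrow> continuous_on S (\<rho> j)"
    and i: "i \<in> {1..d}"
    and contact: "\<And>j. j \<in> {1..d} \<Longrightarrow> i \<noteq> j \<Longrightarrow> \<rho> i t0 = \<rho> j t0 \<Longrightarrow> 1 \<le> mult_at t0 (\<lambda>t. \<rho> i t - \<rho> j t)"
  shows "\<rho> i differentiable (at t0)"
proof -
  \<comment> \<open>The indices of the roots that meet \<open>\<rho> i\<close> at \<open>t0\<close>.
    Their factor and the complementary one have no common root at \<open>t0\<close>, so its
    coefficients are differentiable there.\<close>
  define C where "C = {j\<in>{1..d}. \<rho> j t0 = \<rho> i t0}"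
  define Q where "Q t = (\<Prod>j\<in>C. [:- \<rho> j t, 1:])" for t
  define R where "R t = (\<Prod>j\<in>{1..d} - C. [:- \<rho> j t, 1:])" for t
  have C: "C \<subseteq> {1..d}" "finite C" "i \<in> C" using i by (auto simp: C_def)
  have QR: "Q t * R t = P t" if "t \<in> S" for t
  proof -
    have "P t = (\<Prod>j=1..d. [:- \<rho> j t, 1:])"
      using \<rho>(1) that by (auto simp: root_parameterization_def root_tuple_def)
    also have "\<dots> = R t * Q t"
      unfolding Q_def R_def using C(1) by (intro prod.subset_diff) auto
    finally show ?thesis by (simp add: mult.commute)
  qed
  have cont: "(\<rho> j \<longlongrightarrow> \<rho> j t0) (at t0)" if "j \<in> {1..d}" for j
    using \<rho>(2)[OF that] assms(1,2) by (simp add: continuous_on_eq_continuous_at isCont_def)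
  have Rt: "poly_tendsto R (R t0) (at t0)"
    unfolding R_def by (intro poly_tendsto_prod poly_tendsto_linear cont) auto
  have lead: "degree (\<Prod>j\<in>A. [:- \<rho> j t, 1:]) = card A \<and> lead_coeff (\<Prod>j\<in>A. [:- \<rho> j t, 1:]) = 1" for A t
    by (rule conjI) (simp add: degree_prod_eq_sum_degree, simp add: lead_coeff_prod)
  have co: "poly (R t0) z \<noteq> 0" if "poly (Q t0) z = 0" for z
    using that C(2) by (auto simp: Q_def R_def poly_prod C_def)
  note Pd = Ck_poly_on_differentiable[OF assms(3,4,1,2)]
  obtain c where c: "card C = Suc c" using C(2,3) by (metis card_0_eq empty_iff not0_implies_Suc)
  obtain l where "((\<lambda>t. coeff (Q t) c) has_vector_derivative l) (at t0)"
    using factor_differentiable[OF assms(1,2) QR _ _ Rt co Pd, of "card C" "card ({1..d} - C)" c] lead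
    unfolding Q_def R_def by blast
  then have "(\<lambda>t. coeff (Q t) c) differentiable (at t0)" by (rule differentiableI_vector)
  moreover have "coeff (Q t) c = - (\<Sum>j\<in>C. \<rho> j t)" for t
    unfolding Q_def by (rule coeff_prod_linear_sum[OF C(2) c])
  ultimately have s: "(\<lambda>t. - (\<Sum>j\<in>C. \<rho> j t)) differentiable (at t0)" by simp
  have diff: "(\<lambda>t. \<rho> i t - \<rho> j t) differentiable (at t0)" if "j \<in> C" for j
  proof (cases "i = j")
    case False
    then show ?thesis using that contact[of j] by (intro mult_at_ge_1_imp_differentiable) (auto simp: C_def)
  qed simp
  \<comment> \<open>A root is the mean of its cluster plus the mean of its differences from the
    members of the cluster.\<close>
  have eq: "\<rho> i t = (1 / real (card C)) *\<^sub>R ((\<Sum>j\<in>C. \<rho> i t - \<rho> j t) - (- (\<Sum>j\<in>C. \<rho> j t)))" for t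
    by (simp add: sum_subtractf c scaleR_conv_of_real del: of_nat_Suc)
  have "(\<lambda>t. (1 / real (card C)) *\<^sub>R ((\<Sum>j\<in>C. \<rho> i t - \<rho> j t) - (- (\<Sum>j\<in>C. \<rho> j t)))) differentiable (at t0)"
    by (intro differentiable_scaleR differentiable_const differentiable_diff differentiable_sum diff s C(2) ballI)
  then show ?thesis by (simp only: eq[symmetric])
qed

section \<open>Multiplicity of \<open>Delta k\<close> for a differentiable parameterization\<close>

lemma root_part_distrib:
  "p \<noteq> 0 \<Longrightarrow> q \<noteq> 0 \<Longrightarrow> root_part B (p * q) = root_part B p * root_part B q"
  by (simp add: root_part_def proots_mult)

lemma root_part_prod:
  "(\<And>i. i \<in> A \<Longrightarrow> f i \<noteq> 0) \<Longrightarrow> root_part B (\<Prod>i\<in>A. f i) = (\<Prod>i\<in>A. root_part B (f i))"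
proof (induction A rule: infinite_finite_induct)
  case (insert a A)
  then have "(\<Prod>i\<in>A. f i) \<noteq> 0" by (cases "finite A") auto
  then show ?case using insert by (simp add: root_part_distrib)
qed (simp_all add: root_part_def)

lemma root_part_eq_self:
  assumes "monic_deg d p" "\<And>z. poly p z = 0 \<Longrightarrow> z \<in> B"
  shows "root_part B p = p"
proof -
  obtain \<mu> where \<mu>: "root_tuple d \<mu> p" using monic_deg_imp_root_tuple assms by blast
  have "{j\<in>{1..d}. \<mu> j \<in> B} = {1..d}" using assms(2) root_tuple_poly_eq_0_iff[OF \<mu>] by blast
  then show ?thesis using \<mu> root_part_eq[OF \<mu>, of B] by (simp only: root_tuple_def)
qed

lemma root_part_eq_1:
  assumes "monic_deg d p" "\<And>z. poly p z = 0 \<Longrightarrow> z \<notin> B"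
  shows "root_part B p = 1"
proof -
  obtain \<mu> where \<mu>: "root_tuple d \<mu> p" using monic_deg_imp_root_tuple assms by blast
  have "{j\<in>{1..d}. \<mu> j \<in> B} = {}" using assms(2) root_tuple_poly_eq_0_iff[OF \<mu>] by blast
  then show ?thesis unfolding root_part_eq[OF \<mu>] by (simp only: prod.empty)
qed

text \<open>The splitting is an arbitrary one, so \<open>Q i\<close> must be recognized as the
  product over the parameterized roots that equal \<open>\<nu> i\<close> at \<open>t0\<close>. These
  differ pairwise by \<open>t - t0\<close> times a continuous function, and each summand of
  \<open>Delta k\<close> collects \<open>k * (k - 1)\<close> such factors.\<close>

lemma diff_param_imp_Delta_mult:
  assumes "open S" "t0 \<in> S" "diff_param n P S \<rho>" "splitting_at N P t0 l Q"
    and "i \<in> {1..l}" "2 \<le> k" "k \<le> degree (Q i t0)"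
  shows "enat (k * (k - 1)) \<le> mult_at t0 (\<lambda>t. Delta k (Q i t))"
proof -
  note i = assms(5)
  obtain \<nu> m where \<nu>: "inj_on \<nu> {1..l}"
    and Qt0: "\<forall>i\<in>{1..l}. 1 \<le> m i \<and> Q i t0 = [:- \<nu> i, 1:] ^ m i"
    and Pt0: "P t0 = (\<Prod>i=1..l. Q i t0)"
    and evP: "\<forall>\<^sub>F t in at t0. P t = (\<Prod>i=1..l. Q i t)"
    and evQ: "\<forall>i\<in>{1..l}. \<forall>\<^sub>F t in at t0. monic_deg (m i) (Q i t)"
    and roots: "\<forall>i\<in>{1..l}. \<forall>U. open U \<longrightarrow> \<nu> i \<in> U \<longrightarrow>
        (\<forall>\<^sub>F t in at t0. \<forall>z. poly (Q i t) z = 0 \<longrightarrow> z \<in> U)"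
    using splitting_at_factor_roots[OF assms(4)] by (elim exE conjE) (rule that; assumption)
  have deg: "degree (Q j t0) = m j" if "j \<in> {1..l}" for j
    using bspec[OF Qt0 that] by (simp add: degree_linear_power)
  have mon0: "monic_deg (m j) (Q j t0)" if "j \<in> {1..l}" for j
  proof -
    have "lead_coeff ([:- \<nu> j, 1:] ^ m j) = 1" by (subst lead_coeff_power) simp
    then show ?thesis using bspec[OF Qt0 that] deg[OF that] by (metis monic_deg_def)
  qed
  have root0: "z = \<nu> j" if "j \<in> {1..l}" "poly (Q j t0) z = 0" for j z
    using bspec[OF Qt0 that(1)] that(2) by (simp add: poly_power)
  obtain \<eta> where \<eta>: "\<eta> > 0" "\<forall>z\<in>\<nu> ` {1..l} - {\<nu> i}. \<eta> < dist (\<nu> i) z"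
    using isolating_ball[of "\<nu> ` {1..l}" "\<nu> i"] by auto
  define B where "B = ball (\<nu> i) \<eta>"
  define A where "A = {j\<in>{1..n}. \<rho> j t0 = \<nu> i}"
  have sep: "\<nu> j \<in> - cball (\<nu> i) \<eta>" if "j \<in> {1..l}" "j \<noteq> i" for j
  proof -
    have "\<nu> j \<noteq> \<nu> i" using inj_on_eq_iff[OF \<nu> that(1) i] that(2) by simp
    then have "\<eta> < dist (\<nu> i) (\<nu> j)" using \<eta>(2) that(1) by blast
    then show ?thesis by simp
  qed
  have far: "- cball (\<nu> i) \<eta> \<subseteq> - B" by (auto simp: B_def)
  have \<rho>0: "\<rho> j t0 \<in> - cball (\<nu> i) \<eta>" if "j \<in> {1..n} - A" for j
  proof -
    have "poly (P t0) (\<rho> j t0) = 0"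
      using root_tuple_poly_eq_0_iff[OF diff_param_root_tuple[OF assms(3,2)]] that by blast
    then have "(\<Prod>i=1..l. poly (Q i t0) (\<rho> j t0)) = 0" by (simp only: Pt0 poly_prod)
    then obtain j' where j': "j' \<in> {1..l}" "poly (Q j' t0) (\<rho> j t0) = 0" by auto
    then have "\<rho> j t0 = \<nu> j'" using root0 by blast
    moreover from this have "j' \<noteq> i" using that by (auto simp: A_def)
    ultimately show ?thesis using sep[OF j'(1)] by simp
  qed
  \<comment> \<open>\<open>G\<close> localizes the roots of the given factors and the parameterized
    roots simultaneously: those of the cluster at \<open>\<nu> i\<close> inside \<open>B\<close>,
    all others outside the closed ball. Both then describe the same root part of
    \<open>P t\<close>.\<close>
  define G where "G t \<longleftrightarrow> t \<in> S \<and> P t = (\<Prod>i=1..l. Q i t) \<and> (\<forall>j\<in>{1..l}. monic_deg (m j) (Q j t)) \<and>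
    (\<forall>z. poly (Q i t) z = 0 \<longrightarrow> z \<in> B) \<and>
    (\<forall>j\<in>{1..l} - {i}. \<forall>z. poly (Q j t) z = 0 \<longrightarrow> z \<in> - cball (\<nu> i) \<eta>) \<and>
    (\<forall>j\<in>A. \<rho> j t \<in> B) \<and> (\<forall>j\<in>{1..n} - A. \<rho> j t \<in> - cball (\<nu> i) \<eta>)" for t
  have cont: "(\<rho> j \<longlongrightarrow> \<rho> j t0) (at t0)" if "j \<in> {1..n}" for j
    using differentiable_imp_continuous_within[OF diff_param_differentiable[OF assms(3) that assms(2)]]
    by (simp only: continuous_at)
  have "\<forall>\<^sub>F t in at t0. G t"
    unfolding G_def
  proof (intro eventually_conj eventually_ball_finite ballI evP)
    show "\<forall>\<^sub>F t in at t0. t \<in> S" using assms(1,2) by (rule eventually_at_in_open')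
    show "\<forall>\<^sub>F t in at t0. monic_deg (m j) (Q j t)" if "j \<in> {1..l}" for j using evQ that by blast
    show "\<forall>\<^sub>F t in at t0. \<forall>z. poly (Q i t) z = 0 \<longrightarrow> z \<in> B"
      using spec[OF bspec[OF roots i], of B] \<eta>(1) by (simp add: B_def)
    show "\<forall>\<^sub>F t in at t0. \<forall>z. poly (Q j t) z = 0 \<longrightarrow> z \<in> - cball (\<nu> i) \<eta>" if "j \<in> {1..l} - {i}" for j
    proof -
      have j: "j \<in> {1..l}" "j \<noteq> i" using that by auto
      have "open (- cball (\<nu> i) \<eta>)" by (intro open_Compl closed_cball)
      then show ?thesis using spec[OF bspec[OF roots j(1)]] sep[OF j] by blast
    qed
    show "\<forall>\<^sub>F t in at t0. \<rho> j t \<in> B" if "j \<in> A" for j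
      using that \<eta>(1) by (intro topological_tendstoD[OF cont]) (auto simp: A_def B_def)
    show "\<forall>\<^sub>F t in at t0. \<rho> j t \<in> - cball (\<nu> i) \<eta>" if "j \<in> {1..n} - A" for j
      using that \<rho>0[OF that] by (intro topological_tendstoD[OF cont]) auto
  qed (auto simp: A_def)
  moreover have "G t0"
    unfolding G_def
  proof (intro conjI ballI allI impI)
    show "z \<in> B" if "poly (Q i t0) z = 0" for z using root0[OF i that] \<eta>(1) by (simp add: B_def)
    show "z \<in> - cball (\<nu> i) \<eta>" if "j \<in> {1..l} - {i}" "poly (Q j t0) z = 0" for j z
      using root0[of j z] sep[of j] that by simp
    show "\<rho> j t0 \<in> B" if "j \<in> A" for j using that \<eta>(1) by (simp add: A_def B_def)
  qed (use assms(2) Pt0 mon0 \<rho>0 in auto)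
  ultimately obtain e where e: "e > 0" "\<And>t. t \<in> ball t0 e \<Longrightarrow> G t"
    using eventually_at_imp_ball by blast
  have Qi: "Q i t = (\<Prod>j\<in>A. [:- \<rho> j t, 1:])" if "t \<in> ball t0 e" for t
  proof -
    have G: "t \<in> S" "P t = (\<Prod>i=1..l. Q i t)" "\<forall>j\<in>{1..l}. monic_deg (m j) (Q j t)"
      "\<forall>z. poly (Q i t) z = 0 \<longrightarrow> z \<in> B"
      "\<forall>j\<in>{1..l} - {i}. \<forall>z. poly (Q j t) z = 0 \<longrightarrow> z \<in> - cball (\<nu> i) \<eta>"
      "\<forall>j\<in>A. \<rho> j t \<in> B" "\<forall>j\<in>{1..n} - A. \<rho> j t \<in> - cball (\<nu> i) \<eta>"
      using e(2)[OF that] unfolding G_def by blast+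
    have "{j\<in>{1..n}. \<rho> j t \<in> B} = A"
    proof
      show "{j\<in>{1..n}. \<rho> j t \<in> B} \<subseteq> A" using G(7) far by blast
      show "A \<subseteq> {j\<in>{1..n}. \<rho> j t \<in> B}" using G(6) by (auto simp: A_def)
    qed
    then have 1: "root_part B (P t) = (\<Prod>j\<in>A. [:- \<rho> j t, 1:])"
      unfolding root_part_eq[OF diff_param_root_tuple[OF assms(3) G(1)]] by (simp only:)
    have "Q j t \<noteq> 0" if "j \<in> {1..l}" for j
      using bspec[OF G(3) that] by (auto simp: monic_deg_def)
    then have "root_part B (P t) = (\<Prod>j=1..l. root_part B (Q j t))"
      unfolding G(2) by (rule root_part_prod)
    also have "\<dots> = (\<Prod>j=1..l. if j = i then Q i t else 1)"
    proof (rule prod.cong[OF refl])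
      fix j assume j: "j \<in> {1..l}"
      show "root_part B (Q j t) = (if j = i then Q i t else 1)"
      proof (cases "j = i")
        case True
        then show ?thesis using root_part_eq_self[OF bspec[OF G(3) i], of B] G(4) by simp
      next
        case False
        then have "z \<notin> B" if "poly (Q j t) z = 0" for z using G(5) j that far by blast
        then show ?thesis using root_part_eq_1[OF bspec[OF G(3) j]] False by simp
      qed
    qed
    also have "\<dots> = Q i t" using i by simp
    finally show ?thesis using 1 by simp
  qed
  have t0e: "t0 \<in> ball t0 e" using e(1) by simp
  have finA: "finite A" by (simp add: A_def)
  have "degree (Q i t0) = card A"
    unfolding Qi[OF t0e] by (simp add: degree_prod_eq_sum_degree)
  then have cA: "card A = m i" using deg[OF i] by simp
  \<comment> \<open>\<open>Delta_tuple\<close> expects the roots to be numbered from 1 to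
    \<open>m i\<close>, whence the renumbering of \<open>A\<close>.\<close>
  then obtain h where h: "bij_betw h {1..m i} A"
    using ex_bij_betw_nat_finite_1[OF finA] by auto
  have hA: "h j \<in> {1..n}" "\<rho> (h j) t0 = \<nu> i" if "j \<in> {1..m i}" for j
    using bij_betwE[OF h] that by (auto simp: A_def)
  have "\<exists>g. continuous_on S g \<and> (\<forall>t. \<rho> (h a) t - \<rho> (h b) t = of_real (t - t0) * g t)"
    if "a \<in> {1..m i}" "b \<in> {1..m i}" for a b
    using diff_param_imp_contact[OF assms(1,3,2) hA(1)[OF that(1)] hA(1)[OF that(2)]] hA(2)[OF that(1)] hA(2)[OF that(2)]
    by metis
  then obtain g where g: "\<And>a b. a \<in> {1..m i} \<Longrightarrow> b \<in> {1..m i} \<Longrightarrow> continuous_on S (g a b)"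
    "\<And>a b t. a \<in> {1..m i} \<Longrightarrow> b \<in> {1..m i} \<Longrightarrow> \<rho> (h a) t - \<rho> (h b) t = of_real (t - t0) * g a b t"
    by metis
  \<comment> \<open>The continuous cofactor that remains after \<open>t - t0\<close> is taken out of
    every difference; the sign comes from passing from squares to ordered pairs.\<close>
  define H where "H t = (\<Sum>A | A \<subseteq> {1..m i} \<and> card A = k.
      (-1) ^ (k * (k - 1) div 2) * (\<Prod>a\<in>A. \<Prod>b\<in>A - {a}. g a b t))" for t
  have "continuous_on S H"
    unfolding H_def by (intro continuous_intros g(1)) auto
  moreover have "ball t0 e \<subseteq> S" using e(2) unfolding G_def by blast
  ultimately have cont_H: "continuous_on (ball t0 e) H" using continuous_on_subset by blast
  show ?thesis
  proof (rule mult_at_geI[OF e(1) cont_H])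
    fix t assume t: "t \<in> ball t0 e"
    have "root_tuple (m i) (\<lambda>j. \<rho> (h j) t) (Q i t)"
      unfolding root_tuple_def Qi[OF t] using h by (rule prod.reindex_bij_betw[symmetric])
    from Delta_eq[OF this] have "Delta k (Q i t) = Delta_tuple k (m i) (\<lambda>j. \<rho> (h j) t)" .
    also have "\<dots> = of_real (t - t0) ^ (k * (k - 1)) * H t"
      unfolding H_def by (rule Delta_tuple_factor) (rule g(2))
    finally show "Delta k (Q i t) = of_real (t - t0) ^ (k * (k - 1)) * H t" .
  qed
qed

theorem theorem4p3:
  fixes I :: "real set" and n :: nat and a :: "nat \<Rightarrow> real \<Rightarrow> complex"
    and P :: "real \<Rightarrow> complex poly"
  assumes "open I" and "is_interval I"
    and "\<forall>j\<in>{1..n}. Ck_on n (a j) I"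
    and "P = monic_curve n a"
  shows
    "((\<exists>\<rho>. root_parameterization n \<rho> P I \<and> (\<forall>j\<in>{1..n}. \<rho> j differentiable_on I))
      \<longleftrightarrow>
      (\<exists>\<rho>. root_parameterization n \<rho> P I \<and> (\<forall>j\<in>{1..n}. continuous_on I (\<rho> j)) \<and>
        (\<forall>t0\<in>I. \<forall>i\<in>{1..n}. \<forall>j\<in>{1..n}. i \<noteq> j \<and> \<rho> i t0 = \<rho> j t0 \<longrightarrow>
          mult_at t0 (\<lambda>t. \<rho> i t - \<rho> j t) \<ge> 1)))
     \<and>
     ((\<exists>\<rho>. root_parameterization n \<rho> P I \<and> (\<forall>j\<in>{1..n}. \<rho> j differentiable_on I))
      \<longleftrightarrow>
      (\<forall>t0\<in>I. \<forall>l Q. l = card {z. poly (P t0) z = 0} \<and> splitting_at n P t0 l Q \<longrightarrow>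
        (\<forall>i\<in>{1..l}. \<forall>k. 2 \<le> k \<and> k \<le> degree (Q i t0) \<longrightarrow>
          mult_at t0 (\<lambda>t. Delta k (Q i t)) \<ge> enat (k * (k - 1)))))"
    (is "(?A \<longleftrightarrow> ?B) \<and> (?A \<longleftrightarrow> ?C)")
proof -
  have m: "monic_deg n (P t)" for t unfolding assms(4) by (rule monic_deg_monic_curve)
  have Ck: "Ck_poly_on n P I" unfolding assms(4) by (rule Ck_monic_curve[OF assms(3)])
  have 1: "?A \<longleftrightarrow> (\<exists>\<rho>. diff_param n P I \<rho>)" by (simp only: diff_param_iff[OF assms(1)])
  have 12: ?B if prem: ?A
  proof -
    obtain \<rho> where \<rho>: "diff_param n P I \<rho>" using prem 1 by blast
    have "\<forall>j\<in>{1..n}. continuous_on I (\<rho> j)"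
      using \<rho> by (auto simp: diff_param_iff[OF assms(1)] intro: differentiable_imp_continuous_on)
    moreover have "1 \<le> mult_at t0 (\<lambda>t. \<rho> i t - \<rho> j t)"
      if t0: "t0 \<in> I" and ij: "i \<in> {1..n}" "j \<in> {1..n}" "\<rho> i t0 = \<rho> j t0" for t0 i j
    proof -
      obtain g where g: "continuous_on I g" "\<And>t. \<rho> i t - \<rho> j t = of_real (t - t0) * g t"
        using diff_param_imp_contact[OF assms(1) \<rho> t0 ij] by blast
      obtain e where "e > 0" "ball t0 e \<subseteq> I" using assms(1) t0 open_contains_ball by blast
      then have "enat 1 \<le> mult_at t0 (\<lambda>t. \<rho> i t - \<rho> j t)"
        using g by (intro mult_at_geI[of e _ g]) (auto intro: continuous_on_subset)
      then show ?thesis by (simp add: one_enat_def)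
    qed
    ultimately show ?thesis using \<rho> unfolding diff_param_def by blast
  qed
  have 21: ?A if prem: ?B
  proof -
    obtain \<rho> where \<rho>: "root_parameterization n \<rho> P I" "\<forall>j\<in>{1..n}. continuous_on I (\<rho> j)"
      "\<forall>t0\<in>I. \<forall>i\<in>{1..n}. \<forall>j\<in>{1..n}. i \<noteq> j \<and> \<rho> i t0 = \<rho> j t0 \<longrightarrow>
          1 \<le> mult_at t0 (\<lambda>t. \<rho> i t - \<rho> j t)" using prem by blast
    have "\<rho> i differentiable (at t0)" if "t0 \<in> I" "i \<in> {1..n}" for t0 i
      by (rule contact_param_imp_differentiable[OF assms(1) that(1) Ck _ \<rho>(1) _ that(2)])
        (use that \<rho>(2,3) in auto)
    then have "diff_param n P I \<rho>" using \<rho>(1) by (simp add: diff_param_def)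
    then show ?thesis using 1 by blast
  qed
  have 13: ?C if prem: ?A
  proof -
    obtain \<rho> where \<rho>: "diff_param n P I \<rho>" using prem 1 by blast
    show ?thesis using diff_param_imp_Delta_mult[OF assms(1) _ \<rho>] by blast
  qed
  have 31: ?A if prem: ?C
  proof -
    have "contact_at P t0" if t0: "t0 \<in> I" for t0
    proof -
      obtain Q where Q: "splitting_at n P t0 (card {z. poly (P t0) z = 0}) Q"
        using splitting_exists[OF assms(1) t0 m Ck] by blast
      show ?thesis by (rule splitting_imp_contact_at[OF Q]) (use prem t0 Q in blast)
    qed
    then have "\<exists>\<rho>. diff_param n P I \<rho>"
      by (intro contact_imp_diff_param[OF assms(1) m Ck order_refl])
    then show ?thesis using 1 by blast
  qed
  show ?thesis using 12 21 13 31 by blast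
qed

end
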